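(* Let $d\ge 1$ be an integer, $\tau>0$, $s\in\mathbb{R}$, $h\ge\tau$, and let $C\colon[s,+\infty)\times[-\tau,0]\to\mathbb{R}^{d\times d}$ be measurable. With the operators $V^{\pm},\mathcal{F},T,T_{M,N}$ defined in the context, assume that: (H1) $C\in L^{\infty}([s,s+h]\times[-\tau,0],\mathbb{R}^{d\times d})$; (H2) $\mathcal{F}V^{+}\colon X^{+}\to X^{+}$ has range contained in $H^{1,+}$ and $\mathcal{F}V^{+}\colon X^{+}\to H^{1,+}$ is bounded; (H3) $\mathcal{F}V^{-}\colon X\to X^{+}$ has range contained in $H^{1,+}$ and $\mathcal{F}V^{-}\colon X\to H^{1,+}$ is bounded. Then $\|T_{M,N}-T\|_{X\leftarrow X}\to 0$ for $N\to+\infty$ and $M\ge N-1$; that is, for every $\varepsilon>0$ there is $N_1$ such that $\|T_{M,N}-T\|_{X\leftarrow X}<\varepsilon$ for all integers $N\ge N_1$ and $M\ge N-1$.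
   Context: Spaces: $X=L^2([-\tau,0],\mathbb{R}^d)$, $X^+=L^2([0,h],\mathbb{R}^d)$, $X^{\pm}=L^2([-\tau,h],\mathbb{R}^d)$ with the usual $L^2$ norms; $H^{1,+}=H^1([0,h],\mathbb{R}^d)=W^{1,2}([0,h],\mathbb{R}^d)$ with $\|w\|_{H^{1,+}}^2=\|w\|_{X^+}^2+\|w'\|_{X^+}^2$; its elements are identified with their continuous representatives on $[0,h]$. $\|\cdot\|_{X\leftarrow X}$ is the operator norm on bounded linear operators $X\to X$. For a function $v$ on $[-\tau,h]$, $v_h\in X$ denotes $v_h(\theta)=v(h+\theta)$, $\theta\in[-\tau,0]$. Operators: $V\colon X\times X^+\to X^{\pm}$, $V(\phi,w)(t)=w(t)$ for $t\in(0,h]$ and $V(\phi,w)(t)=\phi(t)$ for $t\in[-\tau,0]$; $V^-\phi=V(\phi,0)$, $V^+w=V(0,w)$; $\mathcal{F}\colon X^{\pm}\to X^+$, $(\mathcal{F}v)(t)=\int_{-\tau}^0 C(s+t,\theta)v(t+\theta)\,d\theta$, $t\in[0,h]$. Exact operator: under (H1), for each $\phi\in X$ the equation $w=\mathcal{F}V(\phi,w)$ has a unique solution $w^*\in X^+$, and $T\colon X\to X$ is $T\phi=V(\phi,w^* )_h$. (Equivalently, $T=T(s+h,s)$ is the evolution operator $\phi\mapsto x(s+h+\cdot)$ of the renewal equation $x(t)=\int_{-\tau}^0C(t,\theta)x(t+\theta)\,d\theta$, $t>s$, with $x(s+\theta)=\phi(\theta)$ for $\theta\in[-\tau,0]$.)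 Discretization: let $\{\psi_i\}_{i\ge0}$ and $\{\psi_i^+\}_{i\ge0}$ be the Legendre polynomials on $[-\tau,0]$ and $[0,h]$ respectively, $M,N$ positive integers, and $\theta_1^+<\dots<\theta_N^+$ the zeros of $\psi_N^+$. Let $X_M=(\mathbb{R}^d)^{M+1}$, $X_N^+=(\mathbb{R}^d)^N$. $R_M\colon X\to X_M$ maps $\phi=\sum_{i\ge0}\phi_i\psi_i$ to its coefficients $(\phi_0,\dots,\phi_M)$; $P_M\colon X_M\to X$, $P_M\Phi=\sum_{i=0}^M\Phi_i\psi_i$. $R_N^+w=(w(\theta_1^+),\dots,w(\theta_N^+))$ for $w\in H^{1,+}$; $P_N^+\colon X_N^+\to X^+$, $P_N^+W=\sum_{i=1}^N\ell_i^+W_i$ with $\ell_i^+$ the Lagrange basis polynomials on the nodes $\theta_1^+,\dots,\theta_N^+$. Define $\mathbf{T}_{M,N}\colon X_M\to X_M$ by $\mathbf{T}_{M,N}\Phi=R_M\,V(P_M\Phi,P_N^+W^* )_h$, where $W^*\in X_N^+$ is the solution of $W=R_N^+\mathcal{F}V(P_M\Phi,P_N^+W)$; under (H1)–(H3) there is $N_0$ such that for all $N\ge N_0$ (and all $M$) this solution exists and is unique for every $\Phi$, so $\mathbf{T}_{M,N}$ is well defined. Finally $T_{M,N}=P_M\mathbf{T}_{M,N}R_M\colon X\to X$. *)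

theory Defs
  imports "HOL-Analysis.Analysis" "HOL-Computational_Algebra.Polynomial"
begin

text \<open>
  Elements of \<open>L\<^sup>2(A)\<close> are represented by functions on the whole line whose values outside \<open>A\<close>
  are irrelevant; no quotient is formed, so equality in \<open>L\<^sup>2(A)\<close> is equality almost everywhere
  on \<open>A\<close>, and \<open>L2norm A\<close> is a seminorm on representatives.
\<close>

definition L2 :: "real set \<Rightarrow> (real \<Rightarrow> real^'d) set" where
  "L2 A = {f. f \<in> borel_measurable (lebesgue_on A) \<and>
              integrable (lebesgue_on A) (\<lambda>t. (norm (f t))\<^sup>2)}"

definition L2norm :: "real set \<Rightarrow> (real \<Rightarrow> real^'d) \<Rightarrow> real" where
  "L2norm A f = sqrt (\<integral>t. (norm (f t))\<^sup>2 \<partial>(lebesgue_on A))"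

text \<open>
  The infimum is \<open>\<infinity>\<close> if \<open>S\<close> is not bounded or does not map \<open>L\<^sup>2(A)\<close> to itself, so
  an upper bound \<open>L2_opnorm A S < \<epsilon>\<close> includes boundedness of \<open>S\<close>.
\<close>

definition L2_opnorm :: "real set \<Rightarrow> ((real \<Rightarrow> real^'d) \<Rightarrow> (real \<Rightarrow> real^'d)) \<Rightarrow> ereal" where
  "L2_opnorm A S = Inf {ereal K | K. 0 \<le> K \<and>
      (\<forall>f\<in>L2 A. S f \<in> L2 A \<and> L2norm A (S f) \<le> K * L2norm A f)}"

text \<open>
  Weak derivatives on \<open>(a, b)\<close> are tested against \<open>C\<^sup>1\<close> functions with compact support in
  \<open>(a, b)\<close> (the convention of Brezis for Sobolev spaces on an interval); \<open>p'\<close> below is the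
  derivative of the test function \<open>p\<close>.
\<close>

definition test_function :: "real \<Rightarrow> real \<Rightarrow> (real \<Rightarrow> real) \<Rightarrow> (real \<Rightarrow> real) \<Rightarrow> bool" where
  "test_function a b p p' \<longleftrightarrow>
     (\<forall>t. (p has_real_derivative p' t) (at t)) \<and> continuous_on UNIV p' \<and>
     (\<exists>c d. a < c \<and> d < b \<and> (\<forall>t. t \<notin> {c..d} \<longrightarrow> p t = 0))"

definition weak_deriv :: "real \<Rightarrow> real \<Rightarrow> (real \<Rightarrow> real^'d) \<Rightarrow> (real \<Rightarrow> real^'d) \<Rightarrow> bool" where
  "weak_deriv a b w g \<longleftrightarrow> (\<forall>p p'. test_function a b p p' \<longrightarrow>
     (\<integral>t. p' t *\<^sub>R w t \<partial>(lebesgue_on {a..b})) = - (\<integral>t. p t *\<^sub>R g t \<partial>(lebesgue_on {a..b})))"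

definition H1 :: "real \<Rightarrow> real \<Rightarrow> (real \<Rightarrow> real^'d) set" where
  "H1 a b = {w \<in> L2 {a..b}. \<exists>g\<in>L2 {a..b}. weak_deriv a b w g}"

definition H1norm :: "real \<Rightarrow> real \<Rightarrow> (real \<Rightarrow> real^'d) \<Rightarrow> real" where
  "H1norm a b w = sqrt ((L2norm {a..b} w)\<^sup>2 +
     (L2norm {a..b} (SOME g. g \<in> L2 {a..b} \<and> weak_deriv a b w g))\<^sup>2)"

definition cont_rep :: "real \<Rightarrow> real \<Rightarrow> (real \<Rightarrow> real^'d) \<Rightarrow> (real \<Rightarrow> real^'d)" where
  "cont_rep a b w = (SOME u. continuous_on {a..b} u \<and> (AE t in lebesgue_on {a..b}. u t = w t))"

definition V :: "(real \<Rightarrow> real^'d) \<Rightarrow> (real \<Rightarrow> real^'d) \<Rightarrow> (real \<Rightarrow> real^'d)" where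
  "V \<phi> w = (\<lambda>t. if t \<le> 0 then \<phi> t else w t)"

definition F :: "real \<Rightarrow> real \<Rightarrow> (real \<Rightarrow> real \<Rightarrow> real^'d^'d) \<Rightarrow> (real \<Rightarrow> real^'d) \<Rightarrow> (real \<Rightarrow> real^'d)"
  where "F \<tau> s C v = (\<lambda>t. \<integral>\<theta>. C (s + t) \<theta> *v v (t + \<theta>) \<partial>(lebesgue_on {-\<tau>..0}))"

definition segment_at :: "real \<Rightarrow> (real \<Rightarrow> real^'d) \<Rightarrow> (real \<Rightarrow> real^'d)" where
  "segment_at h v = (\<lambda>\<theta>. v (h + \<theta>))"

text \<open>
  The solution of \<open>w = F V(\<phi>, w)\<close> is unique only up to null sets, hence the choice operator.
\<close>

definition exact_sol ::
  "real \<Rightarrow> real \<Rightarrow> real \<Rightarrow> (real \<Rightarrow> real \<Rightarrow> real^'d^'d) \<Rightarrow> (real \<Rightarrow> real^'d) \<Rightarrow> (real \<Rightarrow> real^'d)" where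
  "exact_sol \<tau> s h C \<phi> =
     (SOME w. w \<in> L2 {0..h} \<and> (AE t in lebesgue_on {0..h}. w t = F \<tau> s C (V \<phi> w) t))"

definition T ::
  "real \<Rightarrow> real \<Rightarrow> real \<Rightarrow> (real \<Rightarrow> real \<Rightarrow> real^'d^'d) \<Rightarrow> (real \<Rightarrow> real^'d) \<Rightarrow> (real \<Rightarrow> real^'d)" where
  "T \<tau> s h C \<phi> = segment_at h (V \<phi> (exact_sol \<tau> s h C \<phi>))"

text \<open>
  Legendre polynomials by the Rodrigues formula, transported from \<open>[-1, 1]\<close> to \<open>[a, b]\<close> by the
  increasing affine bijection.
\<close>

definition legendre :: "nat \<Rightarrow> real poly" where
  "legendre n = smult (1 / (2 ^ n * fact n)) ((pderiv ^^ n) ([:-1, 0, 1:] ^ n))"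

definition legendre_on :: "real \<Rightarrow> real \<Rightarrow> nat \<Rightarrow> real \<Rightarrow> real" where
  "legendre_on a b n t = poly (legendre n) ((2 * t - a - b) / (b - a))"

text \<open>
  The coefficients \<open>c\<close> in \<open>f = (\<Sum>i. c i \<psi>\<^sub>i)\<close>, the series converging in \<open>L\<^sup>2\<close>.
\<close>

definition legendre_coeffs :: "real \<Rightarrow> real \<Rightarrow> (real \<Rightarrow> real^'d) \<Rightarrow> (nat \<Rightarrow> real^'d)" where
  "legendre_coeffs a b f = (THE c.
     (\<lambda>n. L2norm {a..b} (\<lambda>t. f t - (\<Sum>i<n. legendre_on a b i t *\<^sub>R c i))) \<longlonglongrightarrow> 0)"

text \<open>
  \<open>X\<^sub>M\<close> and \<open>X\<^sub>N\<^sup>+\<close> are the extensional function spaces over \<open>{0..M}\<close> and \<open>{1..N}\<close>, so that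
  equality of coordinates is equality of functions.
\<close>

definition R :: "real \<Rightarrow> nat \<Rightarrow> (real \<Rightarrow> real^'d) \<Rightarrow> (nat \<Rightarrow> real^'d)" where
  "R \<tau> M \<phi> = restrict (legendre_coeffs (-\<tau>) 0 \<phi>) {0..M}"

definition P :: "real \<Rightarrow> nat \<Rightarrow> (nat \<Rightarrow> real^'d) \<Rightarrow> (real \<Rightarrow> real^'d)" where
  "P \<tau> M \<Phi> = (\<lambda>\<theta>. \<Sum>i=0..M. legendre_on (-\<tau>) 0 i \<theta> *\<^sub>R \<Phi> i)"

definition node :: "real \<Rightarrow> nat \<Rightarrow> nat \<Rightarrow> real" where
  "node h N i = sorted_list_of_set {t. legendre_on 0 h N t = 0} ! (i - 1)"

definition lagrange_basis :: "real \<Rightarrow> nat \<Rightarrow> nat \<Rightarrow> real \<Rightarrow> real" where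
  "lagrange_basis h N i t = (\<Prod>j\<in>{1..N} - {i}. (t - node h N j) / (node h N i - node h N j))"

definition Rplus :: "real \<Rightarrow> nat \<Rightarrow> (real \<Rightarrow> real^'d) \<Rightarrow> (nat \<Rightarrow> real^'d)" where
  "Rplus h N w = (\<lambda>i\<in>{1..N}. cont_rep 0 h w (node h N i))"

definition Pplus :: "real \<Rightarrow> nat \<Rightarrow> (nat \<Rightarrow> real^'d) \<Rightarrow> (real \<Rightarrow> real^'d)" where
  "Pplus h N W = (\<lambda>t. \<Sum>i=1..N. lagrange_basis h N i t *\<^sub>R W i)"

definition discrete_sol ::
  "real \<Rightarrow> real \<Rightarrow> real \<Rightarrow> (real \<Rightarrow> real \<Rightarrow> real^'d^'d) \<Rightarrow> nat \<Rightarrow> nat \<Rightarrow> (nat \<Rightarrow> real^'d) \<Rightarrow> (nat \<Rightarrow> real^'d)"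
  where "discrete_sol \<tau> s h C M N \<Phi> =
     (THE W. W \<in> {1..N} \<rightarrow>\<^sub>E UNIV \<and> W = Rplus h N (F \<tau> s C (V (P \<tau> M \<Phi>) (Pplus h N W))))"

definition T_matrix ::
  "real \<Rightarrow> real \<Rightarrow> real \<Rightarrow> (real \<Rightarrow> real \<Rightarrow> real^'d^'d) \<Rightarrow> nat \<Rightarrow> nat \<Rightarrow> (nat \<Rightarrow> real^'d) \<Rightarrow> (nat \<Rightarrow> real^'d)"
  where "T_matrix \<tau> s h C M N \<Phi> =
     R \<tau> M (segment_at h (V (P \<tau> M \<Phi>) (Pplus h N (discrete_sol \<tau> s h C M N \<Phi>))))"

definition T_discrete ::
  "real \<Rightarrow> real \<Rightarrow> real \<Rightarrow> (real \<Rightarrow> real \<Rightarrow> real^'d^'d) \<Rightarrow> nat \<Rightarrow> nat \<Rightarrow> (real \<Rightarrow> real^'d) \<Rightarrow> (real \<Rightarrow> real^'d)"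
  where "T_discrete \<tau> s h C M N \<phi> = P \<tau> M (T_matrix \<tau> s h C M N (R \<tau> M \<phi>))"

end

theory Submission
  imports Defs "HOL-Library.Function_Algebras"
begin

text \<open>
  Since \<open>h \<ge> \<tau>\<close> and \<open>M \<ge> N - 1\<close>, the outer projection does nothing: \<open>T\<^sub>M\<^sub>,\<^sub>N \<phi> - T \<phi>\<close> is the final segment of
  \<open>e = w\<^sub>N - w\<close>, where \<open>w\<close> is the exact and \<open>w\<^sub>N\<close> the collocation solution, a polynomial of degree below \<open>N\<close>.
  Write \<open>I\<close> for interpolation at the Gauss-Legendre nodes, \<open>L\<close> for the Legendre projection, and
  \<open>A\<close>, \<open>B\<close> for the two parts of \<open>F V\<close> acting on the future and on the past. Then
  \<open>e = A e + (I - 1) A w\<^sub>N + (I - 1) B L \<phi> - B (\<phi> - L \<phi>)\<close>.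
  By Gronwall's inequality \<open>1 - A\<close> is bounded below, so it suffices that the last three terms are
  small in norm, uniformly in \<open>\<phi>\<close>. Orthogonality of the Lagrange polynomials at the Gauss nodes bounds
  \<open>I\<close> by the supremum norm, and \<open>H\<^sup>1\<close> functions are Hoelder continuous of order \<open>1/2\<close>,
  hence uniformly approximable by Bernstein polynomials at a rate depending only on their norm. For the
  last term, \<open>B\<close> pairs \<open>\<phi> - L \<phi>\<close> with the residuals of the rows of the kernel, which tend to
  zero at almost every time, and the Hoelder bound makes this uniform in time.
\<close>

subsection \<open>Square-integrable functions\<close>

text \<open>The past is the obstacle. The operator \<open>1 - L\<close> has norm 1 for every number
  of terms: projections converge for each \<phi>, but not uniformly over the unit ball. Smallness of
  the last term must therefore come from B, whose range in H1 makes it compact. Because a residual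
  is orthogonal to the low Legendre polynomials, approximation of the arbitrary \<phi> can be traded
  for approximation of fixed rows of the kernel. The term with \<open>A w\<^sub>N\<close> contains
  the unknown error again. Interpolation is made so fine that, after multiplication by the stability
  constant, the share of the error is at most one half and can be absorbed. The same inequality
  shows that the homogeneous collocation system has only the zero solution, which is how the
  discrete problem becomes solvable. Much of the length is due to null sets. \<open>F\<close> is
  controlled at almost every time only, whereas a collocation node is a single point, so every
  identity used at a node is first carried over to continuous representatives.\<close>

lemma integrable_mult_square_integrable:
  fixes f g :: "'a \<Rightarrow> real"
  assumes "f \<in> borel_measurable M" "g \<in> borel_measurable M"
    and "integrable M (\<lambda>t. (f t)\<^sup>2)" "integrable M (\<lambda>t. (g t)\<^sup>2)"
  shows "integrable M (\<lambda>t. f t * g t)"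
proof (rule Bochner_Integration.integrable_bound)
  show "integrable M (\<lambda>t. (f t)\<^sup>2 + (g t)\<^sup>2)" using assms by simp
  show "(\<lambda>t. f t * g t) \<in> borel_measurable M" using assms by measurable
  show "AE t in M. norm (f t * g t) \<le> norm ((f t)\<^sup>2 + (g t)\<^sup>2)"
  proof (rule AE_I2)
    fix t
    have "0 \<le> (\<bar>f t\<bar> - \<bar>g t\<bar>)\<^sup>2" by simp
    then have "2 * (\<bar>f t\<bar> * \<bar>g t\<bar>) \<le> (f t)\<^sup>2 + (g t)\<^sup>2" by (simp add: power2_diff)
    moreover have "0 \<le> \<bar>f t\<bar> * \<bar>g t\<bar>" by simp
    ultimately show "norm (f t * g t) \<le> norm ((f t)\<^sup>2 + (g t)\<^sup>2)"
      unfolding real_norm_def abs_mult by linarith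
  qed
qed

text \<open>The integral of \<open>(f - x * g)\<^sup>2\<close> is a nonnegative quadratic polynomial
  in \<open>x\<close>, so its discriminant is not positive.\<close>

lemma Cauchy_Schwarz_integral:
  fixes f g :: "'a \<Rightarrow> real"
  assumes m: "f \<in> borel_measurable M" "g \<in> borel_measurable M"
    and i: "integrable M (\<lambda>t. (f t)\<^sup>2)" "integrable M (\<lambda>t. (g t)\<^sup>2)"
  shows "\<bar>\<integral>t. f t * g t \<partial>M\<bar> \<le> sqrt (\<integral>t. (f t)\<^sup>2 \<partial>M) * sqrt (\<integral>t. (g t)\<^sup>2 \<partial>M)"
proof -
  define a b c where "a = (\<integral>t. (f t)\<^sup>2 \<partial>M)" and "b = (\<integral>t. f t * g t \<partial>M)"
    and "c = (\<integral>t. (g t)\<^sup>2 \<partial>M)"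
  note fg = integrable_mult_square_integrable[OF m i]
  have nn: "0 \<le> a" "0 \<le> c" by (auto simp: a_def c_def)
  have q: "0 \<le> a - 2 * x * b + x\<^sup>2 * c" for x
  proof -
    have "0 \<le> (\<integral>t. (f t - x * g t)\<^sup>2 \<partial>M)" by simp
    also have "\<dots> = (\<integral>t. (f t)\<^sup>2 - 2 * x * (f t * g t) + x\<^sup>2 * (g t)\<^sup>2 \<partial>M)"
      by (intro Bochner_Integration.integral_cong) (auto simp: power2_eq_square algebra_simps)
    also have "\<dots> = a - 2 * x * b + x\<^sup>2 * c"
      using i fg by (simp add: a_def b_def c_def)
    finally show ?thesis .
  qed
  have "b\<^sup>2 \<le> a * c"
  proof (cases "c = 0")
    case True
    have "b = 0"
    proof (rule ccontr)
      assume "b \<noteq> 0"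
      \<comment> \<open>This \<open>x\<close> makes the affine function \<open>a - 2 * x * b\<close>
        equal to -1.\<close>
      with q[of "(a + 1) / (2 * b)"] True show False by simp
    qed
    then show ?thesis using nn by simp
  next
    case False
    then have "0 < c" using nn by simp
    with q[of "b / c"] show ?thesis by (simp add: field_simps power2_eq_square)
  qed
  then have "sqrt (b\<^sup>2) \<le> sqrt (a * c)" by (rule real_sqrt_le_mono)
  then show ?thesis by (simp add: a_def b_def c_def real_sqrt_mult)
qed

lemma L2_measurable: "f \<in> L2 A \<Longrightarrow> f \<in> borel_measurable (lebesgue_on A)"
  and L2_sq_integrable: "f \<in> L2 A \<Longrightarrow> integrable (lebesgue_on A) (\<lambda>t. (norm (f t))\<^sup>2)"
  by (auto simp: L2_def)

lemma L2_norm_mult_integrable: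
  assumes "f \<in> L2 A" "g \<in> L2 A"
  shows "integrable (lebesgue_on A) (\<lambda>t. norm (f t) * norm (g t))"
  using assms by (intro integrable_mult_square_integrable) (auto simp: L2_def)

lemma L2_inner_integrable:
  assumes "f \<in> L2 A" "g \<in> L2 A"
  shows "integrable (lebesgue_on A) (\<lambda>t. f t \<bullet> g t)"
proof (rule Bochner_Integration.integrable_bound[OF L2_norm_mult_integrable[OF assms]])
  show "(\<lambda>t. f t \<bullet> g t) \<in> borel_measurable (lebesgue_on A)"
    using assms by (auto simp: L2_def)
qed (auto simp: Cauchy_Schwarz_ineq2)

lemma L2norm_nonneg [simp]: "0 \<le> L2norm A f"
  by (simp add: L2norm_def)

lemma L2norm_sq: "(L2norm A f)\<^sup>2 = (\<integral>t. (norm (f t))\<^sup>2 \<partial>(lebesgue_on A))"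
  by (simp add: L2norm_def)

lemma L2norm_sq_inner: "(L2norm A f)\<^sup>2 = (\<integral>t. f t \<bullet> f t \<partial>(lebesgue_on A))"
  by (simp add: L2norm_sq power2_norm_eq_inner)

lemma L2_norm_mult_le:
  assumes "f \<in> L2 A" "g \<in> L2 A"
  shows "(\<integral>t. norm (f t) * norm (g t) \<partial>(lebesgue_on A)) \<le> L2norm A f * L2norm A g"
proof -
  have "\<bar>\<integral>t. norm (f t) * norm (g t) \<partial>(lebesgue_on A)\<bar> \<le> L2norm A f * L2norm A g"
    unfolding L2norm_def
    using assms by (intro Cauchy_Schwarz_integral) (auto simp: L2_def)
  then show ?thesis by linarith
qed

lemma L2_Cauchy_Schwarz:
  assumes "f \<in> L2 A" "g \<in> L2 A"
  shows "\<bar>\<integral>t. f t \<bullet> g t \<partial>(lebesgue_on A)\<bar> \<le> L2norm A f * L2norm A g"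
proof -
  have "\<bar>\<integral>t. f t \<bullet> g t \<partial>(lebesgue_on A)\<bar> \<le> (\<integral>t. \<bar>f t \<bullet> g t\<bar> \<partial>(lebesgue_on A))"
    by (rule integral_abs_bound)
  also have "\<dots> \<le> (\<integral>t. norm (f t) * norm (g t) \<partial>(lebesgue_on A))"
    using assms by (intro integral_mono L2_norm_mult_integrable integrable_abs L2_inner_integrable)
      (auto simp: Cauchy_Schwarz_ineq2)
  also note L2_norm_mult_le[OF assms]
  finally show ?thesis .
qed

lemma L2_zero [simp]: "(\<lambda>_. 0) \<in> L2 A"
  by (simp add: L2_def)

lemma L2_add:
  assumes "f \<in> L2 A" "g \<in> L2 A"
  shows "(\<lambda>t. f t + g t) \<in> L2 A"
proof -
  have "integrable (lebesgue_on A) (\<lambda>t. (norm (f t))\<^sup>2 + 2 * (f t \<bullet> g t) + (norm (g t))\<^sup>2)"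
    using assms L2_inner_integrable[OF assms] by (auto simp: L2_def)
  then have "integrable (lebesgue_on A) (\<lambda>t. (norm (f t + g t))\<^sup>2)"
    by (simp add: power2_norm_eq_inner inner_add_left inner_add_right inner_commute algebra_simps)
  then show ?thesis using assms by (auto simp: L2_def)
qed

lemma L2_uminus: "f \<in> L2 A \<Longrightarrow> (\<lambda>t. - f t) \<in> L2 A"
  by (simp add: L2_def)

lemma L2_diff:
  assumes "f \<in> L2 A" "g \<in> L2 A"
  shows "(\<lambda>t. f t - g t) \<in> L2 A"
  using L2_add[OF assms(1) L2_uminus[OF assms(2)]] by simp

lemma L2_sum:
  assumes "\<And>i. i \<in> I \<Longrightarrow> f i \<in> L2 A"
  shows "(\<lambda>t. \<Sum>i\<in>I. f i t) \<in> L2 A"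
  using assms by (induction I rule: infinite_finite_induct) (auto intro!: L2_add)

lemma L2norm_uminus [simp]: "L2norm A (\<lambda>t. - f t) = L2norm A f"
  by (simp add: L2norm_def)

lemma L2norm_commute: "L2norm A (\<lambda>t. f t - g t) = L2norm A (\<lambda>t. g t - f t)"
  by (simp add: L2norm_def norm_minus_commute)

lemma L2norm_sq_add:
  assumes "f \<in> L2 A" "g \<in> L2 A"
  shows "(L2norm A (\<lambda>t. f t + g t))\<^sup>2 =
    (L2norm A f)\<^sup>2 + 2 * (\<integral>t. f t \<bullet> g t \<partial>(lebesgue_on A)) + (L2norm A g)\<^sup>2"
proof -
  have "(L2norm A (\<lambda>t. f t + g t))\<^sup>2 =
    (\<integral>t. (norm (f t))\<^sup>2 + 2 * (f t \<bullet> g t) + (norm (g t))\<^sup>2 \<partial>(lebesgue_on A))"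
    unfolding L2norm_sq
    by (intro Bochner_Integration.integral_cong)
      (auto simp: power2_norm_eq_inner inner_add_left inner_add_right inner_commute)
  also have "\<dots> = (L2norm A f)\<^sup>2 + 2 * (\<integral>t. f t \<bullet> g t \<partial>(lebesgue_on A)) + (L2norm A g)\<^sup>2"
    using L2_inner_integrable[OF assms] assms by (simp add: L2_sq_integrable L2norm_sq)
  finally show ?thesis .
qed

lemma L2norm_triangle:
  assumes "f \<in> L2 A" "g \<in> L2 A"
  shows "L2norm A (\<lambda>t. f t + g t) \<le> L2norm A f + L2norm A g"
proof (rule power2_le_imp_le)
  show "(L2norm A (\<lambda>t. f t + g t))\<^sup>2 \<le> (L2norm A f + L2norm A g)\<^sup>2"
    using L2_Cauchy_Schwarz[OF assms] unfolding L2norm_sq_add[OF assms] power2_sum by linarith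
qed simp

lemma L2norm_triangle_diff:
  assumes "f \<in> L2 A" "g \<in> L2 A"
  shows "L2norm A (\<lambda>t. f t - g t) \<le> L2norm A f + L2norm A g"
  using L2norm_triangle[OF assms(1) L2_uminus[OF assms(2)]] by simp

lemma L2norm_triangle_mid:
  assumes "f \<in> L2 A" "g \<in> L2 A" "k \<in> L2 A"
  shows "L2norm A (\<lambda>t. f t - k t) \<le> L2norm A (\<lambda>t. f t - g t) + L2norm A (\<lambda>t. g t - k t)"
  using L2norm_triangle[OF L2_diff[OF assms(1,2)] L2_diff[OF assms(2,3)]] by simp

lemma L2norm_cong_AE:
  assumes "f \<in> borel_measurable (lebesgue_on A)" "g \<in> borel_measurable (lebesgue_on A)"
    and "AE t in lebesgue_on A. f t = g t"
  shows "L2norm A f = L2norm A g"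
  unfolding L2norm_def
  using assms by (intro arg_cong[where f = sqrt] integral_cong_AE) auto

lemma L2_cong:
  assumes "\<And>t. t \<in> A \<Longrightarrow> f t = g t"
  shows "f \<in> L2 A \<longleftrightarrow> g \<in> L2 A"
proof -
  have "f \<in> borel_measurable (lebesgue_on A) \<longleftrightarrow> g \<in> borel_measurable (lebesgue_on A)"
    by (intro measurable_cong) (auto simp: assms)
  moreover have "integrable (lebesgue_on A) (\<lambda>t. (norm (f t))\<^sup>2) \<longleftrightarrow>
      integrable (lebesgue_on A) (\<lambda>t. (norm (g t))\<^sup>2)"
    by (intro Bochner_Integration.integrable_cong) (auto simp: assms)
  ultimately show ?thesis by (simp add: L2_def)
qed

text \<open>Lebesgue measure is complete: changing \<open>f\<close> on a negligible set keeps it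
  \<open>measurable_on\<close>, which on a Lebesgue measurable set amounts to Borel measurability
  for \<open>lebesgue_on\<close>.\<close>

lemma lebesgue_on_AE_eq_measurable:
  fixes f g :: "real \<Rightarrow> 'b::euclidean_space"
  assumes f: "f \<in> borel_measurable (lebesgue_on A)" and A: "A \<in> sets lebesgue"
    and eq: "AE t in lebesgue_on A. f t = g t"
  shows "g \<in> borel_measurable (lebesgue_on A)"
proof -
  have "f measurable_on A"
    using assms(1,2) by (simp add: measurable_on_iff_borel_measurable)
  moreover have "negligible {t \<in> A. f t \<noteq> g t}"
  proof -
    have "AE t in lebesgue. t \<notin> {t \<in> A. f t \<noteq> g t}"
      using eq A by (simp add: AE_restrict_space_iff)
    then obtain N where "N \<in> null_sets lebesgue" "{t \<in> A. f t \<noteq> g t} \<subseteq> N"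
      by (auto simp: eventually_ae_filter)
    then show ?thesis by (metis negligible_iff_null_sets negligible_subset)
  qed
  ultimately have "g measurable_on A"
    by (rule measurable_on_spike) auto
  then show ?thesis using A by (simp add: measurable_on_iff_borel_measurable)
qed

lemma L2_cong_AE:
  assumes "f \<in> L2 A" and "A \<in> sets lebesgue" and "AE t in lebesgue_on A. f t = g t"
  shows "g \<in> L2 A"
proof -
  have g: "g \<in> borel_measurable (lebesgue_on A)"
    using assms lebesgue_on_AE_eq_measurable L2_measurable by blast
  have "integrable (lebesgue_on A) (\<lambda>t. (norm (g t))\<^sup>2)"
    using assms g by (intro integrable_cong_AE_imp[OF L2_sq_integrable[OF assms(1)]]) auto
  with g show ?thesis by (simp add: L2_def)
qed

lemma lebesgue_on_interval_finite [simp]: "finite_measure (lebesgue_on {a..b::real})"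
  using finite_measure_lebesgue_on[of "{a..b}"] by simp

lemma integrable_const_lebesgue_on_interval [simp]: "integrable (lebesgue_on {a..b::real}) (\<lambda>_. c)"
  by (simp add: finite_measure.integrable_const)

lemma integral_const_lebesgue_on_interval:
  "a \<le> b \<Longrightarrow> (\<integral>t. c \<partial>(lebesgue_on {a..b::real})) = (b - a) * (c::real)"
  by (simp add: measure_restrict_space)

lemma L2_bounded:
  assumes "f \<in> borel_measurable (lebesgue_on {a..b})"
    and "AE t in lebesgue_on {a..b}. norm (f t) \<le> B"
  shows "f \<in> L2 {a..b}"
proof -
  have "AE t in lebesgue_on {a..b}. norm ((norm (f t))\<^sup>2) \<le> B\<^sup>2"
    using assms(2) by eventually_elim (auto intro: power_mono)
  then have "integrable (lebesgue_on {a..b}) (\<lambda>t. (norm (f t))\<^sup>2)"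
    using assms(1) by (intro finite_measure.integrable_const_bound[of _ _ "B\<^sup>2"]) auto
  with assms(1) show ?thesis by (simp add: L2_def)
qed

lemma L2norm_bounded:
  assumes "f \<in> borel_measurable (lebesgue_on {a..b})" and "a \<le> b" "0 \<le> B"
    and "AE t in lebesgue_on {a..b}. norm (f t) \<le> B"
  shows "L2norm {a..b} f \<le> sqrt (b - a) * B"
proof (rule power2_le_imp_le)
  have "(L2norm {a..b} f)\<^sup>2 \<le> (\<integral>t. B\<^sup>2 \<partial>(lebesgue_on {a..b}))"
    unfolding L2norm_sq
  proof (rule integral_mono_AE)
    show "integrable (lebesgue_on {a..b}) (\<lambda>t. (norm (f t))\<^sup>2)"
      using L2_bounded[OF assms(1,4)] by (rule L2_sq_integrable)
    show "AE t in lebesgue_on {a..b}. (norm (f t))\<^sup>2 \<le> B\<^sup>2"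
      using assms(4) by eventually_elim (auto intro: power_mono)
  qed auto
  also have "\<dots> = (sqrt (b - a) * B)\<^sup>2"
    unfolding integral_const_lebesgue_on_interval[OF assms(2)] using assms(2)
    by (simp add: power_mult_distrib)
  finally show "(L2norm {a..b} f)\<^sup>2 \<le> (sqrt (b - a) * B)\<^sup>2" .
qed (use assms in auto)

lemma continuous_lebesgue_on_measurable:
  fixes f :: "real \<Rightarrow> 'b::euclidean_space"
  shows "continuous_on {a..b} f \<Longrightarrow> f \<in> borel_measurable (lebesgue_on {a..b})"
  by (rule continuous_imp_measurable_on_sets_lebesgue) auto

lemma L2_continuous:
  assumes "continuous_on {a..b} f"
  shows "f \<in> L2 {a..b}"
proof -
  have "compact (f ` {a..b})" using assms by (intro compact_continuous_image) auto
  then obtain B where "\<And>t. t \<in> {a..b} \<Longrightarrow> norm (f t) \<le> B"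
    using compact_imp_bounded bounded_iff by (metis imageI)
  then show ?thesis
    by (intro L2_bounded[where B = B] continuous_lebesgue_on_measurable assms AE_I2) auto
qed

lemma L2norm_sup_bound:
  assumes "continuous_on {a..b} f" "a \<le> b" "0 \<le> B" "\<And>t. t \<in> {a..b} \<Longrightarrow> norm (f t) \<le> B"
  shows "L2norm {a..b} f \<le> sqrt (b - a) * B"
  by (rule L2norm_bounded) (use assms in \<open>auto intro: continuous_lebesgue_on_measurable AE_I2\<close>)

lemma L2_integrable:
  assumes "f \<in> L2 {a..b}"
  shows "integrable (lebesgue_on {a..b}) f"
proof (rule Bochner_Integration.integrable_bound)
  show "integrable (lebesgue_on {a..b}) (\<lambda>t. 1 + (norm (f t))\<^sup>2)"
    using assms by (auto simp: L2_def)
  show "AE t in lebesgue_on {a..b}. norm (f t) \<le> norm (1 + (norm (f t))\<^sup>2)"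
  proof (rule AE_I2)
    fix t
    have "0 \<le> (norm (f t) - 1)\<^sup>2" "0 \<le> (norm (f t))\<^sup>2" by simp_all
    then have "2 * norm (f t) \<le> 1 + (norm (f t))\<^sup>2" by (simp add: power2_diff)
    moreover have "0 \<le> norm (f t)" by simp
    ultimately show "norm (f t) \<le> norm (1 + (norm (f t))\<^sup>2)"
      unfolding real_norm_def by linarith
  qed
qed (use assms in \<open>auto simp: L2_def\<close>)

lemma L2_scaleR_continuous:
  assumes f: "f \<in> L2 {a..b}" and g: "continuous_on {a..b} g"
  shows "(\<lambda>t. g t *\<^sub>R f t) \<in> L2 {a..b}"
proof -
  have "compact (g ` {a..b})" using g by (intro compact_continuous_image) auto
  then obtain B where B: "\<And>t. t \<in> {a..b} \<Longrightarrow> norm (g t) \<le> B"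
    using compact_imp_bounded bounded_iff by (metis imageI)
  have m: "(\<lambda>t. g t *\<^sub>R f t) \<in> borel_measurable (lebesgue_on {a..b})"
    by (intro borel_measurable_scaleR continuous_lebesgue_on_measurable g L2_measurable f)
  have "integrable (lebesgue_on {a..b}) (\<lambda>t. (norm (g t *\<^sub>R f t))\<^sup>2)"
  proof (rule Bochner_Integration.integrable_bound)
    show "integrable (lebesgue_on {a..b}) (\<lambda>t. B\<^sup>2 * (norm (f t))\<^sup>2)"
      using f by (auto simp: L2_def)
    show "AE t in lebesgue_on {a..b}. norm ((norm (g t *\<^sub>R f t))\<^sup>2) \<le> norm (B\<^sup>2 * (norm (f t))\<^sup>2)"
    proof (rule AE_I2)
      fix t assume "t \<in> space (lebesgue_on {a..b})"
      then have "\<bar>g t\<bar>\<^sup>2 \<le> B\<^sup>2" using B[of t] by (intro power_mono) auto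
      then show "norm ((norm (g t *\<^sub>R f t))\<^sup>2) \<le> norm (B\<^sup>2 * (norm (f t))\<^sup>2)"
        by (simp add: power_mult_distrib mult_right_mono)
    qed
    show "(\<lambda>t. (norm (g t *\<^sub>R f t))\<^sup>2) \<in> borel_measurable (lebesgue_on {a..b})"
      by (intro borel_measurable_power measurable_compose[OF m]) auto
  qed
  with m show ?thesis by (simp add: L2_def)
qed

lemma scaleR_continuous_integrable:
  assumes "f \<in> L2 {a..b}" and "continuous_on {a..b} g"
  shows "integrable (lebesgue_on {a..b}) (\<lambda>t. g t *\<^sub>R f t)"
  using assms by (intro L2_integrable L2_scaleR_continuous)

lemma L2norm_dominated_convergence:
  fixes f :: "real \<Rightarrow> real^'d" and fk :: "nat \<Rightarrow> real \<Rightarrow> real^'d"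
  assumes f: "f \<in> borel_measurable (lebesgue_on A)"
    and fk: "\<And>k. fk k \<in> borel_measurable (lebesgue_on A)"
    and g: "integrable (lebesgue_on A) (\<lambda>t. (g t)\<^sup>2)"
    and lim: "AE t in lebesgue_on A. (\<lambda>k. fk k t) \<longlonglongrightarrow> f t"
    and bd: "\<And>k. AE t in lebesgue_on A. norm (fk k t) \<le> g t"
  shows "(\<lambda>k. L2norm A (\<lambda>t. f t - fk k t)) \<longlonglongrightarrow> 0"
proof -
  have bd': "AE t in lebesgue_on A. \<forall>k. norm (fk k t) \<le> g t"
    using bd by (simp add: AE_all_countable)
  have "(\<lambda>k. \<integral>t. (norm (f t - fk k t))\<^sup>2 \<partial>(lebesgue_on A)) \<longlonglongrightarrow> (\<integral>t. 0 \<partial>(lebesgue_on A))"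
  \<comment> \<open>The limit \<open>f\<close> inherits the bound \<open>g\<close> from the
    sequence, so the differences are bounded by \<open>2 * g\<close>.\<close>
  proof (rule integral_dominated_convergence[where w = "\<lambda>t. 4 * (g t)\<^sup>2"])
    show "AE t in lebesgue_on A. (\<lambda>k. (norm (f t - fk k t))\<^sup>2) \<longlonglongrightarrow> 0"
      using lim
    proof eventually_elim
      case (elim t)
      then have "(\<lambda>k. (norm (f t - fk k t))\<^sup>2) \<longlonglongrightarrow> (norm (f t - f t))\<^sup>2"
        by (intro tendsto_intros)
      then show ?case by simp
    qed
    show "AE t in lebesgue_on A. norm ((norm (f t - fk k t))\<^sup>2) \<le> 4 * (g t)\<^sup>2" for k
      using lim bd'
    proof eventually_elim
      case (elim t)
      have "norm (f t) \<le> g t"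
        using elim by (intro LIMSEQ_le_const2[OF tendsto_norm[OF elim(1)]]) auto
      then have "norm (f t - fk k t) \<le> 2 * g t"
        using elim(2) norm_triangle_ineq4[of "f t" "fk k t"] by (smt (verit, best))
      then have "(norm (f t - fk k t))\<^sup>2 \<le> (2 * g t)\<^sup>2" by (intro power_mono) auto
      then show ?case by (simp add: power_mult_distrib)
    qed
  qed (use f fk g in auto)
  then have "(\<lambda>k. sqrt (\<integral>t. (norm (f t - fk k t))\<^sup>2 \<partial>(lebesgue_on A))) \<longlonglongrightarrow> sqrt 0"
    by (intro tendsto_real_sqrt) simp
  then show ?thesis by (simp add: L2norm_def)
qed

subsection \<open>Density of polynomials\<close>

text \<open>The identity is required on the whole line, so that two such functions agreeing at
  enough points are equal as functions, not merely on an interval.\<close>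

definition vec_poly :: "nat \<Rightarrow> (real \<Rightarrow> real^'d) \<Rightarrow> bool" where
  "vec_poly n f \<longleftrightarrow> (\<forall>j. \<exists>p. degree p \<le> n \<and> (\<forall>t. f t $ j = poly p t))"

lemma vec_polyI:
  assumes "\<And>j. degree (p j) \<le> n" "\<And>j t. f t $ j = poly (p j) t"
  shows "vec_poly n f"
  using assms unfolding vec_poly_def by (intro allI exI[of _ "p j" for j]) auto

lemma vec_poly_coordinates:
  assumes "vec_poly n f"
  shows "\<exists>p. \<forall>j. degree (p j) \<le> n \<and> (\<forall>t. f t $ j = poly (p j) t)"
  using assms unfolding vec_poly_def by (rule choice)

lemma vec_poly_mono:
  assumes "vec_poly n f" "n \<le> m" shows "vec_poly m f"
proof -
  obtain p where "\<forall>j. degree (p j) \<le> n \<and> (\<forall>t. f t $ j = poly (p j) t)"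
    using vec_poly_coordinates[OF assms(1)] ..
  then show ?thesis using assms(2) by (intro vec_polyI[where p = p]) (simp_all add: order_trans[of _ n])
qed

lemma vec_poly_add:
  assumes "vec_poly n f" "vec_poly n g" shows "vec_poly n (\<lambda>t. f t + g t)"
proof -
  obtain p where p: "\<forall>j. degree (p j) \<le> n \<and> (\<forall>t. f t $ j = poly (p j) t)"
    using vec_poly_coordinates[OF assms(1)] ..
  obtain q where q: "\<forall>j. degree (q j) \<le> n \<and> (\<forall>t. g t $ j = poly (q j) t)"
    using vec_poly_coordinates[OF assms(2)] ..
  show ?thesis
    by (rule vec_polyI[where p = "\<lambda>j. p j + q j"]) (simp_all add: p q degree_add_le)
qed

lemma vec_poly_poly_scaleR:
  assumes "degree p \<le> n" shows "vec_poly n (\<lambda>t. poly p t *\<^sub>R c)"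
proof (rule vec_polyI[where p = "\<lambda>j. smult (c $ j) p"])
  show "degree (smult (c $ j) p) \<le> n" for j
    using degree_smult_le assms by (rule order_trans)
qed simp

lemma vec_poly_zero: "vec_poly n (\<lambda>_. 0)"
  by (rule vec_polyI[where p = "\<lambda>_. 0"]) simp_all

lemma vec_poly_sum:
  "(\<And>i. i \<in> I \<Longrightarrow> vec_poly n (f i)) \<Longrightarrow> vec_poly n (\<lambda>t. \<Sum>i\<in>I. f i t)"
  by (induction I rule: infinite_finite_induct) (simp_all add: vec_poly_zero vec_poly_add)

lemma vec_poly_scaleR:
  assumes "vec_poly n f" shows "vec_poly n (\<lambda>t. c *\<^sub>R f t)"
proof -
  obtain p where p: "\<forall>j. degree (p j) \<le> n \<and> (\<forall>t. f t $ j = poly (p j) t)"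
    using vec_poly_coordinates[OF assms] ..
  show ?thesis
  proof (rule vec_polyI[where p = "\<lambda>j. smult c (p j)"])
    show "degree (smult c (p j)) \<le> n" for j
      using degree_smult_le p by (metis order_trans)
  qed (simp add: p)
qed

lemma vec_poly_diff:
  assumes "vec_poly n f" "vec_poly n g" shows "vec_poly n (\<lambda>t. f t - g t)"
  using vec_poly_add[OF assms(1) vec_poly_scaleR[OF assms(2), where c = "-1"]] by simp

lemma vec_poly_translate:
  assumes "vec_poly n f" shows "vec_poly n (\<lambda>t. f (h + t))"
proof -
  obtain p where p: "\<forall>j. degree (p j) \<le> n \<and> (\<forall>t. f t $ j = poly (p j) t)"
    using vec_poly_coordinates[OF assms] ..
  show ?thesis
  proof (rule vec_polyI[where p = "\<lambda>j. pcompose (p j) [:h, 1:]"])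
    show "degree (pcompose (p j) [:h, 1:]) \<le> n" for j
      using p by (simp add: degree_pcompose)
  qed (simp add: p poly_pcompose)
qed

lemma vec_poly_continuous:
  assumes "vec_poly n f" shows "continuous_on S f"
proof -
  obtain p where p: "\<forall>j. degree (p j) \<le> n \<and> (\<forall>t. f t $ j = poly (p j) t)"
    using vec_poly_coordinates[OF assms] ..
  have "continuous_on S (\<lambda>t. \<chi> j. poly (p j) t)"
    by (intro continuous_on_vec_lambda continuous_intros)
  also have "(\<lambda>t. \<chi> j. poly (p j) t) = f" by (simp add: p fun_eq_iff vec_eq_iff)
  finally show ?thesis .
qed

lemma vec_poly_L2: "vec_poly n f \<Longrightarrow> f \<in> L2 {a..b}"
  by (intro L2_continuous vec_poly_continuous)

lemma polynomial_function_vec_poly: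
  assumes "polynomial_function (q :: real \<Rightarrow> real^'d)"
  shows "\<exists>n. vec_poly n q"
proof -
  have "\<forall>j. \<exists>p. \<forall>t. q t $ j = poly p t"
  proof
    fix j
    have "real_polynomial_function (\<lambda>t. q t $ j)"
      using assms bounded_linear_vec_nth[of j] unfolding polynomial_function_def o_def by blast
    then obtain a n where "(\<lambda>t. q t $ j) = (\<lambda>t. \<Sum>i\<le>n. a i * t ^ i)"
      using real_polynomial_function_iff_sum by auto
    then have "\<forall>t. q t $ j = poly (\<Sum>i\<le>n. monom (a i) i) t"
      by (simp add: poly_sum poly_monom fun_eq_iff)
    then show "\<exists>p. \<forall>t. q t $ j = poly p t" by blast
  qed
  then obtain p where p: "\<And>j t. q t $ j = poly (p j) t" by metis
  have "degree (p j) \<le> Max (range (\<lambda>j. degree (p j)))" for j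
    by (intro Max_ge) auto
  then have "vec_poly (Max (range (\<lambda>j. degree (p j)))) q"
    by (rule vec_polyI) (simp add: p)
  then show ?thesis ..
qed

text \<open>For \<open>0 < K\<close> this is the radial retraction onto the closed ball of radius
  \<open>K\<close>.\<close>

definition clamp_norm :: "real \<Rightarrow> 'b::real_normed_vector \<Rightarrow> 'b" where
  "clamp_norm K x = (K / max K (norm x)) *\<^sub>R x"

lemma clamp_norm_le: "0 < K \<Longrightarrow> norm (clamp_norm K x) \<le> K"
  unfolding clamp_norm_def by (simp add: field_simps max_def)

lemma clamp_norm_le_norm: "0 < K \<Longrightarrow> norm (clamp_norm K x) \<le> norm x"
  unfolding clamp_norm_def by (auto simp: field_simps max_def mult_right_mono)

lemma clamp_norm_id: "0 < K \<Longrightarrow> norm x \<le> K \<Longrightarrow> clamp_norm K x = x"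
  unfolding clamp_norm_def by (auto simp: max_def)

lemma continuous_on_clamp_norm: "0 < K \<Longrightarrow> continuous_on S (clamp_norm K)"
  unfolding clamp_norm_def by (intro continuous_intros) auto

text \<open>Three errors of at most \<open>e / 3\<close>: cutting the values of \<open>f\<close> to
  a ball, replacing the bounded function by a continuous one, and Stone-Weierstrass.\<close>

lemma L2_poly_dense:
  fixes f :: "real \<Rightarrow> real^'d"
  assumes f: "f \<in> L2 {a..b}" and ab: "a < b" and e: "0 < e"
  shows "\<exists>n q. vec_poly n q \<and> L2norm {a..b} (\<lambda>t. f t - q t) < e"
proof -
  let ?M = "lebesgue_on {a..b}"
  have fm: "f \<in> borel_measurable ?M" using f by (rule L2_measurable)
  have cm: "(\<lambda>t. clamp_norm (real (Suc k)) (f t)) \<in> borel_measurable ?M" for k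
    by (rule measurable_compose[OF fm]) (intro borel_measurable_continuous_onI continuous_on_clamp_norm, simp)
  have "(\<lambda>k. L2norm {a..b} (\<lambda>t. f t - clamp_norm (real (Suc k)) (f t))) \<longlonglongrightarrow> 0"
  proof (rule L2norm_dominated_convergence[where g = "\<lambda>t. norm (f t)"])
    show "AE t in ?M. (\<lambda>k. clamp_norm (real (Suc k)) (f t)) \<longlonglongrightarrow> f t"
    proof (rule AE_I2)
      fix t
      obtain m where "norm (f t) \<le> real m" using real_arch_simple by blast
      then have "\<forall>k\<ge>m. clamp_norm (real (Suc k)) (f t) = f t"
        by (intro allI impI clamp_norm_id) auto
      then show "(\<lambda>k. clamp_norm (real (Suc k)) (f t)) \<longlonglongrightarrow> f t"
        by (intro tendsto_eventually) (auto simp: eventually_sequentially)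
    qed
    show "AE t in ?M. norm (clamp_norm (real (Suc k)) (f t)) \<le> norm (f t)" for k
      by (intro AE_I2 clamp_norm_le_norm) simp
  qed (intro fm cm L2_sq_integrable[OF f])+
  then have "\<forall>\<^sub>F k in sequentially. L2norm {a..b} (\<lambda>t. f t - clamp_norm (real (Suc k)) (f t)) < e / 3"
    using e by (intro order_tendstoD) auto
  then obtain k where k: "L2norm {a..b} (\<lambda>t. f t - clamp_norm (real (Suc k)) (f t)) < e / 3"
    by (auto simp: eventually_sequentially)
  define K where "K = real (Suc k)"
  have K: "0 < K" by (simp add: K_def)
  have cm': "(\<lambda>t. clamp_norm K (f t)) \<in> borel_measurable ?M" using cm by (simp add: K_def)
  have cl: "(\<lambda>t. clamp_norm K (f t)) \<in> L2 {a..b}"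
    using cm' K by (intro L2_bounded[where B = K]) (auto intro!: AE_I2 clamp_norm_le)
  \<comment> \<open>By definition a \<open>measurable_on\<close> function is a limit of continuous
    functions off a negligible set. These need not be dominated, so they are clamped at the same
    radius \<open>K\<close>, and their limit becomes \<open>clamp_norm K (f t)\<close>.\<close>
  have "f measurable_on {a..b}" using fm by (simp add: measurable_on_iff_borel_measurable)
  then obtain Z g where Z: "negligible Z" and g: "\<And>n. continuous_on UNIV (g n)"
      "\<And>t. t \<notin> Z \<Longrightarrow> (\<lambda>n. g n t) \<longlonglongrightarrow> (if t \<in> {a..b} then f t else 0)"
    unfolding measurable_on_def by metis
  have gc: "continuous_on S (\<lambda>t. clamp_norm K (g n t))" for n S
    using continuous_on_compose2[OF continuous_on_clamp_norm[OF K, of UNIV] continuous_on_subset[OF g(1), of S]]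
    by auto
  have "(\<lambda>n. L2norm {a..b} (\<lambda>t. clamp_norm K (f t) - clamp_norm K (g n t))) \<longlonglongrightarrow> 0"
  proof (rule L2norm_dominated_convergence[where g = "\<lambda>_. K"])
    have "AE t in ?M. t \<notin> Z"
      using AE_not_in[of Z lebesgue] Z
      by (auto simp: AE_restrict_space_iff negligible_iff_null_sets elim: eventually_mono)
    then show "AE t in ?M. (\<lambda>n. clamp_norm K (g n t)) \<longlonglongrightarrow> clamp_norm K (f t)"
      using AE_space
    proof eventually_elim
      case (elim t)
      then have "(\<lambda>n. g n t) \<longlonglongrightarrow> f t" using g(2)[of t] by auto
      then show ?case
        using continuous_on_clamp_norm[OF K, of UNIV]
        by (intro isCont_tendsto_compose[where g = "clamp_norm K"])
          (auto simp: continuous_on_eq_continuous_at)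
    qed
    show "AE t in ?M. norm (clamp_norm K (g n t)) \<le> K" for n
      by (intro AE_I2 clamp_norm_le K)
    show "(\<lambda>t. clamp_norm K (g n t)) \<in> borel_measurable ?M" for n
      by (intro continuous_lebesgue_on_measurable gc)
  qed (intro cm' integrable_const_lebesgue_on_interval)+
  then have "\<forall>\<^sub>F n in sequentially. L2norm {a..b} (\<lambda>t. clamp_norm K (f t) - clamp_norm K (g n t)) < e / 3"
    using e by (intro order_tendstoD) auto
  then obtain n where n: "L2norm {a..b} (\<lambda>t. clamp_norm K (f t) - clamp_norm K (g n t)) < e / 3"
    by (auto simp: eventually_sequentially)
  let ?u = "\<lambda>t. clamp_norm K (g n t)"
  have u: "?u \<in> L2 {a..b}" by (intro L2_continuous gc)
  \<comment> \<open>Chosen for \<open>sqrt (b - a) * d \<le> e / 3\<close>, the factor being the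
    price of passing from the supremum to the \<open>L2norm\<close>.\<close>
  define d where "d = e / 3 / (1 + sqrt (b - a))"
  have s: "0 < 1 + sqrt (b - a)" using ab by (smt (verit) real_sqrt_ge_zero)
  have d: "0 < d" using e s by (simp add: d_def)
  obtain q where q: "polynomial_function q" "\<And>t. t \<in> {a..b} \<Longrightarrow> norm (?u t - q t) < d"
    using Stone_Weierstrass_polynomial_function[OF compact_Icc gc d, of a b n] by blast
  obtain m where m: "vec_poly m q" using polynomial_function_vec_poly[OF q(1)] by blast
  have "L2norm {a..b} (\<lambda>t. ?u t - q t) \<le> sqrt (b - a) * d"
    using ab d q(2) by (intro L2norm_sup_bound continuous_intros gc vec_poly_continuous[OF m]) (auto intro: less_imp_le)
  also have "\<dots> \<le> (1 + sqrt (b - a)) * d" using d by (intro mult_right_mono) auto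
  also have "\<dots> = e / 3" using s unfolding d_def by (simp only: times_divide_eq_right mult.commute nonzero_mult_div_cancel_right)
  finally have 3: "L2norm {a..b} (\<lambda>t. ?u t - q t) \<le> e / 3" .
  have "L2norm {a..b} (\<lambda>t. f t - q t) \<le>
      L2norm {a..b} (\<lambda>t. f t - clamp_norm K (f t)) + L2norm {a..b} (\<lambda>t. clamp_norm K (f t) - q t)"
    by (rule L2norm_triangle_mid[OF f cl vec_poly_L2[OF m]])
  moreover have "L2norm {a..b} (\<lambda>t. clamp_norm K (f t) - q t) \<le>
      L2norm {a..b} (\<lambda>t. clamp_norm K (f t) - ?u t) + L2norm {a..b} (\<lambda>t. ?u t - q t)"
    by (rule L2norm_triangle_mid[OF cl u vec_poly_L2[OF m]])
  ultimately have "L2norm {a..b} (\<lambda>t. f t - q t) < e"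
    using k n 3 unfolding K_def by linarith
  with m show ?thesis by blast
qed

subsection \<open>Legendre polynomials\<close>

lemma AE_lebesgue_on_interval_witness:
  assumes Q: "AE t in lebesgue_on {a..b::real}. Q t" and cd: "a \<le> c" "c < d" "d \<le> b"
  shows "\<exists>t\<in>{c..d}. Q t"
proof (rule ccontr)
  assume no: "\<not> (\<exists>t\<in>{c..d}. Q t)"
  have "AE t in lebesgue. t \<in> {a..b} \<longrightarrow> Q t" using Q by (simp add: AE_restrict_space_iff)
  then have "AE t in lebesgue. t \<notin> {c..d}"
    using no cd by (auto elim!: eventually_mono)
  then have "emeasure lebesgue {c..d} = 0"
    by (subst (asm) AE_iff_measurable[where N = "{c..d}"]) auto
  then show False using cd by simp
qed

lemma continuous_AE_eq_imp_eq:
  fixes u v :: "real \<Rightarrow> 'b::real_normed_vector"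
  assumes "continuous_on {a..b} u" "continuous_on {a..b} v" and ab: "a < b"
    and eq: "AE t in lebesgue_on {a..b}. u t = v t" and t: "t \<in> {a..b}"
  shows "u t = v t"
proof (rule ccontr)
  assume "u t \<noteq> v t"
  then have pos: "0 < norm (u t - v t)" by simp
  have "continuous_on {a..b} (\<lambda>x. u x - v x)" using assms by (intro continuous_intros)
  then obtain \<delta> where \<delta>: "0 < \<delta>" and
    close: "\<And>x. x \<in> {a..b} \<Longrightarrow> dist x t < \<delta> \<Longrightarrow> dist (u x - v x) (u t - v t) < norm (u t - v t)"
    using t pos unfolding continuous_on_iff by metis
  define c where "c = max a (t - \<delta> / 2)"
  define d where "d = min b (t + \<delta> / 2)"
  have cd: "a \<le> c" "c < d" "d \<le> b" using \<delta> t ab by (auto simp: c_def d_def)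
  obtain x where x: "x \<in> {c..d}" "u x = v x"
    using AE_lebesgue_on_interval_witness[OF eq cd] by blast
  have "dist x t < \<delta>" using x \<delta> by (auto simp: c_def d_def dist_real_def abs_less_iff)
  then have "dist (u x - v x) (u t - v t) < norm (u t - v t)"
    using x cd by (intro close) auto
  then show False using x by (simp add: dist_norm norm_minus_commute)
qed

lemma integral_pderiv:
  fixes p :: "real poly"
  assumes "a \<le> b"
  shows "(\<integral>t. poly (pderiv p) t \<partial>(lebesgue_on {a..b})) = poly p b - poly p a"
proof -
  have "(poly (pderiv p) has_integral poly p b - poly p a) {a..b}"
    using assms by (intro fundamental_theorem_of_calculus)
      (auto intro!: derivative_eq_intros poly_DERIV has_vector_derivative_at_within
        simp: has_real_derivative_iff_has_vector_derivative[symmetric])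
  then have "integral {a..b} (poly (pderiv p)) = poly p b - poly p a"
    by (rule integral_unique)
  then show ?thesis
    by (subst lebesgue_integral_eq_integral)
      (auto intro!: continuous_imp_integrable_real continuous_intros)
qed

lemma poly_integrable: "integrable (lebesgue_on {a..b}) (\<lambda>t. poly p t :: real)"
  by (intro continuous_imp_integrable_real continuous_intros)

lemma integral_poly_by_parts:
  fixes p q :: "real poly"
  assumes "a \<le> b" and "poly p a = 0" "poly p b = 0"
  shows "(\<integral>t. poly (pderiv p * q) t \<partial>(lebesgue_on {a..b})) =
    - (\<integral>t. poly (p * pderiv q) t \<partial>(lebesgue_on {a..b}))"
proof -
  have "(\<integral>t. poly (pderiv (p * q)) t \<partial>(lebesgue_on {a..b})) = 0"
    using assms by (simp add: integral_pderiv)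
  moreover have "pderiv (p * q) = pderiv p * q + p * pderiv q" by (simp add: pderiv_mult)
  ultimately show ?thesis
    using Bochner_Integration.integral_add[OF poly_integrable[of a b "pderiv p * q"]
        poly_integrable[of a b "p * pderiv q"]] by (simp only: poly_add)
qed

text \<open>Each differentiation costs at most one factor \<open>u\<close>. While
  \<open>k < n\<close> a factor remains, so the \<open>k\<close>-th derivative still vanishes at the
  zeros of \<open>u\<close>.\<close>

lemma power_dvd_higher_pderiv:
  fixes u :: "real poly"
  shows "k \<le> n \<Longrightarrow> u ^ (n - k) dvd (pderiv ^^ k) (u ^ n)"
proof (induction k)
  case (Suc k)
  then obtain r where r: "(pderiv ^^ k) (u ^ n) = u ^ Suc (n - Suc k) * r"
    by (auto simp: Suc_diff_Suc elim: dvdE)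
  show ?case
    by (simp only: funpow.simps o_apply r pderiv_mult pderiv_power_Suc)
      (intro dvd_add dvd_mult2 dvd_mult dvd_smult dvd_refl, simp)
qed simp

text \<open>These are \<open>k\<close> integrations by parts. The boundary terms vanish because
  every derivative of \<open>u ^ n\<close> of order below \<open>n\<close> keeps the factor
  \<open>u\<close>.\<close>

lemma integral_higher_pderiv:
  fixes u q :: "real poly"
  assumes ab: "a \<le> b" and u: "poly u a = 0" "poly u b = 0" and "k \<le> n"
  shows "(\<integral>t. poly ((pderiv ^^ k) (u ^ n) * q) t \<partial>(lebesgue_on {a..b})) =
    (-1) ^ k * (\<integral>t. poly (u ^ n * (pderiv ^^ k) q) t \<partial>(lebesgue_on {a..b}))"
  using \<open>k \<le> n\<close>
proof (induction k arbitrary: q)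
  case (Suc k)
  have "u ^ (n - k) dvd (pderiv ^^ k) (u ^ n)" using Suc.prems by (intro power_dvd_higher_pderiv) simp
  moreover have "u dvd u ^ (n - k)" using Suc.prems by (intro dvd_power) simp
  ultimately have "u dvd (pderiv ^^ k) (u ^ n)" by (rule dvd_trans[rotated])
  then have z: "poly ((pderiv ^^ k) (u ^ n)) a = 0" "poly ((pderiv ^^ k) (u ^ n)) b = 0"
    using u by (auto elim!: dvdE)
  have "(\<integral>t. poly ((pderiv ^^ Suc k) (u ^ n) * q) t \<partial>(lebesgue_on {a..b})) =
    - (\<integral>t. poly ((pderiv ^^ k) (u ^ n) * pderiv q) t \<partial>(lebesgue_on {a..b}))"
    using integral_poly_by_parts[OF ab z] by simp
  also have "\<dots> = - ((-1) ^ k * (\<integral>t. poly (u ^ n * (pderiv ^^ k) (pderiv q)) t \<partial>(lebesgue_on {a..b})))"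
    using Suc.prems by (subst Suc.IH) auto
  finally show ?case by (simp add: funpow_swap1)
qed simp

lemma degree_higher_pderiv:
  fixes p :: "real poly" shows "degree ((pderiv ^^ k) p) = degree p - k"
  by (induction k) (auto simp: degree_pderiv)

lemma higher_pderiv_eq_0:
  fixes p :: "real poly" assumes "degree p < k" shows "(pderiv ^^ k) p = 0"
proof -
  obtain m where k: "k = Suc m" using assms by (cases k) auto
  have "degree ((pderiv ^^ m) p) = 0" using assms k by (simp add: degree_higher_pderiv)
  then show ?thesis by (simp add: k pderiv_eq_0_iff)
qed

lemma higher_pderiv_pcompose_linear:
  fixes p :: "real poly"
  shows "(pderiv ^^ n) (pcompose p [:c, m:]) = smult (m ^ n) (pcompose ((pderiv ^^ n) p) [:c, m:])"
  by (induction n) (simp_all add: pderiv_smult pderiv_pcompose pderiv_pCons mult.commute)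

text \<open>The polynomial behind the function \<open>legendre_on\<close>; degree, formal derivative
  and division with remainder refer to it.\<close>

definition legendre_poly_on :: "real \<Rightarrow> real \<Rightarrow> nat \<Rightarrow> real poly" where
  "legendre_poly_on a b n = pcompose (legendre n) [:- (a + b) / (b - a), 2 / (b - a):]"

lemma poly_legendre_poly_on: "poly (legendre_poly_on a b n) t = legendre_on a b n t"
  unfolding legendre_poly_on_def legendre_on_def poly_pcompose
  by (rule arg_cong[where f = "poly (legendre n)"]) (simp add: diff_divide_distrib add_divide_distrib)

lemma degree_legendre: "degree (legendre n) = n"
proof -
  have "degree ([:-1, 0, 1::real:] ^ n) = 2 * n" by (simp add: degree_power_eq)
  then show ?thesis by (simp add: legendre_def degree_higher_pderiv)
qed

lemma degree_legendre_poly_on: "a < b \<Longrightarrow> degree (legendre_poly_on a b n) = n"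
  by (simp add: legendre_poly_on_def degree_pcompose degree_legendre)

lemma legendre_nonzero: "legendre n \<noteq> 0"
proof (cases n)
  case 0 then show ?thesis by (simp add: legendre_def)
next
  case (Suc m) then show ?thesis using degree_legendre[of n] by auto
qed

lemma legendre_poly_on_nonzero: "a < b \<Longrightarrow> legendre_poly_on a b n \<noteq> 0"
  using legendre_nonzero[of n] by (simp add: legendre_poly_on_def pcompose_eq_0_iff)

text \<open>By the chain rule Rodrigues' formula survives the affine change of variable up to a
  constant factor; \<open>u\<close> is the pullback of \<open>x\<^sup>2 - 1\<close>.\<close>

lemma legendre_poly_on_Rodrigues:
  assumes "a < b"
  shows "\<exists>c u. c \<noteq> 0 \<and> poly u a = 0 \<and> poly u b = 0 \<and>
    legendre_poly_on a b n = smult c ((pderiv ^^ n) (u ^ n))"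
proof -
  define A where "A = [:- (a + b) / (b - a), 2 / (b - a):]"
  define u where "u = pcompose [:-1, 0, 1::real:] A"
  have A: "poly A a = -1" "poly A b = 1"
  proof -
    have "poly A t = (2 * t - a - b) / (b - a)" for t
      by (simp add: A_def diff_divide_distrib add_divide_distrib)
    then show "poly A a = -1" "poly A b = 1" using assms by (simp_all add: divide_eq_eq)
  qed
  have pc: "pcompose p A ^ n = pcompose (p ^ n) A" for p
    by (induction n) (simp_all add: pcompose_mult one_pCons)
  have "(pderiv ^^ n) (u ^ n) = (pderiv ^^ n) (pcompose ([:-1, 0, 1:] ^ n) A)"
    by (simp only: u_def pc)
  also have "\<dots> = smult ((2 / (b - a)) ^ n) (pcompose ((pderiv ^^ n) ([:-1, 0, 1:] ^ n)) A)"
    unfolding A_def by (rule higher_pderiv_pcompose_linear)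
  finally have D: "(pderiv ^^ n) (u ^ n) = smult ((2 / (b - a)) ^ n) (pcompose ((pderiv ^^ n) ([:-1, 0, 1:] ^ n)) A)" .
  define k where "k = (2 / (b - a)) ^ n"
  have k: "k \<noteq> 0" using assms by (simp add: k_def)
  have "legendre_poly_on a b n = smult (1 / (2 ^ n * fact n) / k) ((pderiv ^^ n) (u ^ n))"
    using k unfolding D k_def[symmetric] legendre_poly_on_def legendre_def A_def[symmetric]
    by (simp add: pcompose_smult)
  moreover have "poly u a = 0" "poly u b = 0" by (simp_all add: u_def poly_pcompose A)
  ultimately show ?thesis using k by (intro exI[of _ "1 / (2 ^ n * fact n) / k"] exI[of _ u]) simp
qed

text \<open>With Rodrigues' formula, \<open>n\<close> integrations by parts move all derivatives to
  \<open>q\<close>, and the \<open>n\<close>-th derivative of a polynomial of degree below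
  \<open>n\<close> is zero.\<close>

lemma legendre_poly_on_orthogonal:
  assumes "a < b" "degree q < n"
  shows "(\<integral>t. poly (legendre_poly_on a b n * q) t \<partial>(lebesgue_on {a..b})) = 0"
proof -
  obtain c u where u: "poly u a = 0" "poly u b = 0"
      and L: "legendre_poly_on a b n = smult c ((pderiv ^^ n) (u ^ n))"
    using legendre_poly_on_Rodrigues[OF assms(1)] by blast
  show ?thesis
    using integral_higher_pderiv[OF less_imp_le[OF assms(1)] u order_refl, of n q]
      higher_pderiv_eq_0[OF assms(2)] by (simp add: L)
qed

text \<open>Rolle's theorem between neighbouring zeros, the points of \<open>Z\<close> being added
  in increasing order. Keeping the new zeros strictly between \<open>Min Z\<close> and
  \<open>Max Z\<close> makes the next one, found beyond the old maximum, different from all earlier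
  ones.\<close>

lemma poly_Rolle_set:
  fixes p :: "real poly"
  assumes "finite Z" "Z \<noteq> {}" "\<forall>z\<in>Z. poly p z = 0"
  shows "\<exists>Z'. finite Z' \<and> Suc (card Z') = card Z \<and> Z' \<subseteq> {Min Z<..<Max Z} \<and> (\<forall>z\<in>Z'. poly (pderiv p) z = 0)"
  using assms
proof (induction Z rule: finite_linorder_max_induct)
  case (insert b A)
  show ?case
  proof (cases "A = {}")
    case True then show ?thesis by (intro exI[of _ "{}"]) auto
  next
    case False
    then obtain Z' where Z': "finite Z'" "Suc (card Z') = card A" "Z' \<subseteq> {Min A<..<Max A}"
        "\<forall>z\<in>Z'. poly (pderiv p) z = 0" using insert by auto
    have m: "Max A \<in> A" "Max A < b" "Min A \<le> Max A" using insert False by auto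
    then have p: "poly p (Max A) = 0" "poly p b = 0" using insert by auto
    obtain \<xi> where \<xi>: "Max A < \<xi>" "\<xi> < b" "poly (pderiv p) \<xi> = 0"
      using poly_MVT[OF m(2), of p] p m by auto
    have mm: "Min (insert b A) = Min A" "Max (insert b A) = b"
      using m insert(1) False by (simp_all add: min_absorb2 max_absorb1 del: Min_le_iff)
    have "Min A < \<xi>" using m \<xi> by (meson le_less_trans)
    then have sub: "insert \<xi> Z' \<subseteq> {Min (insert b A)<..<Max (insert b A)}"
      using Z'(3) \<xi> m(2) unfolding mm by force
    have "\<xi> \<notin> Z'" "b \<notin> A" using Z' \<xi> insert by auto
    then show ?thesis
      using Z' \<xi> insert(1) by (intro exI[of _ "insert \<xi> Z'"] conjI sub) auto
  qed
qed simp

text \<open>While \<open>k < n\<close>, the \<open>k\<close>-th derivative vanishes at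
  \<open>k\<close> interior points and also at \<open>a\<close> and \<open>b\<close>; Rolle's
  theorem on these \<open>k + 2\<close> points gives \<open>k + 1\<close> interior zeros of the next
  derivative.\<close>

lemma higher_pderiv_roots:
  fixes u :: "real poly"
  assumes ab: "a < b" and u: "poly u a = 0" "poly u b = 0" and "k \<le> n"
  shows "\<exists>Z. finite Z \<and> card Z = k \<and> Z \<subseteq> {a<..<b} \<and> (\<forall>z\<in>Z. poly ((pderiv ^^ k) (u ^ n)) z = 0)"
  using \<open>k \<le> n\<close>
proof (induction k)
  case (Suc k)
  then obtain Z where Z: "finite Z" "card Z = k" "Z \<subseteq> {a<..<b}" "\<forall>z\<in>Z. poly ((pderiv ^^ k) (u ^ n)) z = 0"
    by auto
  have "u ^ (n - k) dvd (pderiv ^^ k) (u ^ n)" using Suc.prems by (intro power_dvd_higher_pderiv) simp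
  moreover have "u dvd u ^ (n - k)" using Suc.prems by (intro dvd_power) simp
  ultimately have "u dvd (pderiv ^^ k) (u ^ n)" by (rule dvd_trans[rotated])
  then have z: "poly ((pderiv ^^ k) (u ^ n)) a = 0" "poly ((pderiv ^^ k) (u ^ n)) b = 0"
    using u by (auto elim!: dvdE)
  let ?Z = "insert a (insert b Z)"
  have "\<exists>Z'. finite Z' \<and> Suc (card Z') = card ?Z \<and> Z' \<subseteq> {Min ?Z<..<Max ?Z}
      \<and> (\<forall>z\<in>Z'. poly (pderiv ((pderiv ^^ k) (u ^ n))) z = 0)"
    using Z z by (intro poly_Rolle_set) auto
  moreover have "a \<notin> insert b Z" "b \<notin> Z" using Z(3) ab by auto
  then have "card ?Z = Suc (Suc k)" using Z(1,2) by simp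
  moreover have "Min ?Z = a" using Z ab by (intro Min_eqI) auto
  moreover have "Max ?Z = b" using Z ab by (intro Max_eqI) auto
  ultimately show ?case by auto
qed (auto intro: exI[of _ "{}"])

text \<open>Rolle's theorem yields \<open>n\<close> zeros inside the interval, and degree
  \<open>n\<close> leaves room for no others.\<close>

lemma legendre_on_zeros:
  assumes "a < b"
  shows "finite {t. legendre_on a b n t = 0}" "card {t. legendre_on a b n t = 0} = n"
    "{t. legendre_on a b n t = 0} \<subseteq> {a<..<b}"
proof -
  obtain c u where u: "poly u a = 0" "poly u b = 0"
      and L: "legendre_poly_on a b n = smult c ((pderiv ^^ n) (u ^ n))"
    using legendre_poly_on_Rodrigues[OF assms(1)] by blast
  obtain Z where Z: "finite Z" "card Z = n" "Z \<subseteq> {a<..<b}" "\<forall>z\<in>Z. poly ((pderiv ^^ n) (u ^ n)) z = 0"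
    using higher_pderiv_roots[OF assms u order_refl] by blast
  have eq: "{t. legendre_on a b n t = 0} = {t. poly (legendre_poly_on a b n) t = 0}"
    by (simp add: poly_legendre_poly_on)
  have fin: "finite {t. poly (legendre_poly_on a b n) t = 0}"
    using legendre_poly_on_nonzero[OF assms] by (rule poly_roots_finite)
  have "Z \<subseteq> {t. poly (legendre_poly_on a b n) t = 0}" using Z by (auto simp: L)
  moreover have "card {t. poly (legendre_poly_on a b n) t = 0} \<le> n"
    by (rule card_poly_roots_bound[OF legendre_poly_on_nonzero[OF assms, of n], unfolded degree_legendre_poly_on[OF assms]])
  ultimately have "Z = {t. poly (legendre_poly_on a b n) t = 0}"
    using Z fin by (metis card_seteq)
  then show "finite {t. legendre_on a b n t = 0}" "card {t. legendre_on a b n t = 0} = n"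
    "{t. legendre_on a b n t = 0} \<subseteq> {a<..<b}" using Z eq by auto
qed

subsection \<open>Legendre expansions\<close>

lemma legendre_on_continuous: "continuous_on S (legendre_on a b i)"
proof -
  have "continuous_on S (\<lambda>t. poly (legendre_poly_on a b i) t)" by (intro continuous_intros)
  then show ?thesis by (simp add: poly_legendre_poly_on)
qed

text \<open>The leading term is removed by a multiple of the Legendre polynomial of the same degree.
  The hypothesis speaks of coefficients instead of the degree so that the base case
  \<open>n = 0\<close> forces the zero polynomial.\<close>

lemma poly_legendre_expansion:
  fixes q :: "real poly"
  assumes ab: "a < b" and "\<forall>i\<ge>n. coeff q i = 0"
  shows "\<exists>c. q = (\<Sum>i<n. smult (c i) (legendre_poly_on a b i))"
  using assms(2)
proof (induction n arbitrary: q)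
  case 0
  then show ?case by (auto intro: poly_eqI)
next
  case (Suc n)
  let ?L = "legendre_poly_on a b n"
  have lc: "coeff ?L n \<noteq> 0"
    using degree_legendre_poly_on[OF ab, of n] legendre_poly_on_nonzero[OF ab, of n]
    by (metis leading_coeff_0_iff)
  define k where "k = coeff q n / coeff ?L n"
  have "\<forall>i\<ge>n. coeff (q - smult k ?L) i = 0"
  proof (intro allI impI)
    fix i assume "n \<le> i"
    then consider "i = n" | "Suc n \<le> i" by linarith
    then show "coeff (q - smult k ?L) i = 0"
    proof cases
      case 2
      then have "coeff ?L i = 0" using degree_legendre_poly_on[OF ab, of n] by (intro coeff_eq_0) simp
      then show ?thesis using Suc.prems 2 by simp
    qed (simp add: k_def lc)
  qed
  then obtain c where c: "q - smult k ?L = (\<Sum>i<n. smult (c i) (legendre_poly_on a b i))"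
    using Suc.IH by blast
  have "q = (\<Sum>i<n. smult (c i) (legendre_poly_on a b i)) + smult k ?L"
    using c by (metis diff_add_cancel)
  then have "q = (\<Sum>i<Suc n. smult ((c(n := k)) i) (legendre_poly_on a b i))" by simp
  then show ?case by blast
qed

text \<open>Here \<open>n\<close> counts terms, so degrees stay below \<open>n\<close>; the range of
  \<open>P \<tau> M\<close>, with degrees up to \<open>M\<close>, corresponds to
  \<open>Suc M\<close>.\<close>

definition legendre_sum :: "real \<Rightarrow> real \<Rightarrow> nat \<Rightarrow> (nat \<Rightarrow> real^'d) \<Rightarrow> real \<Rightarrow> real^'d" where
  "legendre_sum a b n c t = (\<Sum>i<n. legendre_on a b i t *\<^sub>R c i)"

lemma vec_poly_legendre_expansion:
  assumes ab: "a < b" and "vec_poly n f"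
  shows "\<exists>c. f = legendre_sum a b (Suc n) c"
proof -
  obtain p where p: "\<forall>j. degree (p j) \<le> n \<and> (\<forall>t. f t $ j = poly (p j) t)"
    using vec_poly_coordinates[OF assms(2)] ..
  have "\<exists>c. p j = (\<Sum>i<Suc n. smult (c i) (legendre_poly_on a b i))" for j
  proof (rule poly_legendre_expansion[OF ab], intro allI impI)
    fix i assume "Suc n \<le> i"
    then show "coeff (p j) i = 0" using p[THEN spec, of j] by (intro coeff_eq_0) simp
  qed
  then obtain c where c: "\<And>j. p j = (\<Sum>i<Suc n. smult (c j i) (legendre_poly_on a b i))" by metis
  have "f t = legendre_sum a b (Suc n) (\<lambda>i. \<chi> j. c j i) t" for t
    by (simp add: vec_eq_iff p c poly_sum poly_legendre_poly_on legendre_sum_def mult.commute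
        del: sum.lessThan_Suc)
  then show ?thesis by blast
qed

lemma legendre_sum_continuous: "continuous_on S (legendre_sum a b n c)"
  unfolding legendre_sum_def by (intro continuous_intros legendre_on_continuous)

lemma legendre_sum_L2: "legendre_sum a b n c \<in> L2 {a..b}"
  by (intro L2_continuous legendre_sum_continuous)

text \<open>With the Rodrigues normalisation the polynomials are orthogonal but not orthonormal;
  these squared norms divide the moments in \<open>legendre_coeff\<close>.\<close>

definition legendre_sqnorm :: "real \<Rightarrow> real \<Rightarrow> nat \<Rightarrow> real" where
  "legendre_sqnorm a b i = (\<integral>t. (legendre_on a b i t)\<^sup>2 \<partial>(lebesgue_on {a..b}))"

definition legendre_moment :: "real \<Rightarrow> real \<Rightarrow> nat \<Rightarrow> (real \<Rightarrow> real^'d) \<Rightarrow> real^'d" where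
  "legendre_moment a b i f = (\<integral>t. legendre_on a b i t *\<^sub>R f t \<partial>(lebesgue_on {a..b}))"

text \<open>A vanishing integral would make the polynomial zero on the whole interval, including the
  endpoint \<open>a\<close>, whereas its zeros are interior.\<close>

lemma legendre_sqnorm_pos:
  assumes ab: "a < b" shows "0 < legendre_sqnorm a b i"
proof (rule ccontr)
  assume "\<not> 0 < legendre_sqnorm a b i"
  moreover have "0 \<le> legendre_sqnorm a b i" by (simp add: legendre_sqnorm_def)
  ultimately have "legendre_sqnorm a b i = 0" by linarith
  then have "AE t in lebesgue_on {a..b}. (legendre_on a b i t)\<^sup>2 = 0"
    unfolding legendre_sqnorm_def
    by (subst (asm) integral_nonneg_eq_0_iff_AE)
      (auto intro!: continuous_imp_integrable_real continuous_intros legendre_on_continuous)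
  then have ae: "AE t in lebesgue_on {a..b}. legendre_on a b i t = 0" by simp
  have "\<And>t. t \<in> {a..b} \<Longrightarrow> legendre_on a b i t = 0"
    by (rule continuous_AE_eq_imp_eq[OF legendre_on_continuous _ ab ae]) auto
  then have "{a..b} \<subseteq> {t. legendre_on a b i t = 0}" by auto
  then have "{a..b} \<subseteq> {a<..<b}" using legendre_on_zeros(3)[OF ab] by (rule order_trans)
  then have "a \<in> {a<..<b}" using ab by (auto dest: subsetD[where c = a])
  then show False by simp
qed

lemma legendre_on_orthogonal:
  assumes ab: "a < b"
  shows "(\<integral>t. legendre_on a b i t * legendre_on a b k t \<partial>(lebesgue_on {a..b})) =
    (if i = k then legendre_sqnorm a b i else 0)"
proof (cases i k rule: linorder_cases)
  case less
  then show ?thesis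
    using legendre_poly_on_orthogonal[OF ab, of "legendre_poly_on a b i" k]
    by (simp add: degree_legendre_poly_on[OF ab] poly_legendre_poly_on mult.commute)
next
  case greater
  then show ?thesis
    using legendre_poly_on_orthogonal[OF ab, of "legendre_poly_on a b k" i]
    by (simp add: degree_legendre_poly_on[OF ab] poly_legendre_poly_on)
qed (simp add: legendre_sqnorm_def power2_eq_square)

lemma legendre_moment_integrable:
  "f \<in> L2 {a..b} \<Longrightarrow> integrable (lebesgue_on {a..b}) (\<lambda>t. legendre_on a b i t *\<^sub>R f t)"
  by (intro scaleR_continuous_integrable legendre_on_continuous)

lemma legendre_moment_diff:
  assumes "f \<in> L2 {a..b}" "g \<in> L2 {a..b}"
  shows "legendre_moment a b i (\<lambda>t. f t - g t) = legendre_moment a b i f - legendre_moment a b i g"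
  using legendre_moment_integrable[OF assms(1)] legendre_moment_integrable[OF assms(2)]
  by (simp add: legendre_moment_def scaleR_diff_right)

lemma legendre_moment_sum:
  assumes ab: "a < b"
  shows "legendre_moment a b k (legendre_sum a b n c) = (if k < n then legendre_sqnorm a b k *\<^sub>R c k else 0)"
proof -
  have i: "integrable (lebesgue_on {a..b}) (\<lambda>t. legendre_on a b k t * legendre_on a b i t)" for i
    by (intro continuous_imp_integrable_real continuous_intros legendre_on_continuous)
  have "legendre_moment a b k (legendre_sum a b n c) =
    (\<integral>t. (\<Sum>i<n. (legendre_on a b k t * legendre_on a b i t) *\<^sub>R c i) \<partial>(lebesgue_on {a..b}))"
    by (simp add: legendre_moment_def legendre_sum_def scaleR_sum_right)
  also have "\<dots> = (\<Sum>i<n. (if k = i then legendre_sqnorm a b k else 0) *\<^sub>R c i)"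
    by (subst Bochner_Integration.integral_sum)
      (auto simp: i legendre_on_orthogonal[OF ab] intro!: integrable_scaleR_left)
  also have "\<dots> = (\<Sum>i<n. if k = i then legendre_sqnorm a b k *\<^sub>R c k else 0)"
    by (intro sum.cong) auto
  finally show ?thesis by simp
qed

lemma legendre_moment_inner:
  assumes "f \<in> L2 {a..b}"
  shows "(\<integral>t. f t \<bullet> (legendre_on a b i t *\<^sub>R x) \<partial>(lebesgue_on {a..b})) = legendre_moment a b i f \<bullet> x"
  using integral_inner_left[where c = x, OF legendre_moment_integrable[OF assms]]
  by (simp add: legendre_moment_def)

lemma legendre_sum_inner:
  assumes "f \<in> L2 {a..b}"
  shows "(\<integral>t. f t \<bullet> legendre_sum a b n c t \<partial>(lebesgue_on {a..b})) = (\<Sum>i<n. legendre_moment a b i f \<bullet> c i)"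
proof -
  have "integrable (lebesgue_on {a..b}) (\<lambda>t. f t \<bullet> (legendre_on a b i t *\<^sub>R c i))" for i
    by (intro L2_inner_integrable assms L2_continuous continuous_intros legendre_on_continuous)
  then show ?thesis
    unfolding legendre_sum_def inner_sum_right
    by (subst Bochner_Integration.integral_sum) (simp_all only: legendre_moment_inner[OF assms])
qed

definition legendre_coeff :: "real \<Rightarrow> real \<Rightarrow> (real \<Rightarrow> real^'d) \<Rightarrow> nat \<Rightarrow> real^'d" where
  "legendre_coeff a b f i = (1 / legendre_sqnorm a b i) *\<^sub>R legendre_moment a b i f"

abbreviation legendre_proj :: "real \<Rightarrow> real \<Rightarrow> nat \<Rightarrow> (real \<Rightarrow> real^'d) \<Rightarrow> real \<Rightarrow> real^'d" where
  "legendre_proj a b n f \<equiv> legendre_sum a b n (legendre_coeff a b f)"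

context
  fixes a b :: real and f :: "real \<Rightarrow> real^'d"
  assumes ab: "a < b" and f: "f \<in> L2 {a..b}"
begin

lemma legendre_proj_residual_moment:
  assumes "k < n" shows "legendre_moment a b k (\<lambda>t. f t - legendre_proj a b n f t) = 0"
  using assms legendre_sqnorm_pos[OF ab, of k]
  by (simp add: legendre_moment_diff[OF f legendre_sum_L2] legendre_moment_sum[OF ab] legendre_coeff_def)

lemma legendre_proj_orthogonal:
  "(\<integral>t. (f t - legendre_proj a b n f t) \<bullet> legendre_sum a b n c t \<partial>(lebesgue_on {a..b})) = 0"
  by (simp add: legendre_sum_inner[OF L2_diff[OF f legendre_sum_L2]] legendre_proj_residual_moment)

text \<open>The residual of \<open>f\<close> is orthogonal to every Legendre sum with
  \<open>n\<close> terms, in particular to the difference of two of them.\<close>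

lemma legendre_proj_Pythagoras:
  "(L2norm {a..b} (\<lambda>t. f t - legendre_sum a b n c t))\<^sup>2 =
    (L2norm {a..b} (\<lambda>t. f t - legendre_proj a b n f t))\<^sup>2 +
    (L2norm {a..b} (\<lambda>t. legendre_proj a b n f t - legendre_sum a b n c t))\<^sup>2"
proof -
  have d: "legendre_proj a b n f t - legendre_sum a b n c t =
      legendre_sum a b n (\<lambda>i. legendre_coeff a b f i - c i) t" for t
    by (simp add: legendre_sum_def scaleR_diff_right sum_subtractf)
  have "(\<lambda>t. f t - legendre_sum a b n c t) =
      (\<lambda>t. (f t - legendre_proj a b n f t) + (legendre_proj a b n f t - legendre_sum a b n c t))"
    by simp
  then show ?thesis
    using L2norm_sq_add[OF L2_diff[OF f legendre_sum_L2] legendre_sum_L2]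
      legendre_proj_orthogonal by (simp only: d mult_zero_right add_0_right)
qed

lemma legendre_proj_best:
  "L2norm {a..b} (\<lambda>t. f t - legendre_proj a b n f t) \<le> L2norm {a..b} (\<lambda>t. f t - legendre_sum a b n c t)"
  by (rule power2_le_imp_le) (simp_all add: legendre_proj_Pythagoras[of n c])

lemma legendre_proj_residual_le: "L2norm {a..b} (\<lambda>t. f t - legendre_proj a b n f t) \<le> L2norm {a..b} f"
  using legendre_proj_best[of n "\<lambda>_. 0"] by (simp add: legendre_sum_def)

lemma legendre_proj_norm_le: "L2norm {a..b} (legendre_proj a b n f) \<le> L2norm {a..b} f"
proof (rule power2_le_imp_le)
  have "(L2norm {a..b} f)\<^sup>2 = (L2norm {a..b} (\<lambda>t. f t - legendre_proj a b n f t))\<^sup>2 +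
    (L2norm {a..b} (legendre_proj a b n f))\<^sup>2"
    using legendre_proj_Pythagoras[of n "\<lambda>_. 0"] by (simp add: legendre_sum_def[of _ _ _ "\<lambda>_. 0"])
  then show "(L2norm {a..b} (legendre_proj a b n f))\<^sup>2 \<le> (L2norm {a..b} f)\<^sup>2" by simp
qed simp

text \<open>The projection is the best approximation, hence at least as good as the polynomial
  provided by density as soon as \<open>n\<close> exceeds its degree bound.\<close>

lemma legendre_proj_tendsto:
  "(\<lambda>n. L2norm {a..b} (\<lambda>t. f t - legendre_proj a b n f t)) \<longlonglongrightarrow> 0"
proof (rule LIMSEQ_I)
  fix e :: real assume "0 < e"
  then obtain m q where q: "vec_poly m q" "L2norm {a..b} (\<lambda>t. f t - q t) < e"
    using L2_poly_dense[OF f ab] by blast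
  have "L2norm {a..b} (\<lambda>t. f t - legendre_proj a b n f t) < e" if n: "Suc m \<le> n" for n
  proof -
    obtain k where k: "n = Suc k" using n by (cases n) auto
    have "vec_poly k q" using q(1) n k by (intro vec_poly_mono[OF q(1)]) simp
    then obtain c where "q = legendre_sum a b n c" using vec_poly_legendre_expansion[OF ab] k by blast
    then show ?thesis using legendre_proj_best[of n c] q(2) by simp
  qed
  then show "\<exists>no. \<forall>n\<ge>no. norm (L2norm {a..b} (\<lambda>t. f t - legendre_proj a b n f t) - 0) < e"
    by (intro exI[of _ "Suc m"]) simp
qed

text \<open>The left side is a definite description, so uniqueness is part of the work: an expansion
  converging in norm determines each of its coefficients.\<close>

lemma legendre_coeffs_eq: "legendre_coeffs a b f = legendre_coeff a b f"
  unfolding legendre_coeffs_def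
proof (rule the_equality)
  show "(\<lambda>n. L2norm {a..b} (\<lambda>t. f t - (\<Sum>i<n. legendre_on a b i t *\<^sub>R legendre_coeff a b f i))) \<longlonglongrightarrow> 0"
    using legendre_proj_tendsto by (simp only: legendre_sum_def)
next
  fix c assume "(\<lambda>n. L2norm {a..b} (\<lambda>t. f t - (\<Sum>i<n. legendre_on a b i t *\<^sub>R c i))) \<longlonglongrightarrow> 0"
  then have lim: "(\<lambda>n. L2norm {a..b} (\<lambda>t. f t - legendre_sum a b n c t)) \<longlonglongrightarrow> 0"
    by (simp only: legendre_sum_def)
  have "c k = legendre_coeff a b f k" for k
  proof -
    \<comment> \<open>For every \<open>n > k\<close> this is the \<open>k\<close>-th moment of the
      residual of the partial sum with \<open>n\<close> terms, so Cauchy-Schwarz bounds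
      \<open>x \<bullet> x\<close> by a multiple of the norm of that residual.\<close>
    define x where "x = legendre_moment a b k f - legendre_sqnorm a b k *\<^sub>R c k"
    let ?g = "\<lambda>t. legendre_on a b k t *\<^sub>R x"
    have g: "?g \<in> L2 {a..b}" by (intro L2_continuous continuous_intros legendre_on_continuous)
    have "(\<lambda>n. L2norm {a..b} (\<lambda>t. f t - legendre_sum a b n c t) * L2norm {a..b} ?g) \<longlonglongrightarrow> 0"
      using tendsto_mult_right[OF lim] by simp
    moreover have "x \<bullet> x \<le> L2norm {a..b} (\<lambda>t. f t - legendre_sum a b n c t) * L2norm {a..b} ?g"
      if "Suc k \<le> n" for n
    proof -
      have "x \<bullet> x = (\<integral>t. (f t - legendre_sum a b n c t) \<bullet> ?g t \<partial>(lebesgue_on {a..b}))"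
        using that by (simp only: legendre_moment_inner[OF L2_diff[OF f legendre_sum_L2]]
          legendre_moment_diff[OF f legendre_sum_L2] legendre_moment_sum[OF ab])
          (simp add: x_def)
      also have "\<dots> \<le> L2norm {a..b} (\<lambda>t. f t - legendre_sum a b n c t) * L2norm {a..b} ?g"
        using L2_Cauchy_Schwarz[OF L2_diff[OF f legendre_sum_L2] g] by (rule abs_le_D1)
      finally show ?thesis .
    qed
    ultimately have "x \<bullet> x \<le> 0" by (intro LIMSEQ_le_const) auto
    then have "x = 0" by (metis inner_ge_zero inner_eq_zero_iff order_antisym)
    then show ?thesis using legendre_sqnorm_pos[OF ab, of k] by (simp add: x_def legendre_coeff_def)
  qed
  then show "c = legendre_coeff a b f" by blast
qed

end

lemma legendre_proj_vec_poly:
  assumes ab: "a < b" and "vec_poly n q"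
  shows "legendre_proj a b (Suc n) q = q"
proof -
  obtain c where c: "q = legendre_sum a b (Suc n) c"
    using vec_poly_legendre_expansion[OF assms] by blast
  have "legendre_coeff a b q i = c i" if "i < Suc n" for i
    using that legendre_sqnorm_pos[OF ab, of i] by (simp add: legendre_coeff_def c legendre_moment_sum[OF ab])
  then have "legendre_proj a b (Suc n) q t = legendre_sum a b (Suc n) c t" for t
    unfolding legendre_sum_def by (intro sum.cong) auto
  then show ?thesis using c by blast
qed

lemma legendre_coeff_cong_AE:
  assumes "f \<in> L2 {a..b}" "g \<in> L2 {a..b}" "AE t in lebesgue_on {a..b}. f t = g t"
  shows "legendre_coeff a b f = legendre_coeff a b g"
proof -
  have "legendre_moment a b i f = legendre_moment a b i g" for i
    unfolding legendre_moment_def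
    using legendre_moment_integrable[OF assms(1)] legendre_moment_integrable[OF assms(2)] assms(3)
    by (intro integral_cong_AE) auto
  then show ?thesis by (simp add: legendre_coeff_def fun_eq_iff)
qed

lemma P_R_eq_legendre_proj:
  assumes "0 < \<tau>" "f \<in> L2 {-\<tau>..0}"
  shows "P \<tau> M (R \<tau> M f) = legendre_proj (-\<tau>) 0 (Suc M) f"
proof
  fix t
  have "P \<tau> M (R \<tau> M f) t = (\<Sum>i=0..M. legendre_on (-\<tau>) 0 i t *\<^sub>R legendre_coeff (-\<tau>) 0 f i)"
    unfolding P_def R_def using assms by (intro sum.cong) (auto simp: legendre_coeffs_eq)
  then show "P \<tau> M (R \<tau> M f) t = legendre_proj (-\<tau>) 0 (Suc M) f t"
    by (simp add: legendre_sum_def lessThan_Suc_atMost atMost_atLeast0 del: sum.lessThan_Suc)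
qed

subsection \<open>Interpolation at the Gauss-Legendre nodes\<close>

text \<open>The variance of a binomial mean. The square is expanded in terms of 1, \<open>k\<close>
  and \<open>k * (k - 1)\<close>, whose Bernstein sums are known.\<close>

lemma Bernstein_variance:
  assumes "0 < n"
  shows "(\<Sum>k\<le>n. (x - real k / real n)\<^sup>2 * Bernstein n k x) = x * (1 - x) / real n"
proof -
  let ?B = "\<lambda>k. Bernstein n k x"
  have "(\<Sum>k\<le>n. (real n * x - real k)\<^sup>2 * ?B k) =
      (\<Sum>k\<le>n. (real n * x)\<^sup>2 * ?B k + (1 - 2 * real n * x) * (real k * ?B k) + real k * (real k - 1) * ?B k)"
    by (intro sum.cong) (auto simp: algebra_simps power2_eq_square)
  also have "\<dots> = (real n * x)\<^sup>2 + (1 - 2 * real n * x) * (real n * x) + real n * (real n - 1) * x\<^sup>2"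
    by (simp only: sum.distrib sum_distrib_left[symmetric] sum_Bernstein sum_k_Bernstein sum_kk_Bernstein mult_1_right)
  also have "\<dots> = real n * (x * (1 - x))" by (simp add: algebra_simps power2_eq_square)
  finally have 1: "(\<Sum>k\<le>n. (real n * x - real k)\<^sup>2 * ?B k) = real n * (x * (1 - x))" .
  have "(\<Sum>k\<le>n. (x - real k / real n)\<^sup>2 * ?B k) = (\<Sum>k\<le>n. (real n * x - real k)\<^sup>2 * ?B k / (real n)\<^sup>2)"
    using assms by (intro sum.cong) (auto simp: field_simps power2_eq_square)
  also have "\<dots> = real n * (x * (1 - x)) / (real n)\<^sup>2"
    by (simp only: sum_divide_distrib[symmetric] 1)
  finally show ?thesis using assms by (simp add: power2_eq_square)
qed

text \<open>If \<open>sqrt x > e\<close> then \<open>e ^ 3 * sqrt x \<le> (sqrt x) ^ 4\<close>. The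
  inequality trades the Hoelder modulus for a quadratic one, which the variance of the Bernstein
  weights controls.\<close>

lemma sqrt_le_linear_quartic:
  assumes "0 < e" "0 \<le> x" shows "sqrt x \<le> e + x\<^sup>2 / e ^ 3"
proof (cases "sqrt x \<le> e")
  case True
  then show ?thesis using assms by (smt (verit) divide_nonneg_pos zero_le_power2 zero_less_power)
next
  case False
  define y where "y = sqrt x"
  have y: "e \<le> y" "x = y ^ 2" using False assms by (auto simp: y_def)
  have "y * e ^ 3 \<le> y * y ^ 3" using y assms by (intro mult_left_mono power_mono) auto
  also have "\<dots> = x\<^sup>2" by (simp add: y(2) power_mult[symmetric] power_Suc[symmetric] del: power_Suc)
  finally have "y \<le> x\<^sup>2 / e ^ 3" using assms by (simp add: field_simps)
  then show ?thesis using assms by (simp add: y_def)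
qed

text \<open>The order of the quantifiers is the point: \<open>N0\<close> depends on \<open>h\<close>
  and \<epsilon> only, and the error is proportional to the Hoelder constant \<open>K\<close>. The
  approximant is the Bernstein polynomial of \<open>u\<close> transported to
  \<open>{0..h}\<close>.\<close>

lemma Holder_half_poly_approx:
  assumes h: "0 < h" and \<epsilon>: "0 < (\<epsilon>::real)"
  shows "\<exists>N0. \<forall>n\<ge>N0. \<forall>(u :: real \<Rightarrow> real^'d) K. 0 \<le> K \<longrightarrow>
    (\<forall>t\<in>{0..h}. \<forall>r\<in>{0..h}. norm (u t - u r) \<le> K * sqrt \<bar>t - r\<bar>) \<longrightarrow>
    (\<exists>p. vec_poly n p \<and> (\<forall>t\<in>{0..h}. norm (u t - p t) \<le> K * \<epsilon>))"
proof -
  \<comment> \<open>One half pays for the constant part of \<open>sqrt_le_linear_quartic\<close>,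
    the other for its quadratic part.\<close>
  define e where "e = \<epsilon> / 2"
  have e: "0 < e" using \<epsilon> by (simp add: e_def)
  \<comment> \<open>Ensures \<open>h\<^sup>2 / e ^ 3 / n \<le> e\<close> from \<open>N0\<close> on,
    where \<open>h\<^sup>2 / n\<close> bounds the variance in the variable \<open>t\<close>.\<close>
  obtain N0 where N0: "h\<^sup>2 / e ^ 4 \<le> real N0" using real_arch_simple by blast
  show ?thesis
  proof (intro exI[of _ "Suc N0"] allI impI)
    fix n and u :: "real \<Rightarrow> real^'d" and K :: real
    assume n: "Suc N0 \<le> n" and K: "0 \<le> K"
      and H: "\<forall>t\<in>{0..h}. \<forall>r\<in>{0..h}. norm (u t - u r) \<le> K * sqrt \<bar>t - r\<bar>"
    have n0: "0 < n" using n by simp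
    define c where "c k = smult (real (n choose k)) ([:0, 1 / h:] ^ k * [:1, - 1 / h:] ^ (n - k))" for k
    have c: "poly (c k) t = Bernstein n k (t / h)" for k t
      by (simp add: c_def Bernstein_def poly_power)
    define p where "p t = (\<Sum>k\<le>n. poly (c k) t *\<^sub>R u (h * (real k / real n)))" for t
    have "vec_poly n p" unfolding p_def
    proof (intro vec_poly_sum vec_poly_poly_scaleR)
      fix k assume k: "k \<in> {..n}"
      have d: "degree ([:0, 1 / h:] ^ k) \<le> k" "degree ([:1, - 1 / h:] ^ (n - k)) \<le> n - k"
        by (rule order_trans[OF degree_power_le], simp)+
      have "degree (c k) \<le> degree ([:0, 1 / h:] ^ k * [:1, - 1 / h:] ^ (n - k))"
        unfolding c_def by (rule degree_smult_le)
      also have "\<dots> \<le> degree ([:0, 1 / h:] ^ k) + degree ([:1, - 1 / h:] ^ (n - k))" by (rule degree_mult_le)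
      also have "\<dots> \<le> n" using d k by simp
      finally show "degree (c k) \<le> n" .
    qed
    moreover have "norm (u t - p t) \<le> K * \<epsilon>" if t: "t \<in> {0..h}" for t
    proof -
      define x where "x = t / h"
      have x: "0 \<le> x" "x \<le> 1" and tx: "t = h * x" using t h by (auto simp: x_def)
      let ?B = "\<lambda>k. Bernstein n k x"
      have B0: "0 \<le> ?B k" for k using x by (intro Bernstein_nonneg)
      have "u t - p t = (\<Sum>k\<le>n. ?B k *\<^sub>R (u t - u (h * (real k / real n))))"
        by (simp add: p_def c x_def[symmetric] scaleR_diff_right sum_subtractf scaleR_sum_left[symmetric])
      also have "norm \<dots> \<le> (\<Sum>k\<le>n. ?B k * (K * (e + (h\<^sup>2 * (x - real k / real n)\<^sup>2) / e ^ 3)))"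
      proof (rule sum_norm_le)
        fix k assume "k \<in> {..n}"
        then have "real k / real n \<le> 1" using n0 by simp
        then have k: "h * (real k / real n) \<in> {0..h}"
          using h mult_left_mono[of "real k / real n" 1 h] by simp
        have "norm (u t - u (h * (real k / real n))) \<le> K * sqrt \<bar>t - h * (real k / real n)\<bar>"
          using H[rule_format, OF t k] .
        also have "\<dots> \<le> K * (e + \<bar>t - h * (real k / real n)\<bar>\<^sup>2 / e ^ 3)"
          using K e by (intro mult_left_mono sqrt_le_linear_quartic) auto
        also have "\<bar>t - h * (real k / real n)\<bar>\<^sup>2 = h\<^sup>2 * (x - real k / real n)\<^sup>2"
          by (simp add: tx right_diff_distrib[symmetric] power_mult_distrib del: times_divide_eq_right)
        finally show "norm (?B k *\<^sub>R (u t - u (h * (real k / real n)))) \<le>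
            ?B k * (K * (e + (h\<^sup>2 * (x - real k / real n)\<^sup>2) / e ^ 3))"
          using B0[of k] by (simp add: mult_left_mono)
      qed
      also have "\<dots> = (\<Sum>k\<le>n. (K * e) * ?B k + (K * h\<^sup>2 / e ^ 3) * ((x - real k / real n)\<^sup>2 * ?B k))"
        by (intro sum.cong) (auto simp: algebra_simps)
      also have "\<dots> = K * e + (K * h\<^sup>2 / e ^ 3) * (x * (1 - x) / real n)"
        by (simp only: sum.distrib sum_distrib_left[symmetric] sum_Bernstein Bernstein_variance[OF n0] mult_1_right)
      also have "\<dots> \<le> K * e + (K * h\<^sup>2 / e ^ 3) * (1 / real n)"
      proof (intro add_left_mono mult_left_mono divide_right_mono)
        show "x * (1 - x) \<le> 1" using x by (intro mult_le_one) auto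
        show "0 \<le> K * h\<^sup>2 / e ^ 3" using K e by simp
      qed simp
      also have "\<dots> = K * e + K * (h\<^sup>2 / e ^ 3 / real n)" by (simp add: mult.assoc)
      also have "\<dots> \<le> K * e + K * e"
      proof (intro add_left_mono mult_left_mono K)
        have "h\<^sup>2 / e ^ 4 \<le> real n" using N0 n by linarith
        then have "h\<^sup>2 \<le> real n * e ^ 4" using e by (simp add: pos_divide_le_eq)
        moreover have "e ^ 4 = e * e ^ 3" by (simp add: power_Suc[symmetric])
        ultimately show "h\<^sup>2 / e ^ 3 / real n \<le> e" using e n0
          by (simp add: pos_divide_le_eq mult_ac)
      qed
      also have "\<dots> = K * \<epsilon>" by (simp add: e_def)
      finally show ?thesis .
    qed
    ultimately show "\<exists>p. vec_poly n p \<and> (\<forall>t\<in>{0..h}. norm (u t - p t) \<le> K * \<epsilon>)" by blast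
  qed
qed

context
  fixes h :: real and N :: nat
  assumes h: "0 < h" and N: "1 \<le> N"
begin

lemma node_zero: "i \<in> {1..N} \<Longrightarrow> legendre_on 0 h N (node h N i) = 0"
  and node_inside: "i \<in> {1..N} \<Longrightarrow> node h N i \<in> {0<..<h}"
  and node_inj: "inj_on (node h N) {1..N}"
proof -
  let ?Z = "{t. legendre_on 0 h N t = 0}"
  note z = legendre_on_zeros[OF h, of N]
  have mem: "node h N i \<in> ?Z" if "i \<in> {1..N}" for i
  proof -
    have "sorted_list_of_set ?Z ! (i - 1) \<in> set (sorted_list_of_set ?Z)"
      using that z by (intro nth_mem) auto
    then show ?thesis using z(1) by (simp add: node_def)
  qed
  then show "i \<in> {1..N} \<Longrightarrow> legendre_on 0 h N (node h N i) = 0" by blast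
  show "i \<in> {1..N} \<Longrightarrow> node h N i \<in> {0<..<h}" using mem z(3) by blast
  show "inj_on (node h N) {1..N}"
  proof (rule inj_onI)
    fix i j assume ij: "i \<in> {1..N}" "j \<in> {1..N}" "node h N i = node h N j"
    have "i - 1 = j - 1"
      using ij z by (subst nth_eq_iff_index_eq[of "sorted_list_of_set ?Z", symmetric])
        (auto simp: node_def)
    then show "i = j" using ij by auto
  qed
qed

definition lagrange_poly :: "nat \<Rightarrow> real poly" where
  "lagrange_poly i = (\<Prod>j\<in>{1..N} - {i}. smult (1 / (node h N i - node h N j)) [:- node h N j, 1:])"

lemma poly_lagrange_poly: "poly (lagrange_poly i) t = lagrange_basis h N i t"
  by (simp add: lagrange_poly_def lagrange_basis_def poly_prod diff_divide_distrib)

lemma degree_lagrange_poly: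
  assumes "i \<in> {1..N}" shows "degree (lagrange_poly i) < N"
proof -
  have "degree (lagrange_poly i) \<le> (\<Sum>j\<in>{1..N} - {i}. degree (smult (1 / (node h N i - node h N j)) [:- node h N j, 1:]))"
    unfolding lagrange_poly_def by (rule order_trans[OF degree_prod_sum_le]) (simp_all add: o_def)
  also have "\<dots> \<le> (\<Sum>j\<in>{1..N} - {i}. 1)"
  proof (rule sum_mono)
    show "degree (smult c [:- x, 1:]) \<le> 1" for c x :: real
      using degree_smult_le[of c "[:- x, 1:]"] by simp
  qed
  also have "\<dots> = N - 1" using assms by simp
  finally show ?thesis using N by simp
qed

lemma lagrange_basis_node:
  assumes "i \<in> {1..N}" "j \<in> {1..N}"
  shows "lagrange_basis h N i (node h N j) = (if i = j then 1 else 0)"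
proof (cases "i = j")
  case True
  have "(node h N i - node h N k) / (node h N i - node h N k) = 1" if "k \<in> {1..N} - {i}" for k
    using that assms inj_onD[OF node_inj, of i k] by auto
  then have "lagrange_basis h N i (node h N i) = 1"
    unfolding lagrange_basis_def by (intro prod.neutral) blast
  then show ?thesis using True by simp
next
  case False
  then have "lagrange_basis h N i (node h N j) = 0"
    using assms unfolding lagrange_basis_def by (intro prod_zero bexI[of _ j]) auto
  then show ?thesis using False by simp
qed

lemma poly_zero_at_nodes:
  fixes p :: "real poly"
  assumes "degree p < N" "\<And>i. i \<in> {1..N} \<Longrightarrow> poly p (node h N i) = 0"
  shows "p = 0"
proof (rule poly_eqI_degree[where A = "node h N ` {1..N}"])
  have "card (node h N ` {1..N}) = N" using node_inj by (simp add: card_image)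
  then show "degree p < card (node h N ` {1..N})" "degree (0 :: real poly) < card (node h N ` {1..N})"
    using assms(1) N by auto
qed (use assms(2) in auto)

lemma Pplus_vec_poly: "vec_poly (N - 1) (Pplus h N W)"
proof -
  have "vec_poly (N - 1) (\<lambda>t. \<Sum>i=1..N. poly (lagrange_poly i) t *\<^sub>R W i)"
    using degree_lagrange_poly N by (intro vec_poly_sum vec_poly_poly_scaleR) fastforce
  then show ?thesis by (simp add: Pplus_def poly_lagrange_poly)
qed

lemma Pplus_node:
  assumes "i \<in> {1..N}" shows "Pplus h N W (node h N i) = W i"
proof -
  have "Pplus h N W (node h N i) = (\<Sum>j=1..N. if j = i then W j else 0)"
    unfolding Pplus_def using assms by (intro sum.cong) (auto simp: lagrange_basis_node)
  then show ?thesis using assms by simp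
qed

lemma vec_poly_eq_if_eq_at_nodes:
  assumes "vec_poly (N - 1) f" "vec_poly (N - 1) g" "\<And>i. i \<in> {1..N} \<Longrightarrow> f (node h N i) = g (node h N i)"
  shows "f = g"
proof -
  obtain p where p: "\<forall>j. degree (p j) \<le> N - 1 \<and> (\<forall>t. (f t - g t) $ j = poly (p j) t)"
    using vec_poly_coordinates[OF vec_poly_diff[OF assms(1,2)]] ..
  have "p j = 0" for j
  proof (rule poly_zero_at_nodes)
    show "degree (p j) < N" using p[THEN spec, of j] N by linarith
    show "poly (p j) (node h N i) = 0" if "i \<in> {1..N}" for i
      using p assms(3)[OF that] by (metis diff_self zero_index)
  qed
  then have "f t - g t = 0" for t using p by (simp add: vec_eq_iff)
  then show ?thesis by (simp add: fun_eq_iff)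
qed

lemma Pplus_interpolates_poly:
  assumes "vec_poly (N - 1) q" shows "Pplus h N (\<lambda>i. q (node h N i)) = q"
  by (rule vec_poly_eq_if_eq_at_nodes[OF Pplus_vec_poly assms]) (rule Pplus_node)

text \<open>Here the Gauss nodes matter. The product vanishes at all of them, hence equals
  \<open>?L * q\<close> for the Legendre polynomial \<open>?L\<close> of degree \<open>N\<close>;
  since \<open>q\<close> has degree below \<open>N\<close>, the integral is zero.\<close>

lemma lagrange_basis_orthogonal:
  assumes ij: "i \<in> {1..N}" "j \<in> {1..N}" "i \<noteq> j"
  shows "(\<integral>t. lagrange_basis h N i t * lagrange_basis h N j t \<partial>(lebesgue_on {0..h})) = 0"
proof -
  let ?L = "legendre_poly_on 0 h N" and ?p = "lagrange_poly i * lagrange_poly j"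
  define q where "q = ?p div ?L"
  have dL: "degree ?L = N" "?L \<noteq> 0" using degree_legendre_poly_on[OF h] legendre_poly_on_nonzero[OF h] by auto
  have "?p mod ?L = 0"
  proof (rule poly_zero_at_nodes)
    show "degree (?p mod ?L) < N" using degree_mod_less'[of ?L ?p] dL N by (cases "?p mod ?L = 0") auto
    fix k assume k: "k \<in> {1..N}"
    have "poly ?p (node h N k) = poly (?L * q + ?p mod ?L) (node h N k)"
      by (simp add: q_def mult.commute)
    then have "poly (?p mod ?L) (node h N k) = poly ?p (node h N k)"
      using node_zero[OF k] by (simp add: poly_legendre_poly_on)
    also have "\<dots> = 0" using ij k by (auto simp: poly_lagrange_poly lagrange_basis_node)
    finally show "poly (?p mod ?L) (node h N k) = 0" .
  qed
  then have pq: "?p = ?L * q" by (metis q_def add.right_neutral mult.commute div_mult_mod_eq)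
  have "(\<integral>t. poly (?L * q) t \<partial>(lebesgue_on {0..h})) = 0"
  proof (cases "q = 0")
    case False
    then have "N + degree q = degree ?p" using dL by (simp add: pq degree_mult_eq)
    also have "\<dots> \<le> degree (lagrange_poly i) + degree (lagrange_poly j)" by (rule degree_mult_le)
    finally have "degree q < N" using degree_lagrange_poly[OF ij(1)] degree_lagrange_poly[OF ij(2)] by linarith
    then show ?thesis by (rule legendre_poly_on_orthogonal[OF h])
  qed simp
  then show ?thesis by (simp add: pq[symmetric] poly_lagrange_poly)
qed

text \<open>Orthogonality removes the mixed terms; the integrals that remain are the Gauss-Legendre
  quadrature weights.\<close>

lemma Pplus_L2norm_sq:
  "(L2norm {0..h} (Pplus h N W))\<^sup>2 =
    (\<Sum>i=1..N. (\<integral>t. (lagrange_basis h N i t)\<^sup>2 \<partial>(lebesgue_on {0..h})) * (norm (W i))\<^sup>2)"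
proof -
  let ?l = "lagrange_basis h N" and ?M = "lebesgue_on {0..h}"
  have i: "integrable ?M (\<lambda>t. ?l i t * ?l j t)" for i j
    using poly_integrable[of 0 h "lagrange_poly i * lagrange_poly j"] by (simp add: poly_lagrange_poly)
  have o: "(\<integral>t. ?l i t * ?l j t \<partial>?M) = (if j = i then \<integral>t. (?l i t)\<^sup>2 \<partial>?M else 0)"
    if "i \<in> {1..N}" "j \<in> {1..N}" for i j
    using lagrange_basis_orthogonal[OF that] by (auto simp: power2_eq_square)
  have "(L2norm {0..h} (Pplus h N W))\<^sup>2 = (\<integral>t. (\<Sum>i=1..N. \<Sum>j=1..N. (?l i t * ?l j t) * (W i \<bullet> W j)) \<partial>?M)"
    by (simp add: L2norm_sq_inner Pplus_def inner_sum_left inner_sum_right sum_distrib_left mult.assoc mult.left_commute inner_commute)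
  also have "\<dots> = (\<Sum>i=1..N. \<Sum>j=1..N. (\<integral>t. ?l i t * ?l j t \<partial>?M) * (W i \<bullet> W j))"
    using i by (simp add: Bochner_Integration.integral_sum)
  also have "\<dots> = (\<Sum>i=1..N. \<Sum>j=1..N. if j = i then (\<integral>t. (?l i t)\<^sup>2 \<partial>?M) * (W i \<bullet> W i) else 0)"
    by (intro sum.cong refl) (simp add: o)
  finally show ?thesis by (simp add: power2_norm_eq_inner)
qed

text \<open>Interpolating a constant shows that the weights in the previous identity add up to \<open>h\<close>.\<close>

lemma Pplus_L2norm_le:
  fixes W :: "nat \<Rightarrow> real^'d"
  assumes B: "0 \<le> B" and W: "\<And>i. i \<in> {1..N} \<Longrightarrow> norm (W i) \<le> B"
  shows "L2norm {0..h} (Pplus h N W) \<le> sqrt h * B"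
proof (rule power2_le_imp_le)
  define w where "w i = (\<integral>t. (lagrange_basis h N i t)\<^sup>2 \<partial>(lebesgue_on {0..h}))" for i
  \<comment> \<open>Any unit vector would do; \<open>undefined\<close> names some
    coordinate.\<close>
  define e :: "real^'d" where "e = axis undefined 1"
  have e: "norm e = 1" by (simp add: e_def)
  have "vec_poly (N - 1) (\<lambda>_. e)" using vec_poly_poly_scaleR[of 1 "N - 1" e] by simp
  then have "Pplus h N (\<lambda>_. e) = (\<lambda>_. e)" by (rule Pplus_interpolates_poly)
  then have "(L2norm {0..h} (\<lambda>_. e))\<^sup>2 = (\<Sum>i=1..N. w i)"
    using Pplus_L2norm_sq[of "\<lambda>_. e"] by (simp add: w_def e)
  moreover have "(L2norm {0..h} (\<lambda>_. e))\<^sup>2 = h"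
    using integral_const_lebesgue_on_interval[of 0 h 1] h by (simp add: L2norm_sq e)
  ultimately have sw: "(\<Sum>i=1..N. w i) = h" by simp
  have "(L2norm {0..h} (Pplus h N W))\<^sup>2 = (\<Sum>i=1..N. w i * (norm (W i))\<^sup>2)"
    by (simp add: Pplus_L2norm_sq w_def)
  also have "\<dots> \<le> (\<Sum>i=1..N. w i * B\<^sup>2)"
    using W by (intro sum_mono mult_left_mono power_mono) (auto simp: w_def)
  also have "\<dots> = (sqrt h * B)\<^sup>2" using h by (simp only: sum_distrib_right[symmetric] sw power_mult_distrib real_sqrt_pow2 less_imp_le)
  finally show "(L2norm {0..h} (Pplus h N W))\<^sup>2 \<le> (sqrt h * B)\<^sup>2" .
qed (use B h in auto)

lemma Pplus_add: "Pplus h N (\<lambda>i. W i + W' i) t = Pplus h N W t + Pplus h N W' t"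
  and Pplus_diff: "Pplus h N (\<lambda>i. W i - W' i) t = Pplus h N W t - Pplus h N W' t"
  and Pplus_scaleR: "Pplus h N (\<lambda>i. c *\<^sub>R W i) t = c *\<^sub>R Pplus h N W t"
  by (simp_all add: Pplus_def scaleR_add_right scaleR_diff_right sum.distrib sum_subtractf
      scaleR_sum_right mult.commute)

lemma Pplus_cong: "(\<And>i. i \<in> {1..N} \<Longrightarrow> W i = W' i) \<Longrightarrow> Pplus h N W = Pplus h N W'"
  unfolding Pplus_def by (intro ext sum.cong) auto

text \<open>Interpolation reproduces \<open>p\<close>, so the error is that of \<open>u - p\<close>:
  this function and its interpolant both have norm at most \<open>sqrt h * E\<close>, whatever the
  number of nodes.\<close>

lemma interpolation_error:
  assumes u: "continuous_on {0..h} u" and p: "vec_poly (N - 1) p" and E: "0 \<le> E"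
    and up: "\<And>t. t \<in> {0..h} \<Longrightarrow> norm (u t - p t) \<le> E"
  shows "L2norm {0..h} (\<lambda>t. u t - Pplus h N (\<lambda>i. u (node h N i)) t) \<le> 2 * sqrt h * E"
proof -
  let ?W = "\<lambda>i. u (node h N i) - p (node h N i)"
  have c: "continuous_on {0..h} (\<lambda>t. u t - p t)" using u vec_poly_continuous[OF p] by (intro continuous_intros)
  have eq: "u t - Pplus h N (\<lambda>i. u (node h N i)) t = (u t - p t) - Pplus h N ?W t" for t
    by (simp add: Pplus_diff Pplus_interpolates_poly[OF p])
  have "L2norm {0..h} (\<lambda>t. u t - p t) \<le> sqrt h * E"
    using L2norm_sup_bound[OF c _ E up] h by simp
  moreover have "L2norm {0..h} (Pplus h N ?W) \<le> sqrt h * E"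
    using node_inside by (intro Pplus_L2norm_le E up) force
  ultimately show ?thesis
    using L2norm_triangle_diff[OF L2_continuous[OF c] vec_poly_L2[OF Pplus_vec_poly], of ?W]
    unfolding eq by linarith
qed

end

subsection \<open>Continuous representatives of weakly differentiable functions\<close>

lemma L2_subinterval:
  assumes "f \<in> L2 {a..b}" "{c..d} \<subseteq> {a..b}"
  shows "f \<in> L2 {c..d}"
proof -
  have "f \<in> borel_measurable (lebesgue_on {c..d})"
    using L2_measurable[OF assms(1)] assms(2) by (rule measurable_restrict_mono)
  then show ?thesis
    using integrable_subinterval[OF L2_sq_integrable[OF assms(1)] assms(2)] by (simp add: L2_def)
qed

lemma L2norm_subinterval_le:
  assumes "f \<in> L2 {a..b}" "{c..d} \<subseteq> {a..b}"
  shows "L2norm {c..d} f \<le> L2norm {a..b} f"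
  unfolding L2norm_def
  by (intro real_sqrt_le_mono integral_mono_lebesgue_on_AE L2_sq_integrable assms) auto

lemma norm_integral_le_L2norm:
  fixes f :: "real \<Rightarrow> real^'d"
  assumes f: "f \<in> L2 {c..d}" and "c \<le> d"
  shows "(\<integral>t. norm (f t) \<partial>(lebesgue_on {c..d})) \<le> sqrt (d - c) * L2norm {c..d} f"
proof -
  have "\<bar>\<integral>t. 1 * norm (f t) \<partial>(lebesgue_on {c..d})\<bar> \<le>
      sqrt (\<integral>t. 1\<^sup>2 \<partial>(lebesgue_on {c..d})) * sqrt (\<integral>t. (norm (f t))\<^sup>2 \<partial>(lebesgue_on {c..d}))"
    using f by (intro Cauchy_Schwarz_integral) (auto simp: L2_def)
  then show ?thesis
    using integral_const_lebesgue_on_interval[OF assms(2), of 1] by (simp add: L2norm_def)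
qed

text \<open>Cauchy-Schwarz against the constant 1 between \<open>s\<close> and \<open>t\<close>
  produces the square root.\<close>

lemma indefinite_integral_Holder:
  fixes g :: "real \<Rightarrow> real^'d"
  assumes g: "g \<in> L2 {a..b}" and st: "s \<in> {a..b}" "t \<in> {a..b}"
  shows "norm ((\<integral>x. g x \<partial>(lebesgue_on {a..t})) - (\<integral>x. g x \<partial>(lebesgue_on {a..s}))) \<le>
    L2norm {a..b} g * sqrt \<bar>t - s\<bar>"
proof -
  have main: "norm ((\<integral>x. g x \<partial>(lebesgue_on {a..t})) - (\<integral>x. g x \<partial>(lebesgue_on {a..s}))) \<le>
      L2norm {a..b} g * sqrt (t - s)" if "a \<le> s" "s \<le> t" "t \<le> b" for s t
  proof -
    have gt: "g \<in> L2 {a..t}" "g \<in> L2 {s..t}" using that by (auto intro: L2_subinterval[OF g])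
    have "(\<integral>x. g x \<partial>(lebesgue_on {a..t})) - (\<integral>x. g x \<partial>(lebesgue_on {a..s})) =
        (\<integral>x. g x \<partial>(lebesgue_on {s..t}))"
      using integral_combine[OF L2_integrable[OF gt(1)] that(1,2)] by simp
    also have "norm \<dots> \<le> (\<integral>x. norm (g x) \<partial>(lebesgue_on {s..t}))" by (rule integral_norm_bound)
    also have "\<dots> \<le> sqrt (t - s) * L2norm {s..t} g"
      by (rule norm_integral_le_L2norm[OF gt(2) that(2)])
    also have "\<dots> \<le> sqrt (t - s) * L2norm {a..b} g"
      using that by (intro mult_left_mono L2norm_subinterval_le g) auto
    finally show ?thesis by (simp add: mult.commute)
  qed
  show ?thesis
  proof (cases "s \<le> t")
    case True
    then show ?thesis using main[of s t] st by simp
  next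
    case False
    then show ?thesis using main[of t s] st by (simp add: norm_minus_commute)
  qed
qed

lemma Holder_imp_continuous_on:
  fixes u :: "real \<Rightarrow> 'b::real_normed_vector"
  assumes K: "0 \<le> K"
    and H: "\<And>s t. s \<in> S \<Longrightarrow> t \<in> S \<Longrightarrow> norm (u t - u s) \<le> K * sqrt \<bar>t - s\<bar>"
  shows "continuous_on S u"
  unfolding continuous_on_def
proof
  fix s assume s: "s \<in> S"
  have "((\<lambda>t. K * sqrt \<bar>t - s\<bar>) \<longlongrightarrow> K * sqrt \<bar>s - s\<bar>) (at s within S)"
    by (intro tendsto_intros)
  then have lim: "((\<lambda>t. K * sqrt \<bar>t - s\<bar>) \<longlongrightarrow> 0) (at s within S)" by simp
  have "\<forall>\<^sub>F t in at s within S. norm (u t - u s) \<le> K * sqrt \<bar>t - s\<bar>"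
    unfolding eventually_at_filter using H[OF s] by (intro always_eventually) simp
  then have "((\<lambda>t. u t - u s) \<longlongrightarrow> 0) (at s within S)" using lim by (rule Lim_null_comparison)
  then show "(u \<longlongrightarrow> u s) (at s within S)" by (rule LIM_zero_cancel)
qed

text \<open>The support condition is that of \<open>test_function\<close>; for \<open>a < b\<close>
  the members with integral zero are the derivatives of test functions.\<close>

definition compactly_supported :: "real \<Rightarrow> real \<Rightarrow> (real \<Rightarrow> real) \<Rightarrow> bool" where
  "compactly_supported a b f \<longleftrightarrow> continuous_on UNIV f \<and> (\<exists>c d. a < c \<and> d < b \<and> (\<forall>t. t \<notin> {c..d} \<longrightarrow> f t = 0))"

lemma compactly_supported_continuous: "compactly_supported a b f \<Longrightarrow> continuous_on S f"
  by (auto simp: compactly_supported_def intro: continuous_on_subset)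

lemma compactly_supported_lincomb:
  assumes "compactly_supported a b f" "compactly_supported a b g"
  shows "compactly_supported a b (\<lambda>t. f t - k * g t)"
proof -
  obtain c d where 1: "a < c" "d < b" "\<forall>t. t \<notin> {c..d} \<longrightarrow> f t = 0"
    using assms(1) by (auto simp: compactly_supported_def)
  obtain c' d' where 2: "a < c'" "d' < b" "\<forall>t. t \<notin> {c'..d'} \<longrightarrow> g t = 0"
    using assms(2) by (auto simp: compactly_supported_def)
  have "continuous_on UNIV (\<lambda>t. f t - k * g t)"
    using assms by (intro continuous_intros compactly_supported_continuous)
  moreover have "\<forall>t. t \<notin> {min c c'..max d d'} \<longrightarrow> f t - k * g t = 0"
  proof (intro allI impI)
    fix t assume "t \<notin> {min c c'..max d d'}"
    then have "t \<notin> {c..d}" "t \<notin> {c'..d'}" by auto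
    then show "f t - k * g t = 0" using 1(3) 2(3) by simp
  qed
  moreover have "a < min c c'" "max d d' < b" using 1 2 by auto
  ultimately show ?thesis unfolding compactly_supported_def by blast
qed

text \<open>Piecewise linear: for \<open>0 < k\<close> it is zero within distance
  \<open>1 / k\<close> of the endpoints and one at distance at least \<open>2 / k\<close> inside the
  interval.\<close>

definition cutoff :: "real \<Rightarrow> real \<Rightarrow> nat \<Rightarrow> real \<Rightarrow> real" where
  "cutoff a b k t = max 0 (min 1 (real k * min (t - a) (b - t) - 1))"

lemma cutoff_bounds: "0 \<le> cutoff a b k t" "cutoff a b k t \<le> 1"
  by (auto simp: cutoff_def)

lemma cutoff_continuous: "continuous_on S (cutoff a b k)"
  unfolding cutoff_def by (intro continuous_intros)

lemma cutoff_support: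
  assumes "0 < k" "t \<notin> {a + 1 / real k..b - 1 / real k}"
  shows "cutoff a b k t = 0"
proof -
  have "min (t - a) (b - t) \<le> 1 / real k" using assms by auto
  then have "real k * min (t - a) (b - t) \<le> real k * (1 / real k)" by (intro mult_left_mono) auto
  then show ?thesis using assms by (simp add: cutoff_def)
qed

lemma compactly_supported_cutoff_mult:
  assumes "continuous_on UNIV f" "0 < k"
  shows "compactly_supported a b (\<lambda>t. cutoff a b k t * f t)"
  unfolding compactly_supported_def
proof (intro conjI exI allI impI)
  show "a < a + 1 / real k" "b - 1 / real k < b" using assms(2) by simp_all
  show "cutoff a b k t * f t = 0" if "t \<notin> {a + 1 / real k..b - 1 / real k}" for t
    using cutoff_support[OF assms(2) that] by simp
qed (intro continuous_intros cutoff_continuous assms)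

lemma cutoff_tendsto:
  assumes "t \<in> {a<..<b}" shows "(\<lambda>k. cutoff a b k t) \<longlonglongrightarrow> 1"
proof -
  have pos: "0 < min (t - a) (b - t)" using assms by auto
  then obtain k0 where k0: "2 / min (t - a) (b - t) \<le> real k0" using real_arch_simple by blast
  have "cutoff a b k t = 1" if "k0 \<le> k" for k
  proof -
    have "2 / min (t - a) (b - t) \<le> real k" using k0 that by linarith
    then have "2 \<le> real k * min (t - a) (b - t)" using pos by (simp add: pos_divide_le_eq)
    then show ?thesis by (simp add: cutoff_def)
  qed
  then show ?thesis by (intro tendsto_eventually) (auto simp: eventually_sequentially)
qed

lemma AE_lebesgue_on_interior:
  "AE t in lebesgue_on {a..b::real}. t \<in> {a<..<b}"
proof -
  have "{a, b} \<in> null_sets lebesgue" by (simp add: finite_imp_null_set_lborel null_sets_completionI)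
  then have "AE t in lebesgue. t \<notin> {a, b}" by (rule AE_not_in)
  then have "AE t in lebesgue. t \<in> {a..b} \<longrightarrow> t \<in> {a<..<b}"
    by eventually_elim auto
  then show ?thesis by (rule iffD2[OF AE_restrict_space_iff, rotated]) simp
qed

text \<open>If the norm of \<open>z\<close> were positive, a polynomial close to \<open>z\<close>,
  multiplied by a cutoff, would be nearer to \<open>z\<close> than zero is. As \<open>z\<close> is
  orthogonal to it, Cauchy-Schwarz would make the squared norm of \<open>z\<close> less than
  itself.\<close>

lemma L2_zero_if_orthogonal_to_compactly_supported:
  fixes z :: "real \<Rightarrow> real^'d"
  assumes ab: "a < b" and z: "z \<in> L2 {a..b}"
    and orth: "\<And>f. compactly_supported a b f \<Longrightarrow> (\<integral>t. f t *\<^sub>R z t \<partial>(lebesgue_on {a..b})) = 0"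
  shows "L2norm {a..b} z = 0"
proof (rule ccontr)
  let ?M = "lebesgue_on {a..b}"
  assume "L2norm {a..b} z \<noteq> 0"
  then have pos: "0 < L2norm {a..b} z" using L2norm_nonneg[of "{a..b}" z] by linarith
  then obtain n q where q: "vec_poly n q" "L2norm {a..b} (\<lambda>t. z t - q t) < L2norm {a..b} z / 2"
    using L2_poly_dense[OF z ab, of "L2norm {a..b} z / 2"] by auto
  have qc: "continuous_on S q" for S by (rule vec_poly_continuous[OF q(1)])
  let ?\<psi> = "\<lambda>k t. cutoff a b k t *\<^sub>R q t"
  have \<psi>c: "continuous_on S (?\<psi> k)" for k S by (intro continuous_intros cutoff_continuous qc)
  have "(\<lambda>k. L2norm {a..b} (\<lambda>t. q t - ?\<psi> k t)) \<longlonglongrightarrow> 0"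
  proof (rule L2norm_dominated_convergence[where g = "\<lambda>t. norm (q t)"])
    show "AE t in ?M. (\<lambda>k. ?\<psi> k t) \<longlonglongrightarrow> q t"
      using AE_lebesgue_on_interior
    proof eventually_elim
      case (elim t)
      have "(\<lambda>k. ?\<psi> k t) \<longlonglongrightarrow> 1 *\<^sub>R q t" by (intro tendsto_intros cutoff_tendsto elim)
      then show ?case by simp
    qed
    show "AE t in ?M. norm (?\<psi> k t) \<le> norm (q t)" for k
      using cutoff_bounds[of a b k] by (intro AE_I2) (simp add: mult_left_le_one_le)
  qed (intro continuous_lebesgue_on_measurable qc \<psi>c L2_sq_integrable vec_poly_L2[OF q(1)])+
  then have "\<forall>\<^sub>F k in sequentially. L2norm {a..b} (\<lambda>t. q t - ?\<psi> k t) < L2norm {a..b} z / 2"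
    using pos by (intro order_tendstoD) auto
  then obtain k0 where k0: "\<forall>k\<ge>k0. L2norm {a..b} (\<lambda>t. q t - ?\<psi> k t) < L2norm {a..b} z / 2"
    by (auto simp: eventually_sequentially)
  \<comment> \<open>\<open>Suc\<close> makes the index positive, as the support of the cutoff
    requires.\<close>
  define k where "k = Suc k0"
  have \<psi>: "?\<psi> k \<in> L2 {a..b}" by (intro L2_continuous \<psi>c)
  have close: "L2norm {a..b} (\<lambda>t. z t - ?\<psi> k t) < L2norm {a..b} z"
    using L2norm_triangle_mid[OF z vec_poly_L2[OF q(1)] \<psi>] q(2) k0[rule_format, of k]
    by (simp add: k_def)
  \<comment> \<open>The hypothesis tests \<open>z\<close> with scalar functions only, so the inner
    product is treated coordinate by coordinate.\<close>
  have comp: "(\<integral>t. (?\<psi> k t $ j) * (z t $ j) \<partial>?M) = 0" for j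
  proof -
    have cc: "compactly_supported a b (\<lambda>t. cutoff a b k t * (q t $ j))"
      by (intro compactly_supported_cutoff_mult continuous_intros qc) (simp add: k_def)
    have "(\<integral>t. (cutoff a b k t * (q t $ j)) *\<^sub>R z t \<partial>?M) \<bullet> axis j 1 =
        (\<integral>t. ((cutoff a b k t * (q t $ j)) *\<^sub>R z t) \<bullet> axis j 1 \<partial>?M)"
      by (rule integral_inner_left[symmetric])
        (rule scaleR_continuous_integrable[OF z compactly_supported_continuous[OF cc]])
    then show ?thesis using orth[OF cc] by (simp add: inner_axis)
  qed
  have "(\<integral>t. ?\<psi> k t \<bullet> z t \<partial>?M) = (\<Sum>j\<in>UNIV. \<integral>t. (?\<psi> k t $ j) * (z t $ j) \<partial>?M)"
    unfolding inner_vec_def inner_real_def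
  proof (rule Bochner_Integration.integral_sum)
    fix j
    have "integrable ?M (\<lambda>t. ((cutoff a b k t * (q t $ j)) *\<^sub>R z t) \<bullet> axis j 1)"
      by (intro integrable_inner_left scaleR_continuous_integrable[OF z] continuous_intros cutoff_continuous qc)
    then show "integrable ?M (\<lambda>t. (?\<psi> k t $ j) * (z t $ j))" by (simp add: inner_axis)
  qed
  also have "\<dots> = 0" by (simp only: comp sum.neutral_const)
  finally have "(\<integral>t. ?\<psi> k t \<bullet> z t \<partial>?M) = 0" .
  then have "(L2norm {a..b} z)\<^sup>2 = (\<integral>t. (z t - ?\<psi> k t) \<bullet> z t \<partial>?M)"
    using L2_inner_integrable[OF z z] L2_inner_integrable[OF \<psi> z]
    by (simp add: L2norm_sq_inner inner_diff_left)
  also have "\<dots> \<le> L2norm {a..b} (\<lambda>t. z t - ?\<psi> k t) * L2norm {a..b} z"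
    using L2_Cauchy_Schwarz[OF L2_diff[OF z \<psi>] z] by (rule abs_le_D1)
  also have "\<dots> < L2norm {a..b} z * L2norm {a..b} z"
    using close pos by (rule mult_strict_right_mono)
  finally show False by (simp add: power2_eq_square)
qed

lemma L2norm_zero_imp_AE:
  assumes "z \<in> L2 A" "L2norm A z = 0" shows "AE t in lebesgue_on A. z t = 0"
proof -
  have "AE t in lebesgue_on A. (norm (z t))\<^sup>2 = 0"
    using assms L2_sq_integrable[OF assms(1)]
    by (subst integral_nonneg_eq_0_iff_AE[symmetric]) (auto simp: L2norm_def)
  then show ?thesis by simp
qed

text \<open>The lemma of du Bois-Reymond. If every test function had integral zero, the hypothesis would
  already force \<open>v = 0\<close>; otherwise one test function of integral one is used to normalise the others.\<close>

lemma du_Bois_Reymond: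
  fixes v :: "real \<Rightarrow> real^'d"
  assumes ab: "a < b" and v: "v \<in> L2 {a..b}"
    and orth: "\<And>f. compactly_supported a b f \<Longrightarrow> (\<integral>t. f t \<partial>(lebesgue_on {a..b})) = 0 \<Longrightarrow>
      (\<integral>t. f t *\<^sub>R v t \<partial>(lebesgue_on {a..b})) = 0"
  shows "\<exists>m. AE t in lebesgue_on {a..b}. v t = m"
proof (cases "\<exists>f. compactly_supported a b f \<and> (\<integral>t. f t \<partial>(lebesgue_on {a..b})) \<noteq> 0")
  case False
  then have "L2norm {a..b} v = 0" using orth by (intro L2_zero_if_orthogonal_to_compactly_supported[OF ab v]) blast
  then show ?thesis using L2norm_zero_imp_AE[OF v] by blast
next
  case True
  let ?M = "lebesgue_on {a..b}"
  obtain f0 where f0: "compactly_supported a b f0" "(\<integral>t. f0 t \<partial>?M) \<noteq> 0" using True by blast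
  define I where "I = (\<integral>t. f0 t \<partial>?M)"
  have I: "I \<noteq> 0" using f0 by (simp add: I_def)
  define m where "m = (1 / I) *\<^sub>R (\<integral>t. f0 t *\<^sub>R v t \<partial>?M)"
  have z: "(\<lambda>t. v t - m) \<in> L2 {a..b}" by (intro L2_diff v L2_continuous continuous_intros)
  have int: "integrable ?M f" if "compactly_supported a b f" for f
    by (intro continuous_imp_integrable_real compactly_supported_continuous[OF that])
  have intv: "integrable ?M (\<lambda>t. f t *\<^sub>R v t)" if "compactly_supported a b f" for f
    by (intro scaleR_continuous_integrable v compactly_supported_continuous[OF that])
  have "L2norm {a..b} (\<lambda>t. v t - m) = 0"
  proof (rule L2_zero_if_orthogonal_to_compactly_supported[OF ab z])
    fix f assume f: "compactly_supported a b f"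
    define k where "k = (\<integral>t. f t \<partial>?M) / I"
    have "(\<integral>t. f t - k * f0 t \<partial>?M) = 0"
      using int[OF f] int[OF f0(1)] I by (simp add: k_def I_def)
    then have "(\<integral>t. (f t - k * f0 t) *\<^sub>R v t \<partial>?M) = 0"
      by (intro orth compactly_supported_lincomb f f0)
    moreover have "(\<integral>t. (f t - k * f0 t) *\<^sub>R v t \<partial>?M) = (\<integral>t. f t *\<^sub>R v t \<partial>?M) - k *\<^sub>R (\<integral>t. f0 t *\<^sub>R v t \<partial>?M)"
      using intv[OF f] intv[OF f0(1)] by (simp add: scaleR_diff_left scaleR_scaleR[symmetric] del: scaleR_scaleR)
    moreover have "k *\<^sub>R (\<integral>t. f0 t *\<^sub>R v t \<partial>?M) = (\<integral>t. f t \<partial>?M) *\<^sub>R m"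
      by (simp add: k_def m_def)
    ultimately show "(\<integral>t. f t *\<^sub>R (v t - m) \<partial>?M) = 0"
      using intv[OF f] int[OF f] by (simp add: scaleR_diff_right)
  qed
  then have "AE t in ?M. v t - m = 0" by (rule L2norm_zero_imp_AE[OF z])
  then show ?thesis by (auto elim!: eventually_mono)
qed

text \<open>An antiderivative is constant on either side of the support; since the integral is zero,
  the two constants agree and can be subtracted.\<close>

lemma compactly_supported_antiderivative:
  assumes ab: "a < b" and f: "compactly_supported a b f" and I: "(\<integral>t. f t \<partial>(lebesgue_on {a..b})) = 0"
  shows "\<exists>p. test_function a b p f"
proof -
  obtain c d where cd: "a < c" "d < b" "\<forall>t. t \<notin> {c..d} \<longrightarrow> f t = 0" and fc: "continuous_on UNIV f"
    using f by (auto simp: compactly_supported_def)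
  \<comment> \<open>Infinite endpoints give one antiderivative on the whole line;
    \<open>test_function\<close> demands a derivative at every real point.\<close>
  have "\<exists>F. \<forall>x. -\<infinity> < ereal x \<longrightarrow> ereal x < \<infinity> \<longrightarrow> (F has_vector_derivative f x) (at x)"
    using fc by (intro einterval_antiderivative) (auto simp: continuous_on_eq_continuous_at)
  then obtain F where F: "\<And>x. (F has_real_derivative f x) (at x)"
    by (auto simp: has_real_derivative_iff_has_vector_derivative)
  have "(f has_integral F b - F a) {a..b}"
    using ab F by (intro fundamental_theorem_of_calculus)
      (auto simp: has_real_derivative_iff_has_vector_derivative intro: has_vector_derivative_at_within)
  moreover have "integral {a..b} f = 0"
    using I lebesgue_integral_eq_integral[OF continuous_imp_integrable_real[OF compactly_supported_continuous[OF f]], of a b]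
    by simp
  ultimately have Fab: "F b = F a" by (simp add: integral_unique)
  have "\<exists>k. \<forall>t\<in>{..<c}. F t = k"
  proof (rule has_field_derivative_zero_constant)
    fix t assume "t \<in> {..<c}"
    then have "f t = 0" using cd(3) by auto
    then show "(F has_field_derivative 0) (at t within {..<c})"
      using F[of t] by (simp add: has_field_derivative_at_within)
  qed (simp add: convex_real_interval)
  then have l: "\<And>t. t < c \<Longrightarrow> F t = F a" using cd by (metis lessThan_iff)
  have "\<exists>k. \<forall>t\<in>{d<..}. F t = k"
  proof (rule has_field_derivative_zero_constant)
    fix t assume "t \<in> {d<..}"
    then have "f t = 0" using cd(3) by auto
    then show "(F has_field_derivative 0) (at t within {d<..})"
      using F[of t] by (simp add: has_field_derivative_at_within)
  qed (simp add: convex_real_interval)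
  then have r: "\<And>t. d < t \<Longrightarrow> F t = F a" using cd Fab by (metis greaterThan_iff)
  have "test_function a b (\<lambda>t. F t - F a) f"
    unfolding test_function_def
  proof (intro conjI exI allI impI)
    show "((\<lambda>t. F t - F a) has_real_derivative f t) (at t)" for t
      using DERIV_diff[OF F[of t] DERIV_const[of "F a"]] by simp
    show "F t - F a = 0" if "t \<notin> {c..d}" for t
      using that l[of t] r[of t] by auto
  qed (use fc cd in auto)
  then show ?thesis by blast
qed

lemma norm_integral_scaleR_le:
  fixes u :: "real \<Rightarrow> real^'d"
  assumes ab: "a \<le> b" and u: "u \<in> L2 {a..b}" and k: "continuous_on {a..b} k"
    and M: "\<And>t. t \<in> {a..b} \<Longrightarrow> \<bar>k t\<bar> \<le> M"
  shows "norm (\<integral>t. k t *\<^sub>R u t \<partial>(lebesgue_on {a..b})) \<le> M * (sqrt (b - a) * L2norm {a..b} u)"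
proof -
  have M0: "0 \<le> M" using M[of a] ab by auto
  have "norm (\<integral>t. k t *\<^sub>R u t \<partial>(lebesgue_on {a..b})) \<le> (\<integral>t. norm (k t *\<^sub>R u t) \<partial>(lebesgue_on {a..b}))"
    by (rule integral_norm_bound)
  also have "\<dots> \<le> (\<integral>t. M * norm (u t) \<partial>(lebesgue_on {a..b}))"
    using M by (intro integral_mono integrable_norm integrable_mult_right scaleR_continuous_integrable[OF u k]
        L2_integrable[OF u]) (auto intro: mult_right_mono)
  also have "\<dots> \<le> M * (sqrt (b - a) * L2norm {a..b} u)"
    using norm_integral_le_L2norm[OF u ab] M0 by (simp add: mult_left_mono)
  finally show ?thesis .
qed

lemma nonpos_if_le_all_multiples:
  fixes x c :: real
  assumes "0 \<le> c" "\<And>e. 0 < e \<Longrightarrow> x \<le> c * e" shows "x \<le> 0"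
proof (rule ccontr)
  assume "\<not> x \<le> 0"
  then have x: "0 < x" by simp
  then have "x \<le> c * (x / (c + 1))" using assms(1) by (intro assms(2)) simp
  then have "x * (c + 1) \<le> c * x" using assms(1) by (simp add: pos_le_divide_eq)
  then show False using x by (simp add: algebra_simps)
qed

lemma norm_indefinite_integral_le:
  fixes g :: "real \<Rightarrow> real^'d"
  assumes g: "g \<in> L2 {a..b}" and t: "t \<in> {a..b}"
  shows "norm (\<integral>x. g x \<partial>(lebesgue_on {a..t})) \<le> sqrt (b - a) * L2norm {a..b} g"
proof -
  have gt: "g \<in> L2 {a..t}" using t by (intro L2_subinterval[OF g]) auto
  have "norm (\<integral>x. g x \<partial>(lebesgue_on {a..t})) \<le> (\<integral>x. norm (g x) \<partial>(lebesgue_on {a..t}))"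
    by (rule integral_norm_bound)
  also have "\<dots> \<le> sqrt (t - a) * L2norm {a..t} g" using t by (intro norm_integral_le_L2norm gt) auto
  also have "\<dots> \<le> sqrt (b - a) * L2norm {a..b} g"
    using t by (intro mult_mono L2norm_subinterval_le[OF g]) auto
  finally show ?thesis .
qed

text \<open>For a polynomial the indefinite integral is a classical antiderivative, so ordinary
  integration by parts applies, and \<open>p\<close> kills the boundary terms.\<close>

lemma integral_by_parts_indefinite_vec_poly:
  fixes q :: "real \<Rightarrow> real^'d"
  assumes ab: "a < b" and p: "\<And>t. (p has_real_derivative f t) (at t)" "p a = 0" "p b = 0"
    and f: "continuous_on UNIV f" and q: "vec_poly n q"
  shows "(\<integral>t. f t *\<^sub>R (\<integral>x. q x \<partial>(lebesgue_on {a..t})) \<partial>(lebesgue_on {a..b})) =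
    - (\<integral>t. p t *\<^sub>R q t \<partial>(lebesgue_on {a..b}))"
proof -
  let ?Q = "\<lambda>t. \<integral>x. q x \<partial>(lebesgue_on {a..t})"
  have qc: "continuous_on S q" for S by (rule vec_poly_continuous[OF q])
  have pc: "continuous_on S p" for S by (intro continuous_at_imp_continuous_on ballI DERIV_isCont[OF p(1)])
  have fc: "continuous_on S f" for S using f by (rule continuous_on_subset) simp
  have Q: "?Q t = integral {a..t} q" for t
    by (intro lebesgue_integral_eq_integral L2_integrable L2_continuous qc) simp
  have Qd: "(?Q has_vector_derivative q t) (at t)" if "t \<in> {a<..<b}" for t
  proof -
    have "((\<lambda>u. integral {a..u} q) has_vector_derivative q t) (at t within {a..b})"
      using that by (intro integral_has_vector_derivative qc) auto
    then show ?thesis using that by (simp add: Q at_within_Icc_at)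
  qed
  have Qc: "continuous_on {a..b} ?Q"
    using indefinite_integral_Holder[OF vec_poly_L2[OF q]] by (intro Holder_imp_continuous_on[where K = "L2norm {a..b} q"]) auto
  have "continuous_on {a..b} (\<lambda>t. p t *\<^sub>R q t)" by (intro continuous_intros pc qc)
  then have "((\<lambda>t. p t *\<^sub>R q t) has_integral integral {a..b} (\<lambda>t. p t *\<^sub>R q t)) {a..b}"
    by (intro integrable_integral integrable_continuous_real)
  then have "((\<lambda>t. f t *\<^sub>R ?Q t) has_integral - integral {a..b} (\<lambda>t. p t *\<^sub>R q t)) {a..b}"
    using ab by (intro integration_by_parts_interior[OF bounded_bilinear_scaleR _ pc Qc _ Qd])
      (auto simp: p has_real_derivative_iff_has_vector_derivative[symmetric])
  then have "integral {a..b} (\<lambda>t. f t *\<^sub>R ?Q t) = - integral {a..b} (\<lambda>t. p t *\<^sub>R q t)"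
    by (rule integral_unique)
  moreover have "(\<integral>t. f t *\<^sub>R ?Q t \<partial>(lebesgue_on {a..b})) = integral {a..b} (\<lambda>t. f t *\<^sub>R ?Q t)"
    by (intro lebesgue_integral_eq_integral L2_integrable L2_continuous continuous_intros fc Qc) simp
  moreover have "(\<integral>t. p t *\<^sub>R q t \<partial>(lebesgue_on {a..b})) = integral {a..b} (\<lambda>t. p t *\<^sub>R q t)"
    by (intro lebesgue_integral_eq_integral L2_integrable L2_continuous continuous_intros pc qc) simp
  ultimately show ?thesis by simp
qed

text \<open>For square-integrable \<open>g\<close> the indefinite integral need not be
  differentiable everywhere. Both sides depend continuously on \<open>g\<close> in the norm, so the
  polynomial case extends by density.\<close>

lemma integral_by_parts_indefinite:
  fixes g :: "real \<Rightarrow> real^'d"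
  assumes ab: "a < b" and p: "\<And>t. (p has_real_derivative f t) (at t)" "p a = 0" "p b = 0"
    and f: "continuous_on UNIV f" and g: "g \<in> L2 {a..b}"
  shows "(\<integral>t. f t *\<^sub>R (\<integral>x. g x \<partial>(lebesgue_on {a..t})) \<partial>(lebesgue_on {a..b})) =
    - (\<integral>t. p t *\<^sub>R g t \<partial>(lebesgue_on {a..b}))" (is "?I = - ?J")
proof -
  let ?M = "lebesgue_on {a..b}"
  let ?G = "\<lambda>g t. \<integral>x. g x \<partial>(lebesgue_on {a..t}) :: real^'d"
  have pc: "continuous_on S p" for S by (intro continuous_at_imp_continuous_on ballI DERIV_isCont[OF p(1)])
  have fc: "continuous_on S f" for S using f by (rule continuous_on_subset) simp
  have bdd: "\<exists>B\<ge>0. \<forall>t\<in>{a..b}. \<bar>k t\<bar> \<le> B" if "continuous_on {a..b} k" for k :: "real \<Rightarrow> real"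
  proof -
    have "bounded (k ` {a..b})" using that by (intro compact_imp_bounded compact_continuous_image) auto
    then obtain B where "\<forall>t\<in>{a..b}. \<bar>k t\<bar> \<le> B" by (auto simp: bounded_iff)
    then show ?thesis by (intro exI[of _ "max B 0"]) (auto simp: le_max_iff_disj)
  qed
  obtain Mf where Mf: "0 \<le> Mf" "\<And>t. t \<in> {a..b} \<Longrightarrow> \<bar>f t\<bar> \<le> Mf" using bdd[OF fc] by blast
  obtain Mp where Mp: "0 \<le> Mp" "\<And>t. t \<in> {a..b} \<Longrightarrow> \<bar>p t\<bar> \<le> Mp" using bdd[OF pc] by blast
  have Gc: "continuous_on {a..b} (?G g)" if "g \<in> L2 {a..b}" for g
    using indefinite_integral_Holder[OF that] by (intro Holder_imp_continuous_on[where K = "L2norm {a..b} g"]) auto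
  define s where "s = sqrt (b - a)"
  have s: "0 \<le> s" using ab by (simp add: s_def)
  have "norm (?I + ?J) \<le> 0"
  proof (rule nonpos_if_le_all_multiples)
    \<comment> \<open>Three factors \<open>s\<close>: from the norm of \<open>g - q\<close> to the
      supremum of its indefinite integral, from there to an \<open>L2norm\<close>, and from that to
      an integral. Only the last passage occurs in the term with \<open>p\<close>.\<close>
    show "0 \<le> Mf * (s * (s * s)) + Mp * s" using Mf Mp s by simp
    fix e :: real assume "0 < e"
    then obtain n q where q: "vec_poly n q" "L2norm {a..b} (\<lambda>t. g t - q t) < e"
      using L2_poly_dense[OF g ab] by blast
    have qL: "q \<in> L2 {a..b}" by (rule vec_poly_L2[OF q(1)])
    have gq: "(\<lambda>t. g t - q t) \<in> L2 {a..b}" by (intro L2_diff g qL)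
    have GQ: "?G g t - ?G q t = ?G (\<lambda>t. g t - q t) t" if "t \<in> {a..b}" for t
    proof -
      have "{a..t} \<subseteq> {a..b}" using that by auto
      then show ?thesis using L2_integrable[OF L2_subinterval[OF g]] L2_integrable[OF L2_subinterval[OF qL]] by simp
    qed
    have "L2norm {a..b} (\<lambda>t. ?G g t - ?G q t) \<le> s * (s * e)"
    proof -
      have "norm (?G g t - ?G q t) \<le> s * e" if "t \<in> {a..b}" for t
        using norm_indefinite_integral_le[OF gq that] mult_left_mono[OF less_imp_le[OF q(2)] s]
        unfolding GQ[OF that] s_def by linarith
      then show ?thesis unfolding s_def
        using ab s \<open>0 < e\<close> by (intro L2norm_sup_bound continuous_intros Gc g qL) (auto simp: s_def)
    qed
    then have "Mf * (s * L2norm {a..b} (\<lambda>t. ?G g t - ?G q t)) \<le> Mf * (s * (s * (s * e)))"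
      using s Mf by (intro mult_left_mono)
    then have 1: "norm (\<integral>t. f t *\<^sub>R (?G g t - ?G q t) \<partial>?M) \<le> Mf * (s * (s * (s * e)))"
      using ab norm_integral_scaleR_le[OF less_imp_le[OF ab] L2_continuous[OF continuous_on_diff[OF Gc[OF g] Gc[OF qL]]] fc Mf(2)]
      unfolding s_def by linarith
    have "Mp * (s * L2norm {a..b} (\<lambda>t. g t - q t)) \<le> Mp * (s * e)"
      using s Mp q(2) by (intro mult_left_mono) auto
    then have 2: "norm (\<integral>t. p t *\<^sub>R (g t - q t) \<partial>?M) \<le> Mp * (s * e)"
      using norm_integral_scaleR_le[OF less_imp_le[OF ab] gq pc Mp(2)] unfolding s_def by linarith
    have "?I + ?J = (\<integral>t. f t *\<^sub>R (?G g t - ?G q t) \<partial>?M) + (\<integral>t. p t *\<^sub>R (g t - q t) \<partial>?M)"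
      using integral_by_parts_indefinite_vec_poly[OF ab p f q(1)]
        scaleR_continuous_integrable[OF L2_continuous[OF Gc[OF g]] fc]
        scaleR_continuous_integrable[OF L2_continuous[OF Gc[OF qL]] fc]
        scaleR_continuous_integrable[OF g pc] scaleR_continuous_integrable[OF qL pc]
      by (simp add: scaleR_diff_right)
    then have "norm (?I + ?J) \<le> Mf * (s * (s * (s * e))) + Mp * (s * e)"
      by (simp only:) (rule norm_triangle_mono[OF 1 2])
    then show "norm (?I + ?J) \<le> (Mf * (s * (s * s)) + Mp * s) * e" by (simp add: algebra_simps)
  qed
  then show ?thesis by (simp add: add_eq_0_iff2)
qed

text \<open>By du Bois-Reymond \<open>w\<close> differs from the indefinite integral of
  \<open>g\<close> by a constant: both give the same integral against every compactly supported
  \<open>f\<close> of integral zero, since such an \<open>f\<close> is the derivative of a test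
  function.\<close>

lemma weak_deriv_Holder_representative:
  fixes w g :: "real \<Rightarrow> real^'d"
  assumes ab: "a < b" and w: "w \<in> L2 {a..b}" and g: "g \<in> L2 {a..b}" and wd: "weak_deriv a b w g"
  shows "\<exists>u. (AE t in lebesgue_on {a..b}. u t = w t) \<and>
    (\<forall>s\<in>{a..b}. \<forall>t\<in>{a..b}. norm (u t - u s) \<le> L2norm {a..b} g * sqrt \<bar>t - s\<bar>)"
proof -
  let ?M = "lebesgue_on {a..b}" and ?G = "\<lambda>t. \<integral>x. g x \<partial>(lebesgue_on {a..t})"
  have Gc: "continuous_on {a..b} ?G"
    using indefinite_integral_Holder[OF g] by (intro Holder_imp_continuous_on[where K = "L2norm {a..b} g"]) auto
  have v: "(\<lambda>t. w t - ?G t) \<in> L2 {a..b}" by (intro L2_diff w L2_continuous Gc)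
  have "\<exists>m. AE t in ?M. w t - ?G t = m"
  proof (rule du_Bois_Reymond[OF ab v])
    fix f assume f: "compactly_supported a b f" "(\<integral>t. f t \<partial>?M) = 0"
    then obtain p where p: "test_function a b p f" using compactly_supported_antiderivative[OF ab] by blast
    then obtain c d where cd: "a < c" "d < b" "\<forall>t. t \<notin> {c..d} \<longrightarrow> p t = 0" by (auto simp: test_function_def)
    then have pab: "p a = 0" "p b = 0" by auto
    have pd: "\<And>t. (p has_real_derivative f t) (at t)" and fc: "continuous_on UNIV f"
      using p by (auto simp: test_function_def)
    have "(\<integral>t. f t *\<^sub>R w t \<partial>?M) = - (\<integral>t. p t *\<^sub>R g t \<partial>?M)"
      using wd p unfolding weak_deriv_def by blast
    also have "\<dots> = (\<integral>t. f t *\<^sub>R ?G t \<partial>?M)"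
      using integral_by_parts_indefinite[OF ab pd pab fc g] by simp
    finally show "(\<integral>t. f t *\<^sub>R (w t - ?G t) \<partial>?M) = 0"
      using scaleR_continuous_integrable[OF w compactly_supported_continuous[OF f(1)]]
        scaleR_continuous_integrable[OF L2_continuous[OF Gc] compactly_supported_continuous[OF f(1)]]
      by (simp add: scaleR_diff_right)
  qed
  then obtain m where m: "AE t in ?M. w t - ?G t = m" by blast
  have "AE t in ?M. ?G t + m = w t" using m by eventually_elim auto
  then show ?thesis using indefinite_integral_Holder[OF g] by (intro exI[of _ "\<lambda>t. ?G t + m"]) auto
qed

text \<open>The choice in \<open>cont_rep\<close> is harmless, because continuous functions that
  agree almost everywhere agree on the whole interval. Any convenient representative may be inserted
  for it.\<close>

lemma cont_rep_eq:
  assumes ab: "a < b" and u: "continuous_on {a..b} u" "AE t in lebesgue_on {a..b}. u t = w t"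
  shows "continuous_on {a..b} (cont_rep a b w)" "AE t in lebesgue_on {a..b}. cont_rep a b w t = w t"
    "t \<in> {a..b} \<Longrightarrow> cont_rep a b w t = u t"
proof -
  have "continuous_on {a..b} (cont_rep a b w) \<and> (AE t in lebesgue_on {a..b}. cont_rep a b w t = w t)"
    unfolding cont_rep_def by (rule someI[where x = u]) (use u in blast)
  then show 1: "continuous_on {a..b} (cont_rep a b w)" and 2: "AE t in lebesgue_on {a..b}. cont_rep a b w t = w t"
    by auto
  have "AE t in lebesgue_on {a..b}. cont_rep a b w t = u t" using 2 u(2) by eventually_elim simp
  then show "t \<in> {a..b} \<Longrightarrow> cont_rep a b w t = u t"
    by (rule continuous_AE_eq_imp_eq[OF 1 u(1) ab])
qed

lemma H1_Holder:
  fixes w :: "real \<Rightarrow> real^'d"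
  assumes ab: "a < b" and w: "w \<in> H1 a b"
  shows "continuous_on {a..b} (cont_rep a b w)" "AE t in lebesgue_on {a..b}. cont_rep a b w t = w t"
    "s \<in> {a..b} \<Longrightarrow> t \<in> {a..b} \<Longrightarrow>
      norm (cont_rep a b w t - cont_rep a b w s) \<le> H1norm a b w * sqrt \<bar>t - s\<bar>"
proof -
  \<comment> \<open>The very weak derivative chosen inside \<open>H1norm\<close>, so that its norm
    is a summand there.\<close>
  define g where "g = (SOME g. g \<in> L2 {a..b} \<and> weak_deriv a b w g)"
  have "\<exists>g. g \<in> L2 {a..b} \<and> weak_deriv a b w g" and wL: "w \<in> L2 {a..b}"
    using w by (auto simp: H1_def)
  then have g: "g \<in> L2 {a..b}" "weak_deriv a b w g"
    using someI_ex[of "\<lambda>g. g \<in> L2 {a..b} \<and> weak_deriv a b w g"] by (auto simp: g_def)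
  obtain u where u: "AE t in lebesgue_on {a..b}. u t = w t"
    "\<And>s t. s \<in> {a..b} \<Longrightarrow> t \<in> {a..b} \<Longrightarrow> norm (u t - u s) \<le> L2norm {a..b} g * sqrt \<bar>t - s\<bar>"
    using weak_deriv_Holder_representative[OF ab wL g] by blast
  have uc: "continuous_on {a..b} u" by (rule Holder_imp_continuous_on[OF L2norm_nonneg u(2)])
  note cr = cont_rep_eq[OF ab uc u(1)]
  show "continuous_on {a..b} (cont_rep a b w)" "AE t in lebesgue_on {a..b}. cont_rep a b w t = w t"
    using cr by auto
  have "L2norm {a..b} g \<le> H1norm a b w"
    unfolding H1norm_def g_def[symmetric] by (rule real_le_rsqrt) simp
  then show "norm (cont_rep a b w t - cont_rep a b w s) \<le> H1norm a b w * sqrt \<bar>t - s\<bar>"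
    if "s \<in> {a..b}" "t \<in> {a..b}"
    using u(2)[OF that] that mult_right_mono[of "L2norm {a..b} g" "H1norm a b w" "sqrt \<bar>t - s\<bar>"]
    by (simp add: cr(3))
qed

subsection \<open>The Volterra equation\<close>

lemma measurable_translate_lebesgue_on:
  "(\<lambda>\<theta>. t + \<theta>) \<in> lebesgue_on {a..b::real} \<rightarrow>\<^sub>M lebesgue_on {t + a..t + b}"
proof (rule measurable_restrict_space3)
  show "(\<lambda>\<theta>::real. t + \<theta>) \<in> lebesgue \<rightarrow>\<^sub>M lebesgue"
    using lebesgue_affine_measurable[of "\<lambda>_. 1" t] by simp
qed auto

lemma AE_translate_lebesgue_on:
  assumes "AE x in lebesgue_on {t + a..t + b::real}. Q x"
  shows "AE x in lebesgue_on {a..b}. Q (t + x)"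
proof -
  have "AE x in lebesgue. x \<in> {t + a..t + b} \<longrightarrow> Q x" using assms by (simp add: AE_restrict_space_iff)
  then obtain N where N: "negligible N" "{x. \<not> (x \<in> {t + a..t + b} \<longrightarrow> Q x)} \<subseteq> N"
    by (auto simp: eventually_ae_filter negligible_iff_null_sets)
  have "negligible ((+) (- t) ` N)" by (rule negligible_translation[OF N(1)])
  then have "AE x in lebesgue. x \<notin> (+) (- t) ` N"
    by (intro AE_not_in) (simp add: negligible_iff_null_sets)
  then have "AE x in lebesgue. x \<in> {a..b} \<longrightarrow> Q (t + x)"
  proof eventually_elim
    case (elim x)
    show ?case
    proof (rule impI, rule ccontr)
      assume "x \<in> {a..b}" "\<not> Q (t + x)"
      then have "t + x \<in> N" using N(2) by auto
      then have "- t + (t + x) \<in> (+) (- t) ` N" by (rule imageI)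
      then show False using elim by simp
    qed
  qed
  then show ?thesis by (rule iffD2[OF AE_restrict_space_iff, rotated]) simp
qed

lemma integral_translate_lebesgue_on:
  fixes f :: "real \<Rightarrow> 'b::euclidean_space"
  shows "(\<integral>x. f (t + x) \<partial>(lebesgue_on {a..b})) = (\<integral>x. f x \<partial>(lebesgue_on {t + a..t + b}))"
proof -
  have "(\<integral>x. f x \<partial>(lebesgue_on {t + a..t + b})) = (\<integral>x. indicator {t + a..t + b} x *\<^sub>R f x \<partial>lebesgue)"
    by (simp add: integral_restrict_space)
  also have "\<dots> = (\<integral>x. indicator {t + a..t + b} (t + x) *\<^sub>R f (t + x) \<partial>lebesgue)"
    using lebesgue_integral_real_affine[of 1 "\<lambda>x. indicator {t + a..t + b} x *\<^sub>R f x" t] by simp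
  also have "\<dots> = (\<integral>x. indicator {a..b} x *\<^sub>R f (t + x) \<partial>lebesgue)"
    by (intro Bochner_Integration.integral_cong) (auto simp: indicator_def)
  finally show ?thesis by (simp add: integral_restrict_space)
qed

lemma integrable_translate_lebesgue_on:
  fixes f :: "real \<Rightarrow> 'b::euclidean_space"
  assumes "integrable (lebesgue_on {t + a..t + b}) f"
  shows "integrable (lebesgue_on {a..b}) (\<lambda>x. f (t + x))"
proof -
  have "integrable lebesgue (\<lambda>x. indicator {t + a..t + b} x *\<^sub>R f x)"
    using assms by (simp add: integrable_restrict_space)
  then have "integrable lebesgue (\<lambda>x. indicator {t + a..t + b} (t + x) *\<^sub>R f (t + x))"
    using lebesgue_integrable_real_affine[of "\<lambda>x. indicator {t + a..t + b} x *\<^sub>R f x" 1 t] by simp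
  also have "(\<lambda>x. indicator {t + a..t + b} (t + x) *\<^sub>R f (t + x)) = (\<lambda>x. indicator {a..b} x *\<^sub>R f (t + x))"
    by (auto simp: indicator_def)
  finally show ?thesis by (simp add: integrable_restrict_space)
qed

lemma L2_translate:
  assumes "f \<in> L2 {t + a..t + b}"
  shows "(\<lambda>x. f (t + x)) \<in> L2 {a..b}"
  using measurable_compose[OF measurable_translate_lebesgue_on L2_measurable[OF assms]]
    integrable_translate_lebesgue_on[OF L2_sq_integrable[OF assms]] by (simp add: L2_def)

lemma L2norm_translate: "L2norm {a..b} (\<lambda>x. f (t + x)) = L2norm {t + a..t + b} f"
  unfolding L2norm_def by (simp add: integral_translate_lebesgue_on[where f = "\<lambda>x. (norm (f x))\<^sup>2"])

lemma L2_combine: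
  fixes f :: "real \<Rightarrow> real^'d"
  assumes "f \<in> L2 {a..c}" "f \<in> L2 {c..b}" "a \<le> c" "c \<le> b"
  shows "f \<in> L2 {a..b}"
  using integrable_combine[OF L2_integrable[OF assms(1)] L2_integrable[OF assms(2)] assms(3,4)]
    integrable_combine[OF L2_sq_integrable[OF assms(1)] L2_sq_integrable[OF assms(2)] assms(3,4)]
  by (auto simp: L2_def)

lemma AE_lebesgue_on_neq: "AE t in lebesgue_on {a..b::real}. t \<noteq> c"
proof -
  have "{c} \<in> null_sets lebesgue" by simp
  then have "AE t in lebesgue. t \<notin> {c}" by (rule AE_not_in)
  then have "AE t in lebesgue. t \<in> {a..b} \<longrightarrow> t \<noteq> c" by eventually_elim auto
  then show ?thesis by (rule iffD2[OF AE_restrict_space_iff, rotated]) simp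
qed

lemma V_L2_past: "\<phi> \<in> L2 {a..0} \<Longrightarrow> V \<phi> w \<in> L2 {a..0}"
  by (subst L2_cong[where g = \<phi>]) (auto simp: V_def)

lemma V_AE_future: "AE t in lebesgue_on {0..b}. V \<phi> w t = w t"
  using AE_lebesgue_on_neq[of 0 0 b] AE_space
  by eventually_elim (auto simp: V_def)

lemma V_L2_future:
  assumes "w \<in> L2 {0..b}" shows "V \<phi> w \<in> L2 {0..b}"
proof (rule L2_cong_AE[OF assms])
  show "AE t in lebesgue_on {0..b}. w t = V \<phi> w t"
    using V_AE_future[where b = b and \<phi> = \<phi> and w = w] by eventually_elim simp
qed simp

lemma V_L2:
  assumes "\<phi> \<in> L2 {a..0}" "w \<in> L2 {0..b}" "a \<le> 0" "0 \<le> b" shows "V \<phi> w \<in> L2 {a..b}"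
  using L2_combine[OF V_L2_past[OF assms(1)] V_L2_future[OF assms(2)] assms(3,4)] .

lemma V_split: "V \<phi> w t = V \<phi> (\<lambda>_. 0) t + V (\<lambda>_. 0) w t"
  by (simp add: V_def)

text \<open>The norm of the type \<open>real^'n^'m\<close> is the Frobenius norm, so Cauchy-Schwarz
  row by row suffices.\<close>

lemma norm_matrix_vector_mult_le:
  fixes A :: "real^'n^'m" and x :: "real^'n"
  shows "norm (A *v x) \<le> norm A * norm x"
proof -
  have "norm (A *v x) = L2_set (\<lambda>i. norm (A $ i \<bullet> x)) UNIV"
    by (simp add: norm_vec_def matrix_vector_mul_component)
  also have "\<dots> \<le> L2_set (\<lambda>i. norm (A $ i) * norm x) UNIV"
    by (intro L2_set_mono) (auto simp: Cauchy_Schwarz_ineq2)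
  also have "\<dots> = norm A * norm x"
    by (simp add: norm_vec_def[of A] L2_set_left_distrib)
  finally show ?thesis .
qed

lemma borel_measurable_matrix_vector_mult:
  fixes A :: "real \<Rightarrow> real^'n^'m" and x :: "real \<Rightarrow> real^'n"
  assumes "A \<in> borel_measurable (lebesgue_on S)" "x \<in> borel_measurable (lebesgue_on S)" "S \<in> sets lebesgue"
  shows "(\<lambda>t. A t *v x t) \<in> borel_measurable (lebesgue_on S)"
proof (rule borel_measurable_bilinear[OF _ assms])
  show "bilinear ((*v) :: real^'n^'m \<Rightarrow> real^'n \<Rightarrow> real^'m)"
    by (auto simp: bilinear_def linear_iff vec_eq_iff matrix_vector_mult_def sum.distrib
        sum_distrib_left distrib_left distrib_right mult.assoc mult.left_commute)
qed

text \<open>The right-hand side \<open>z\<close> of the hypothesis is differentiable with derivative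
  \<open>b * y\<close>, at most \<open>b * z\<close>; hence \<open>exp (- b * t) * z t\<close>
  decreases from its initial value \<open>a\<close>.\<close>

lemma Gronwall:
  fixes y :: "real \<Rightarrow> real"
  assumes y: "continuous_on {0..h} y" and b: "0 \<le> b"
    and le: "\<And>t. t \<in> {0..h} \<Longrightarrow> y t \<le> a + b * integral {0..t} y" and t: "t \<in> {0..h}"
  shows "y t \<le> a * exp (b * t)"
proof -
  define z where "z t = a + b * integral {0..t} y" for t
  have zd: "(z has_real_derivative b * y x) (at x within {0..h})" if "x \<in> {0..h}" for x
    unfolding z_def using integral_has_real_derivative[OF y that]
    by (auto intro!: derivative_eq_intros)
  have "exp (- b * t) * z t \<le> exp (- b * 0) * z 0"
  proof (cases "t = 0")
    case False
    show ?thesis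
    proof (rule DERIV_nonpos_imp_decreasing_open[where f = "\<lambda>t. exp (- b * t) * z t"])
      show "0 \<le> t" using t by simp
      fix x assume x: "0 < x" "x < t"
      then have "(z has_real_derivative b * y x) (at x)"
        using zd[of x] t by (simp add: at_within_Icc_at)
      then have "((\<lambda>t. exp (- b * t) * z t) has_real_derivative exp (- b * x) * (b * y x - b * z x)) (at x)"
        by (auto intro!: derivative_eq_intros simp: algebra_simps)
      moreover have "exp (- b * x) * (b * y x - b * z x) \<le> 0"
        using le[of x] x t b unfolding z_def[symmetric] by (simp add: mult_nonneg_nonpos mult_left_mono)
      ultimately show "\<exists>y. ((\<lambda>t. exp (- b * t) * z t) has_real_derivative y) (at x) \<and> y \<le> 0" by blast
    next
      have "continuous_on {0..h} z" using zd by (intro DERIV_continuous_on)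
      then show "continuous_on {0..t} (\<lambda>t. exp (- b * t) * z t)"
        using t by (intro continuous_intros) (auto elim: continuous_on_subset)
    qed
  qed simp
  then have "exp (- b * t) * z t \<le> a" by (simp add: z_def)
  then have "z t \<le> a * exp (b * t)" by (simp add: exp_minus field_simps)
  then show ?thesis using le[OF t] by (simp add: z_def)
qed

text \<open>A Lebesgue null set lies in a Borel null set, to which Fubini's theorem for the product
  of two copies of \<open>lborel\<close> applies.\<close>

lemma AE_slice_lebesgue:
  fixes Q :: "real \<times> real \<Rightarrow> bool"
  assumes "AE x in lebesgue. Q x"
  shows "AE t in lebesgue. AE \<theta> in lebesgue. Q (t, \<theta>)"
proof -
  have "AE x in lborel. Q x" using assms by (simp add: AE_completion_iff)
  then have "AE x in lborel \<Otimes>\<^sub>M lborel. Q x" unfolding lborel_prod .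
  then have "AE t in lborel. AE \<theta> in lborel. Q (t, \<theta>)" by (rule lborel_pair.AE_pair)
  then show ?thesis by (simp add: AE_completion_iff)
qed

text \<open>A single slice of a Lebesgue measurable function need not be measurable. The continuous
  functions approximating \<open>C\<close> converge off a negligible set, and almost every slice of
  that set is negligible.\<close>

lemma slice_measurable_bounded:
  fixes C :: "real \<Rightarrow> real \<Rightarrow> real^'n^'m"
  assumes m: "(\<lambda>(t, \<theta>). C t \<theta>) \<in> borel_measurable (lebesgue_on ({s..} \<times> {c..d}))"
    and K: "AE (t, \<theta>) in lebesgue_on ({s..s+h} \<times> {c..d}). norm (C t \<theta>) \<le> K"
  shows "AE t in lebesgue_on {s..s+h}. C t \<in> borel_measurable (lebesgue_on {c..d}) \<and>
    (AE \<theta> in lebesgue_on {c..d}. norm (C t \<theta>) \<le> K)"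
proof -
  let ?D = "{s..s+h} \<times> {c..d}"
  have "closed ?D" by (intro closed_Times) auto
  then have D: "?D \<in> sets lebesgue" by simp
  have "(\<lambda>(t, \<theta>). C t \<theta>) \<in> borel_measurable (lebesgue_on ?D)"
    by (rule measurable_restrict_mono[OF m]) auto
  then have "(\<lambda>(t, \<theta>). C t \<theta>) measurable_on ?D" using D by (simp add: measurable_on_iff_borel_measurable)
  then obtain N g where N: "negligible N" and g: "\<And>n. continuous_on UNIV (g n)"
    "\<And>x. x \<notin> N \<Longrightarrow> (\<lambda>n. g n x) \<longlonglongrightarrow> (if x \<in> ?D then (case x of (t, \<theta>) \<Rightarrow> C t \<theta>) else 0)"
    unfolding measurable_on_def by metis
  have "AE x in lebesgue. x \<notin> N" using N by (intro AE_not_in) (simp add: negligible_iff_null_sets)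
  then have a1: "AE t in lebesgue. AE \<theta> in lebesgue. (t, \<theta>) \<notin> N" by (rule AE_slice_lebesgue)
  have "AE x in lebesgue. x \<in> ?D \<longrightarrow> (case x of (t, \<theta>) \<Rightarrow> norm (C t \<theta>) \<le> K)"
    using K D by (simp add: AE_restrict_space_iff)
  from AE_slice_lebesgue[OF this]
  have a2: "AE t in lebesgue. AE \<theta> in lebesgue. (t, \<theta>) \<in> ?D \<longrightarrow> norm (C t \<theta>) \<le> K" by simp
  have "AE t in lebesgue. t \<in> {s..s+h} \<longrightarrow> C t \<in> borel_measurable (lebesgue_on {c..d}) \<and>
    (AE \<theta> in lebesgue_on {c..d}. norm (C t \<theta>) \<le> K)"
    using a1 a2
  proof eventually_elim
    case (elim t)
    show ?case
    proof
      assume t: "t \<in> {s..s+h}"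
      have "AE \<theta> in lebesgue. \<theta> \<in> {c..d} \<longrightarrow> norm (C t \<theta>) \<le> K"
        using elim(2) t by (auto elim!: eventually_mono)
      then have 1: "AE \<theta> in lebesgue_on {c..d}. norm (C t \<theta>) \<le> K"
        by (rule iffD2[OF AE_restrict_space_iff, rotated]) simp
      obtain Z where Z: "negligible Z" "\<And>\<theta>. \<theta> \<notin> Z \<Longrightarrow> (t, \<theta>) \<notin> N"
        using elim(1) by (auto simp: eventually_ae_filter negligible_iff_null_sets)
      have "C t measurable_on {c..d}" unfolding measurable_on_def
      proof (intro exI conjI allI impI)
        show "negligible Z" by fact
        show "continuous_on UNIV (\<lambda>\<theta>. g n (t, \<theta>))" for n
          by (rule continuous_on_compose2[OF g(1)]) (auto intro!: continuous_intros)
        show "(\<lambda>n. g n (t, \<theta>)) \<longlonglongrightarrow> (if \<theta> \<in> {c..d} then C t \<theta> else 0)" if "\<theta> \<notin> Z" for \<theta>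
          using g(2)[OF Z(2)[OF that]] t by (cases "\<theta> \<in> {c..d}") auto
      qed
      then have "C t \<in> borel_measurable (lebesgue_on {c..d})"
        by (simp add: measurable_on_iff_borel_measurable)
      with 1 show "C t \<in> borel_measurable (lebesgue_on {c..d}) \<and>
        (AE \<theta> in lebesgue_on {c..d}. norm (C t \<theta>) \<le> K)" by blast
    qed
  qed
  then show ?thesis by (rule iffD2[OF AE_restrict_space_iff, rotated]) simp
qed

text \<open>\<open>K\<close> bounds the kernel; \<open>K2\<close> and \<open>K3\<close> bound, as
  maps into H1, the operators called A and B in the overview.\<close>

locale renewal =
  fixes C :: "real \<Rightarrow> real \<Rightarrow> real^'d^'d" and \<tau> s h K K2 K3 :: real
  assumes tau_pos: "\<tau> > 0" and h_ge: "h \<ge> \<tau>"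
    and C_meas: "(\<lambda>(t, \<theta>). C t \<theta>) \<in> borel_measurable (lebesgue_on ({s..} \<times> {-\<tau>..0}))"
    and K_nonneg: "0 \<le> K"
    and C_bdd: "AE (t, \<theta>) in lebesgue_on ({s..s+h} \<times> {-\<tau>..0}). norm (C t \<theta>) \<le> K"
    and F_future_H1: "w \<in> L2 {0..h} \<Longrightarrow> F \<tau> s C (V (\<lambda>_. 0) w) \<in> H1 0 h"
    and K2_nonneg: "0 \<le> K2"
    and F_future_le: "w \<in> L2 {0..h} \<Longrightarrow> H1norm 0 h (F \<tau> s C (V (\<lambda>_. 0) w)) \<le> K2 * L2norm {0..h} w"
    and F_past_H1: "\<phi> \<in> L2 {-\<tau>..0} \<Longrightarrow> F \<tau> s C (V \<phi> (\<lambda>_. 0)) \<in> H1 0 h"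
    and K3_nonneg: "0 \<le> K3"
    and F_past_le: "\<phi> \<in> L2 {-\<tau>..0} \<Longrightarrow> H1norm 0 h (F \<tau> s C (V \<phi> (\<lambda>_. 0))) \<le> K3 * L2norm {-\<tau>..0} \<phi>"
begin

abbreviation FV where "FV \<phi> w \<equiv> F \<tau> s C (V \<phi> w)"
abbreviation FP where "FP \<phi> \<equiv> F \<tau> s C (V \<phi> (\<lambda>_. 0))"
abbreviation FN where "FN w \<equiv> F \<tau> s C (V (\<lambda>_. 0) w)"

lemma h_pos: "0 < h" using tau_pos h_ge by simp

text \<open>At other times the integral in \<open>F\<close> may degenerate to 0, the value given to
  non-integrable functions; linearity and norm bounds of \<open>F\<close> are therefore stated at
  good times.\<close>

definition good :: "real \<Rightarrow> bool" where
  "good t \<longleftrightarrow> C (s + t) \<in> borel_measurable (lebesgue_on {-\<tau>..0}) \<and>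
    (AE \<theta> in lebesgue_on {-\<tau>..0}. norm (C (s + t) \<theta>) \<le> K)"

lemma AE_good: "AE t in lebesgue_on {0..h}. good t"
  unfolding good_def
  by (rule AE_translate_lebesgue_on[where t = s and a = 0 and b = h, unfolded add_0_right,
        OF slice_measurable_bounded[OF C_meas C_bdd]])

text \<open>The kernel in absolute time \<sigma> = t + \<theta>, which turns \<open>F\<close> into a
  Volterra operator with the moving window \<open>{t-\<tau>..t}\<close>.\<close>

definition kern :: "real \<Rightarrow> real \<Rightarrow> real^'d^'d" where
  "kern t \<sigma> = C (s + t) (\<sigma> - t)"

lemma F_eq_kern: "F \<tau> s C v t = (\<integral>\<sigma>. kern t \<sigma> *v v \<sigma> \<partial>(lebesgue_on {t-\<tau>..t}))"
  using integral_translate_lebesgue_on[where f = "\<lambda>\<sigma>. kern t \<sigma> *v v \<sigma>" and t = t and a = "-\<tau>" and b = 0]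
  by (simp add: F_def kern_def)

lemma kern_good:
  assumes "good t"
  shows "kern t \<in> borel_measurable (lebesgue_on {t-\<tau>..t})"
    "AE \<sigma> in lebesgue_on {t-\<tau>..t}. norm (kern t \<sigma>) \<le> K"
proof -
  have iv: "{-\<tau>..0} = {-t + (t-\<tau>)..-t + t}" by simp
  have C: "C (s + t) \<in> borel_measurable (lebesgue_on {-t + (t-\<tau>)..-t + t})"
    "AE \<theta> in lebesgue_on {-t + (t-\<tau>)..-t + t}. norm (C (s + t) \<theta>) \<le> K"
    using assms unfolding good_def iv by blast+
  show "kern t \<in> borel_measurable (lebesgue_on {t-\<tau>..t})"
    using measurable_compose[OF measurable_translate_lebesgue_on C(1)]
    by (simp add: kern_def[abs_def] add.commute)
  show "AE \<sigma> in lebesgue_on {t-\<tau>..t}. norm (kern t \<sigma>) \<le> K"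
    using AE_translate_lebesgue_on[OF C(2)] by (simp add: kern_def add.commute)
qed

context
  fixes t :: real
  assumes t: "t \<in> {0..h}" and g: "good t"
begin

lemma kern_integrable:
  assumes v: "v \<in> L2 {-\<tau>..h}"
  shows "integrable (lebesgue_on {t-\<tau>..t}) (\<lambda>\<sigma>. kern t \<sigma> *v v \<sigma>)"
proof (rule Bochner_Integration.integrable_bound)
  have vL: "v \<in> L2 {t-\<tau>..t}" using t by (intro L2_subinterval[OF v]) auto
  show "integrable (lebesgue_on {t-\<tau>..t}) (\<lambda>\<sigma>. K * norm (v \<sigma>))"
    using L2_integrable[OF vL] by (intro integrable_mult_right integrable_norm)
  show "(\<lambda>\<sigma>. kern t \<sigma> *v v \<sigma>) \<in> borel_measurable (lebesgue_on {t-\<tau>..t})"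
    by (intro borel_measurable_matrix_vector_mult kern_good g L2_measurable[OF vL]) simp
  show "AE \<sigma> in lebesgue_on {t-\<tau>..t}. norm (kern t \<sigma> *v v \<sigma>) \<le> norm (K * norm (v \<sigma>))"
    using kern_good(2)[OF g]
  proof eventually_elim
    case (elim \<sigma>)
    have "norm (kern t \<sigma> *v v \<sigma>) \<le> norm (kern t \<sigma>) * norm (v \<sigma>)" by (rule norm_matrix_vector_mult_le)
    also have "\<dots> \<le> K * norm (v \<sigma>)" using elim by (intro mult_right_mono) auto
    finally show ?case using K_nonneg by simp
  qed
qed

lemma F_add:
  assumes "u \<in> L2 {-\<tau>..h}" "v \<in> L2 {-\<tau>..h}"
  shows "F \<tau> s C (\<lambda>x. u x + v x) t = F \<tau> s C u t + F \<tau> s C v t"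
  using kern_integrable[OF assms(1)] kern_integrable[OF assms(2)]
  by (simp add: F_eq_kern matrix_vector_right_distrib)

lemma F_diff:
  assumes "u \<in> L2 {-\<tau>..h}" "v \<in> L2 {-\<tau>..h}"
  shows "F \<tau> s C (\<lambda>x. u x - v x) t = F \<tau> s C u t - F \<tau> s C v t"
  using kern_integrable[OF assms(1)] kern_integrable[OF assms(2)]
  by (simp add: F_eq_kern matrix_vector_mult_diff_distrib)

lemma F_scaleR: "F \<tau> s C (\<lambda>x. c *\<^sub>R v x) t = c *\<^sub>R F \<tau> s C v t"
  by (simp add: F_eq_kern matrix_vector_mult_scaleR)

lemma F_norm_le:
  assumes v: "v \<in> L2 {-\<tau>..h}"
  shows "norm (F \<tau> s C v t) \<le> K * (\<integral>\<sigma>. norm (v \<sigma>) \<partial>(lebesgue_on {-\<tau>..t}))"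
proof -
  have vL: "v \<in> L2 {-\<tau>..t}" using t by (intro L2_subinterval[OF v]) auto
  have "norm (F \<tau> s C v t) \<le> (\<integral>\<sigma>. norm (kern t \<sigma> *v v \<sigma>) \<partial>(lebesgue_on {t-\<tau>..t}))"
    unfolding F_eq_kern by (rule integral_norm_bound)
  also have "\<dots> \<le> (\<integral>\<sigma>. K * norm (v \<sigma>) \<partial>(lebesgue_on {-\<tau>..t}))"
  proof (rule integral_mono_lebesgue_on_AE)
    show "integrable (lebesgue_on {-\<tau>..t}) (\<lambda>\<sigma>. K * norm (v \<sigma>))"
      using L2_integrable[OF vL] by (intro integrable_mult_right integrable_norm)
    show "AE \<sigma> in lebesgue_on {t-\<tau>..t}. norm (kern t \<sigma> *v v \<sigma>) \<le> K * norm (v \<sigma>)"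
      using kern_good(2)[OF g]
      by eventually_elim (rule order_trans[OF norm_matrix_vector_mult_le], rule mult_right_mono, auto)
  qed (use t K_nonneg in auto)
  finally show ?thesis by simp
qed

text \<open>As the past is zero, only values of \<open>w\<close> up to time \<open>t\<close> enter.
  This causality is behind both Gronwall's inequality and the factorials in the Neumann
  series.\<close>

lemma FN_norm_le:
  assumes w: "w \<in> L2 {0..h}"
  shows "norm (FN w t) \<le> K * (\<integral>\<sigma>. norm (w \<sigma>) \<partial>(lebesgue_on {0..t}))"
proof -
  have v: "V (\<lambda>_. 0) w \<in> L2 {-\<tau>..h}" using tau_pos h_pos w by (intro V_L2) auto
  have vt: "V (\<lambda>_. 0) w \<in> L2 {-\<tau>..t}" using t by (intro L2_subinterval[OF v]) auto
  have v0: "V (\<lambda>_. 0) w \<in> L2 {0..t}" and w0: "w \<in> L2 {0..t}"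
    using t tau_pos by (intro L2_subinterval[OF v] L2_subinterval[OF w]; force)+
  have "(\<integral>\<sigma>. norm (V (\<lambda>_. 0) w \<sigma>) \<partial>(lebesgue_on {-\<tau>..t})) =
      (\<integral>\<sigma>. norm (V (\<lambda>_. 0) w \<sigma>) \<partial>(lebesgue_on {-\<tau>..0})) + (\<integral>\<sigma>. norm (V (\<lambda>_. 0) w \<sigma>) \<partial>(lebesgue_on {0..t}))"
    using t tau_pos by (intro integral_combine integrable_norm L2_integrable[OF vt]) auto
  also have "(\<integral>\<sigma>. norm (V (\<lambda>_. 0) w \<sigma>) \<partial>(lebesgue_on {-\<tau>..0})) = (\<integral>\<sigma>. 0 \<partial>(lebesgue_on {-\<tau>..0}))"
    by (intro Bochner_Integration.integral_cong) (auto simp: V_def)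
  also have "(\<integral>\<sigma>. norm (V (\<lambda>_. 0) w \<sigma>) \<partial>(lebesgue_on {0..t})) = (\<integral>\<sigma>. norm (w \<sigma>) \<partial>(lebesgue_on {0..t}))"
  proof (rule integral_cong_AE)
    show "AE \<sigma> in lebesgue_on {0..t}. norm (V (\<lambda>_. 0) w \<sigma>) = norm (w \<sigma>)"
      using V_AE_future[where b = t and \<phi> = "\<lambda>_. 0" and w = w] by eventually_elim simp
  qed (use L2_measurable[OF v0] L2_measurable[OF w0] in auto)
  finally show ?thesis using F_norm_le[OF v] by simp
qed

lemma FP_norm_le:
  assumes \<phi>: "\<phi> \<in> L2 {-\<tau>..0}"
  shows "norm (FP \<phi> t) \<le> K * (sqrt \<tau> * L2norm {-\<tau>..0} \<phi>)"
proof -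
  have v: "V \<phi> (\<lambda>_. 0) \<in> L2 {-\<tau>..h}" using tau_pos h_pos \<phi> by (intro V_L2) auto
  have vt: "V \<phi> (\<lambda>_. 0) \<in> L2 {-\<tau>..t}" using t by (intro L2_subinterval[OF v]) auto
  have v0: "V \<phi> (\<lambda>_. 0) \<in> L2 {0..t}" using t tau_pos by (intro L2_subinterval[OF v]) auto
  have "(\<integral>\<sigma>. norm (V \<phi> (\<lambda>_. 0) \<sigma>) \<partial>(lebesgue_on {-\<tau>..t})) =
      (\<integral>\<sigma>. norm (V \<phi> (\<lambda>_. 0) \<sigma>) \<partial>(lebesgue_on {-\<tau>..0})) + (\<integral>\<sigma>. norm (V \<phi> (\<lambda>_. 0) \<sigma>) \<partial>(lebesgue_on {0..t}))"
    using t tau_pos by (intro integral_combine integrable_norm L2_integrable[OF vt]) auto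
  also have "(\<integral>\<sigma>. norm (V \<phi> (\<lambda>_. 0) \<sigma>) \<partial>(lebesgue_on {-\<tau>..0})) = (\<integral>\<sigma>. norm (\<phi> \<sigma>) \<partial>(lebesgue_on {-\<tau>..0}))"
    by (intro Bochner_Integration.integral_cong) (auto simp: V_def)
  also have "(\<integral>\<sigma>. norm (V \<phi> (\<lambda>_. 0) \<sigma>) \<partial>(lebesgue_on {0..t})) = (\<integral>\<sigma>. 0 \<partial>(lebesgue_on {0..t}))"
  proof (rule integral_cong_AE)
    show "AE \<sigma> in lebesgue_on {0..t}. norm (V \<phi> (\<lambda>_. 0) \<sigma>) = 0"
      using V_AE_future[where b = t and \<phi> = \<phi> and w = "\<lambda>_. 0"] by eventually_elim simp
  qed (use L2_measurable[OF v0] in auto)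
  finally have "(\<integral>\<sigma>. norm (V \<phi> (\<lambda>_. 0) \<sigma>) \<partial>(lebesgue_on {-\<tau>..t})) \<le> sqrt \<tau> * L2norm {-\<tau>..0} \<phi>"
    using norm_integral_le_L2norm[OF \<phi>] tau_pos by simp
  then have "K * (\<integral>\<sigma>. norm (V \<phi> (\<lambda>_. 0) \<sigma>) \<partial>(lebesgue_on {-\<tau>..t})) \<le> K * (sqrt \<tau> * L2norm {-\<tau>..0} \<phi>)"
    using K_nonneg by (intro mult_left_mono)
  then show ?thesis using F_norm_le[OF v] by linarith
qed

lemma FV_split:
  assumes "\<phi> \<in> L2 {-\<tau>..0}" "w \<in> L2 {0..h}"
  shows "FV \<phi> w t = FP \<phi> t + FN w t"
proof -
  have "FV \<phi> w t = F \<tau> s C (\<lambda>x. V \<phi> (\<lambda>_. 0) x + V (\<lambda>_. 0) w x) t"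
    by (rule arg_cong[where f = "\<lambda>v. F \<tau> s C v t"], rule ext, rule V_split)
  also have "\<dots> = FP \<phi> t + FN w t"
    using tau_pos h_pos assms by (intro F_add V_L2) auto
  finally show ?thesis .
qed

lemma FN_diff:
  assumes "u \<in> L2 {0..h}" "w \<in> L2 {0..h}"
  shows "FN (\<lambda>x. u x - w x) t = FN u t - FN w t"
proof -
  have "FN (\<lambda>x. u x - w x) t = F \<tau> s C (\<lambda>x. V (\<lambda>_. 0) u x - V (\<lambda>_. 0) w x) t"
    by (rule arg_cong[where f = "\<lambda>v. F \<tau> s C v t"]) (auto simp: V_def)
  also have "\<dots> = FN u t - FN w t" using tau_pos h_pos assms by (intro F_diff V_L2) auto
  finally show ?thesis .
qed

lemma FN_add:
  assumes "u \<in> L2 {0..h}" "w \<in> L2 {0..h}"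
  shows "FN (\<lambda>x. u x + w x) t = FN u t + FN w t"
proof -
  have "FN (\<lambda>x. u x + w x) t = F \<tau> s C (\<lambda>x. V (\<lambda>_. 0) u x + V (\<lambda>_. 0) w x) t"
    by (rule arg_cong[where f = "\<lambda>v. F \<tau> s C v t"]) (auto simp: V_def)
  also have "\<dots> = FN u t + FN w t" using tau_pos h_pos assms by (intro F_add V_L2) auto
  finally show ?thesis .
qed

lemma FN_scaleR: "FN (\<lambda>x. c *\<^sub>R w x) t = c *\<^sub>R FN w t"
proof -
  have "FN (\<lambda>x. c *\<^sub>R w x) t = F \<tau> s C (\<lambda>x. c *\<^sub>R V (\<lambda>_. 0) w x) t"
    by (rule arg_cong[where f = "\<lambda>v. F \<tau> s C v t"]) (auto simp: V_def)
  then show ?thesis by (simp add: F_scaleR)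
qed

lemma FP_diff:
  assumes "u \<in> L2 {-\<tau>..0}" "w \<in> L2 {-\<tau>..0}"
  shows "FP (\<lambda>x. u x - w x) t = FP u t - FP w t"
proof -
  have "FP (\<lambda>x. u x - w x) t = F \<tau> s C (\<lambda>x. V u (\<lambda>_. 0) x - V w (\<lambda>_. 0) x) t"
    by (rule arg_cong[where f = "\<lambda>v. F \<tau> s C v t"]) (auto simp: V_def)
  also have "\<dots> = FP u t - FP w t" using tau_pos h_pos assms by (intro F_diff V_L2) auto
  finally show ?thesis .
qed

end

lemma FN_L2: "w \<in> L2 {0..h} \<Longrightarrow> FN w \<in> L2 {0..h}"
  using F_future_H1 by (auto simp: H1_def)

lemma FP_L2: "\<phi> \<in> L2 {-\<tau>..0} \<Longrightarrow> FP \<phi> \<in> L2 {0..h}"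
  using F_past_H1 by (auto simp: H1_def)

text \<open>Gronwall's constant for the rate \<open>2 * K\<^sup>2 * h\<close> on an interval of
  length \<open>h\<close>; the leading 2 comes from the remainder term, and the root from estimating
  squared norms.\<close>

definition stab :: real where "stab = sqrt (2 * exp (2 * K\<^sup>2 * h * h))"

lemma stab_pos: "0 < stab" by (simp add: stab_def)

text \<open>The causal bound and \<open>(x + y)\<^sup>2 \<le> 2 * x\<^sup>2 + 2 * y\<^sup>2\<close>
  give \<open>(norm (e t))\<^sup>2 \<le> b * y t + 2 * (norm (r t))\<^sup>2\<close> almost
  everywhere, where \<open>y t\<close> is the integral of the left side up to \<open>t\<close>.
  Integrated once, this holds for every \<open>t\<close> and is Gronwall's hypothesis for the
  continuous \<open>y\<close>.\<close>

lemma Volterra_stability: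
  assumes e: "e \<in> L2 {0..h}" and r: "r \<in> L2 {0..h}"
    and eq: "AE t in lebesgue_on {0..h}. e t = FN e t + r t"
  shows "L2norm {0..h} e \<le> stab * L2norm {0..h} r"
proof -
  let ?I = "\<lambda>f t. \<integral>x. (norm (f x :: real^'d))\<^sup>2 \<partial>(lebesgue_on {0..t})"
  define y where "y = ?I e"
  define b where "b = 2 * K\<^sup>2 * h"
  have b: "0 \<le> b" using h_pos by (simp add: b_def)
  have eL: "e \<in> L2 {0..t}" and rL: "r \<in> L2 {0..t}" if "t \<in> {0..h}" for t
    using that by (auto intro!: L2_subinterval[OF e] L2_subinterval[OF r])
  have yi: "y t = integral {0..t} (\<lambda>x. (norm (e x))\<^sup>2)" if "t \<in> {0..h}" for t
    unfolding y_def by (intro lebesgue_integral_eq_integral L2_sq_integrable eL that) simp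
  have "(\<lambda>x. (norm (e x))\<^sup>2) integrable_on {0..h}"
    by (intro integrable_on_lebesgue_on L2_sq_integrable e) simp
  then have "continuous_on {0..h} (\<lambda>t. integral {0..t} (\<lambda>x. (norm (e x))\<^sup>2))"
    by (rule indefinite_integral_continuous_1)
  then have yc: "continuous_on {0..h} y" using yi by (subst continuous_on_cong[OF refl]) auto
  have pt: "AE t in lebesgue_on {0..h}. (norm (e t))\<^sup>2 \<le> b * y t + 2 * (norm (r t))\<^sup>2"
    using eq AE_good AE_space
  proof eventually_elim
    case (elim t)
    then have t: "t \<in> {0..h}" by simp
    have n: "0 \<le> L2norm {0..t} e" by simp
    have "norm (e t) \<le> norm (FN e t) + norm (r t)" using elim(1) by (metis norm_triangle_ineq)
    moreover have "norm (FN e t) \<le> K * (sqrt h * L2norm {0..t} e)"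
    proof -
      have "(\<integral>\<sigma>. norm (e \<sigma>) \<partial>(lebesgue_on {0..t})) \<le> sqrt (t - 0) * L2norm {0..t} e"
        using t by (intro norm_integral_le_L2norm eL) auto
      also have "\<dots> \<le> sqrt h * L2norm {0..t} e" using t n by (intro mult_right_mono) auto
      finally have "K * (\<integral>\<sigma>. norm (e \<sigma>) \<partial>(lebesgue_on {0..t})) \<le> K * (sqrt h * L2norm {0..t} e)"
        using K_nonneg by (intro mult_left_mono)
      then show ?thesis using FN_norm_le[OF t elim(2) e] by linarith
    qed
    ultimately have "norm (e t) \<le> K * (sqrt h * L2norm {0..t} e) + norm (r t)" by linarith
    then have "(norm (e t))\<^sup>2 \<le> (K * (sqrt h * L2norm {0..t} e) + norm (r t))\<^sup>2"
      by (intro power_mono) auto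
    also have "\<dots> \<le> 2 * (K * (sqrt h * L2norm {0..t} e))\<^sup>2 + 2 * (norm (r t))\<^sup>2"
      using zero_le_power2[of "K * (sqrt h * L2norm {0..t} e) - norm (r t)"]
      by (simp add: power2_sum power2_diff)
    also have "2 * (K * (sqrt h * L2norm {0..t} e))\<^sup>2 = b * y t"
      using h_pos by (simp add: b_def y_def power_mult_distrib L2norm_sq)
    finally show ?case .
  qed
  have "y h \<le> (2 * (L2norm {0..h} r)\<^sup>2) * exp (b * h)"
  proof (rule Gronwall[OF yc b])
    fix t assume t: "t \<in> {0..h}"
    have yt: "continuous_on {0..t} y" using t by (intro continuous_on_subset[OF yc]) auto
    have iy: "integrable (lebesgue_on {0..t}) y" by (rule continuous_imp_integrable_real[OF yt])
    have ir: "integrable (lebesgue_on {0..t}) (\<lambda>x. (norm (r x))\<^sup>2)" by (rule L2_sq_integrable[OF rL[OF t]])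
    have "y t \<le> (\<integral>x. b * y x + 2 * (norm (r x))\<^sup>2 \<partial>(lebesgue_on {0..t}))"
      unfolding y_def
    proof (rule integral_mono_AE[OF L2_sq_integrable[OF eL[OF t]]])
      show "integrable (lebesgue_on {0..t}) (\<lambda>x. b * ?I e x + 2 * (norm (r x))\<^sup>2)"
        using iy ir unfolding y_def by (intro Bochner_Integration.integrable_add integrable_mult_right)
      have "AE x in lebesgue. x \<in> {0..h} \<longrightarrow> (norm (e x))\<^sup>2 \<le> b * ?I e x + 2 * (norm (r x))\<^sup>2"
        using pt unfolding y_def by (simp add: AE_restrict_space_iff)
      then have "AE x in lebesgue. x \<in> {0..t} \<longrightarrow> (norm (e x))\<^sup>2 \<le> b * ?I e x + 2 * (norm (r x))\<^sup>2"
        by eventually_elim (use t in auto)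
      then show "AE x in lebesgue_on {0..t}. (norm (e x))\<^sup>2 \<le> b * ?I e x + 2 * (norm (r x))\<^sup>2"
        by (rule iffD2[OF AE_restrict_space_iff, rotated]) simp
    qed
    also have "\<dots> = b * (\<integral>x. y x \<partial>(lebesgue_on {0..t})) + 2 * (L2norm {0..t} r)\<^sup>2"
      using iy ir by (simp add: L2norm_sq)
    also have "(\<integral>x. y x \<partial>(lebesgue_on {0..t})) = integral {0..t} y"
      by (intro lebesgue_integral_eq_integral iy) simp
    also have "(L2norm {0..t} r)\<^sup>2 \<le> (L2norm {0..h} r)\<^sup>2"
      using t by (intro power_mono L2norm_subinterval_le[OF r]) auto
    finally show "y t \<le> 2 * (L2norm {0..h} r)\<^sup>2 + b * integral {0..t} y" by simp
  qed (use h_pos in auto)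
  also have "\<dots> = (stab * L2norm {0..h} r)\<^sup>2"
    by (simp add: stab_def power_mult_distrib b_def)
  finally have "(L2norm {0..h} e)\<^sup>2 \<le> (stab * L2norm {0..h} r)\<^sup>2"
    by (simp add: y_def L2norm_sq)
  moreover have "0 \<le> stab * L2norm {0..h} r" using stab_pos by simp
  ultimately show ?thesis by (rule power2_le_imp_le)
qed

end

section \<open>Existence of the exact solution by a Neumann series\<close>

lemma L2norm_le_H1norm: "L2norm {a..b} w \<le> H1norm a b w"
  unfolding H1norm_def by (rule real_le_rsqrt) simp

lemma integral_power_interval:
  assumes "0 \<le> t"
  shows "(\<integral>x. x ^ n \<partial>(lebesgue_on {0..t})) = t ^ Suc n / (1 + real n)"
proof -
  have "pderiv (monom (1 / (1 + real n)) (Suc n)) = monom 1 n" by (simp add: pderiv_monom)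
  then show ?thesis
    using integral_pderiv[OF assms, of "monom (1 / (1 + real n)) (Suc n)"] by (simp add: poly_monom)
qed

context renewal
begin

lemma FN_norm_le_L2:
  assumes t: "t \<in> {0..h}" and g: "good t" and w: "w \<in> L2 {0..h}"
  shows "norm (FN w t) \<le> K * (sqrt h * L2norm {0..h} w)"
proof -
  have wt: "w \<in> L2 {0..t}" using t by (intro L2_subinterval[OF w]) auto
  have "(\<integral>\<sigma>. norm (w \<sigma>) \<partial>(lebesgue_on {0..t})) \<le> sqrt (t - 0) * L2norm {0..t} w"
    using t by (intro norm_integral_le_L2norm wt) auto
  also have "\<dots> \<le> sqrt h * L2norm {0..h} w"
    using t by (intro mult_mono L2norm_subinterval_le[OF w]) auto
  finally have "K * (\<integral>\<sigma>. norm (w \<sigma>) \<partial>(lebesgue_on {0..t})) \<le> K * (sqrt h * L2norm {0..h} w)"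
    using K_nonneg by (intro mult_left_mono)
  then show ?thesis using FN_norm_le[OF t g w] by linarith
qed

lemma FN_zero [simp]: "FN (\<lambda>_. 0) t = 0"
  by (simp add: F_def V_def cong: if_cong)

definition neumann :: "(real \<Rightarrow> real^'d) \<Rightarrow> nat \<Rightarrow> real \<Rightarrow> real^'d" where
  "neumann g n = ((\<lambda>w. FN w) ^^ n) g"

lemma neumann_L2: "g \<in> L2 {0..h} \<Longrightarrow> neumann g n \<in> L2 {0..h}"
  by (induction n) (simp_all add: neumann_def FN_L2)

text \<open>Applying A to the term of index \<open>n\<close> integrates a multiple of
  \<open>x ^ n\<close> up to \<open>t\<close>, which contributes the factor
  \<open>K * t / (n + 1)\<close>.\<close>

lemma neumann_bound:
  assumes g: "g \<in> L2 {0..h}" and B: "0 \<le> B" and gB: "AE t in lebesgue_on {0..h}. norm (g t) \<le> B"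
  shows "AE t in lebesgue_on {0..h}. norm (neumann g n t) \<le> B * (K * t) ^ n / fact n"
proof (induction n)
  case 0
  then show ?case using gB by (simp add: neumann_def)
next
  case (Suc n)
  show ?case
    using AE_good AE_space
  proof eventually_elim
    case (elim t)
    then have t: "t \<in> {0..h}" by simp
    let ?c = "B * K ^ n / fact n"
    have c: "0 \<le> ?c" using B K_nonneg by simp
    have "AE x in lebesgue. x \<in> {0..h} \<longrightarrow> norm (neumann g n x) \<le> B * (K * x) ^ n / fact n"
      using Suc.IH by (simp add: AE_restrict_space_iff)
    then have "AE x in lebesgue. x \<in> {0..t} \<longrightarrow> norm (neumann g n x) \<le> ?c * x ^ n"
      by eventually_elim (use t in \<open>auto simp: power_mult_distrib\<close>)
    then have ae: "AE x in lebesgue_on {0..t}. norm (neumann g n x) \<le> ?c * x ^ n"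
      by (rule iffD2[OF AE_restrict_space_iff, rotated]) simp
    have nt: "neumann g n \<in> L2 {0..t}" using t by (intro L2_subinterval[OF neumann_L2[OF g]]) auto
    have "(\<integral>x. norm (neumann g n x) \<partial>(lebesgue_on {0..t})) \<le> (\<integral>x. ?c * x ^ n \<partial>(lebesgue_on {0..t}))"
      by (intro integral_mono_AE integrable_norm L2_integrable[OF nt] ae continuous_imp_integrable_real continuous_intros)
    also have "\<dots> = ?c * (t ^ Suc n / (1 + real n))"
      using t integral_power_interval[of t n] by simp
    finally have "K * (\<integral>x. norm (neumann g n x) \<partial>(lebesgue_on {0..t})) \<le> K * (?c * (t ^ Suc n / (1 + real n)))"
      using K_nonneg by (intro mult_left_mono)
    also have "\<dots> = B * (K * t) ^ Suc n / fact (Suc n)"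
      by (simp add: power_mult_distrib mult.assoc mult.left_commute mult.commute)
    finally have "norm (FN (neumann g n) t) \<le> B * (K * t) ^ Suc n / fact (Suc n)"
      by (rule order_trans[OF FN_norm_le[OF t elim(1) neumann_L2[OF g]]])
    moreover have "neumann g (Suc n) t = FN (neumann g n) t" by (simp add: neumann_def)
    ultimately show ?case by simp
  qed
qed

text \<open>\<open>exact_sol\<close> is a choice, so a solution has to be exhibited: the Neumann
  series started at \<open>FP \<phi>\<close>. An exponential series dominates it, whatever the size
  of \<open>K * h\<close>, so it converges at almost every time and in norm.\<close>

lemma exact_solution_exists:
  assumes \<phi>: "\<phi> \<in> L2 {-\<tau>..0}"
  shows "\<exists>w. w \<in> L2 {0..h} \<and> (AE t in lebesgue_on {0..h}. w t = FV \<phi> w t)"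
proof -
  let ?M = "lebesgue_on {0..h}"
  define g where "g = FP \<phi>"
  have g: "g \<in> L2 {0..h}" using FP_L2[OF \<phi>] by (simp add: g_def)
  define B where "B = K * (sqrt \<tau> * L2norm {-\<tau>..0} \<phi>)"
  have B: "0 \<le> B" using K_nonneg tau_pos by (simp add: B_def)
  have gB: "AE t in ?M. norm (g t) \<le> B"
    using AE_good AE_space by eventually_elim (simp add: g_def B_def FP_norm_le \<phi>)
  let ?d = "neumann g"
  have d: "?d n \<in> L2 {0..h}" for n by (rule neumann_L2[OF g])
  \<comment> \<open>The bound of \<open>neumann_bound\<close> at the right end \<open>t = h\<close>:
    independent of \<open>t\<close> and summable.\<close>
  define a where "a n = B * ((K * h) ^ n /\<^sub>R fact n)" for n
  have a: "a sums (B * exp (K * h))" unfolding a_def by (intro sums_mult exp_converges)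
  have bd: "AE t in ?M. \<forall>n. norm (?d n t) \<le> a n"
    unfolding AE_all_countable
  proof
    fix n
    show "AE t in ?M. norm (?d n t) \<le> a n"
      using neumann_bound[OF g B gB, of n] AE_space
    proof eventually_elim
      case (elim t)
      have "B * (K * t) ^ n / fact n \<le> B * (K * h) ^ n / fact n"
        using elim(2) B K_nonneg by (intro divide_right_mono mult_left_mono power_mono mult_nonneg_nonneg) auto
      then show ?case using elim(1) by (simp add: a_def divide_inverse mult_ac)
    qed
  qed
  define w where "w t = (\<Sum>n. ?d n t)" for t
  define S where "S m t = (\<Sum>n<m. ?d n t)" for m t
  have S: "S m \<in> L2 {0..h}" for m
  proof -
    have "(\<lambda>t. \<Sum>n<m. ?d n t) \<in> L2 {0..h}" by (rule L2_sum[where f = ?d]) (rule d)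
    also have "(\<lambda>t. \<Sum>n<m. ?d n t) = S m" by (rule ext) (simp add: S_def)
    finally show ?thesis .
  qed
  have summ: "summable (\<lambda>n. ?d n t)" if "\<forall>n. norm (?d n t) \<le> a n" for t
    using sums_summable[OF a] by (rule summable_comparison_test'[where N = 0]) (rule that[rule_format])
  have Sw: "(\<lambda>m. S m t) \<longlonglongrightarrow> w t" if "\<forall>n. norm (?d n t) \<le> a n" for t
    unfolding S_def w_def using summ[OF that] by (rule summable_LIMSEQ)
  have Sbd: "norm (S m t) \<le> B * exp (K * h)" if "\<forall>n. norm (?d n t) \<le> a n" for m t
  proof -
    have "norm (S m t) \<le> (\<Sum>n<m. a n)" unfolding S_def by (rule sum_norm_le) (rule that[rule_format])
    also have "\<dots> \<le> suminf a"
    proof (rule sum_le_suminf)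
      show "summable a" by (rule sums_summable[OF a])
      show "0 \<le> a n" for n using that[rule_format, of n] norm_ge_zero[of "?d n t"] by linarith
    qed simp
    finally show ?thesis using sums_unique[OF a] by simp
  qed
  have wm: "w \<in> borel_measurable ?M"
    unfolding w_def[abs_def] by (intro borel_measurable_suminf L2_measurable d)
  have wbd: "AE t in ?M. norm (w t) \<le> B * exp (K * h)"
    using bd
  proof eventually_elim
    case (elim t)
    show ?case
      by (rule LIMSEQ_le_const2[OF tendsto_norm[OF Sw[OF elim]]]) (use Sbd[OF elim] in blast)
  qed
  have w: "w \<in> L2 {0..h}" by (rule L2_bounded[OF wm wbd])
  have lim: "(\<lambda>m. L2norm {0..h} (\<lambda>t. w t - S m t)) \<longlonglongrightarrow> 0"
  proof (rule L2norm_dominated_convergence[where g = "\<lambda>_. B * exp (K * h)"])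
    show "AE t in ?M. (\<lambda>m. S m t) \<longlonglongrightarrow> w t" using bd by eventually_elim (rule Sw)
    show "AE t in ?M. norm (S m t) \<le> B * exp (K * h)" for m using bd by eventually_elim (rule Sbd)
  qed (use wm L2_measurable[OF S] in auto)
  have "AE t in ?M. w t = FV \<phi> w t"
    using bd AE_good AE_space
  proof eventually_elim
    case (elim t)
    then have t: "t \<in> {0..h}" and gd: "good t" by auto
    \<comment> \<open>A shifts a partial sum by one index and so loses the first term
      \<open>g\<close>; letting \<open>m\<close> grow gives the equation at
      \<open>t\<close>.\<close>
    have FS: "FN (S m) t = S (Suc m) t - g t" for m
    proof (induction m)
      case 0
      then show ?case by (simp add: S_def[abs_def] neumann_def)
    next
      case (Suc m)
      have "FN (S (Suc m)) t = FN (\<lambda>x. S m x + ?d m x) t" by (simp add: S_def[abs_def])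
      also have "\<dots> = FN (S m) t + FN (?d m) t" by (rule FN_add[OF t gd S d])
      also have "FN (?d m) t = ?d (Suc m) t" by (simp add: neumann_def)
      finally show ?case using Suc.IH by (simp add: S_def)
    qed
    have "(\<lambda>m. K * (sqrt h * L2norm {0..h} (\<lambda>t. w t - S m t))) \<longlonglongrightarrow> K * (sqrt h * 0)"
      by (intro tendsto_intros lim)
    then have z: "(\<lambda>m. K * (sqrt h * L2norm {0..h} (\<lambda>t. w t - S m t))) \<longlonglongrightarrow> 0" by simp
    have "(\<lambda>m. FN w t - FN (S m) t) \<longlonglongrightarrow> 0"
    proof (rule Lim_null_comparison[OF _ z], rule always_eventually, rule allI)
      fix m
      show "norm (FN w t - FN (S m) t) \<le> K * (sqrt h * L2norm {0..h} (\<lambda>t. w t - S m t))"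
        using FN_norm_le_L2[OF t gd L2_diff[OF w S]] by (simp add: FN_diff[OF t gd w S])
    qed
    then have "(\<lambda>m. FN w t - (FN w t - FN (S m) t)) \<longlonglongrightarrow> FN w t - 0" by (intro tendsto_intros)
    then have "(\<lambda>m. FN (S m) t) \<longlonglongrightarrow> FN w t" by simp
    moreover have "(\<lambda>m. FN (S m) t) \<longlonglongrightarrow> w t - g t"
      unfolding FS using Sw[OF elim(1)] by (intro tendsto_intros LIMSEQ_Suc)
    ultimately have "FN w t = w t - g t" by (rule LIMSEQ_unique)
    then show ?case using FV_split[OF t gd \<phi> w] by (simp add: g_def)
  qed
  with w show ?thesis by blast
qed

abbreviation "exact \<phi> \<equiv> exact_sol \<tau> s h C \<phi>"

lemma exact_solution:
  assumes "\<phi> \<in> L2 {-\<tau>..0}"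
  shows "exact \<phi> \<in> L2 {0..h}" "AE t in lebesgue_on {0..h}. exact \<phi> t = FV \<phi> (exact \<phi>) t"
  using someI_ex[OF exact_solution_exists[OF assms]] unfolding exact_sol_def by auto

lemma exact_solution_norm_le:
  assumes \<phi>: "\<phi> \<in> L2 {-\<tau>..0}"
  shows "L2norm {0..h} (exact \<phi>) \<le> stab * (K3 * L2norm {-\<tau>..0} \<phi>)"
proof -
  have "L2norm {0..h} (exact \<phi>) \<le> stab * L2norm {0..h} (FP \<phi>)"
  proof (rule Volterra_stability[OF exact_solution(1)[OF \<phi>] FP_L2[OF \<phi>]])
    show "AE t in lebesgue_on {0..h}. exact \<phi> t = FN (exact \<phi>) t + FP \<phi> t"
      using exact_solution(2)[OF \<phi>] AE_good AE_space
      by eventually_elim (use FV_split[OF _ _ \<phi> exact_solution(1)[OF \<phi>]] in \<open>simp add: add.commute\<close>)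
  qed
  also have "\<dots> \<le> stab * (K3 * L2norm {-\<tau>..0} \<phi>)"
    using stab_pos order_trans[OF L2norm_le_H1norm F_past_le[OF \<phi>]] by (intro mult_left_mono) auto
  finally show ?thesis .
qed

section \<open>Action of the past operator on Legendre residuals\<close>

definition row :: "real \<Rightarrow> 'd \<Rightarrow> real \<Rightarrow> real^'d" where
  "row t i \<sigma> = (if \<sigma> \<in> {t-\<tau>..t} then kern t \<sigma> $ i else 0)"

text \<open>Measures the effect of a Legendre residual at time \<open>t\<close> without reference to
  \<phi>; the sum over rows matches the bound of a vector norm by the sum of its
  coordinates.\<close>

definition tail :: "real \<Rightarrow> nat \<Rightarrow> real" where
  "tail t M = (\<Sum>i\<in>UNIV. L2norm {-\<tau>..0} (\<lambda>\<sigma>. row t i \<sigma> - legendre_proj (-\<tau>) 0 M (row t i) \<sigma>))"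

lemma row_L2:
  assumes g: "good t"
  shows "row t i \<in> L2 {-\<tau>..0}"
proof (rule L2_bounded)
  have "(\<lambda>\<sigma>. kern t \<sigma> $ i) \<in> borel_measurable (lebesgue_on {t-\<tau>..t})"
    by (rule measurable_compose[OF kern_good(1)[OF g]])
      (intro borel_measurable_continuous_onI continuous_intros)
  then have "row t i \<in> borel_measurable lebesgue"
    unfolding row_def[abs_def] by (intro borel_measurable_if_I) auto
  then show "row t i \<in> borel_measurable (lebesgue_on {-\<tau>..0})" by (rule measurable_restrict_space1)
  have "AE \<sigma> in lebesgue. \<sigma> \<in> {t-\<tau>..t} \<longrightarrow> norm (kern t \<sigma>) \<le> K"
    using kern_good(2)[OF g] by (simp add: AE_restrict_space_iff)
  then have "AE \<sigma> in lebesgue. \<sigma> \<in> {-\<tau>..0} \<longrightarrow> norm (row t i \<sigma>) \<le> K"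
  proof eventually_elim
    case (elim \<sigma>)
    then show ?case using K_nonneg Finite_Cartesian_Product.norm_nth_le[of "kern t \<sigma>" i] by (auto simp: row_def)
  qed
  then show "AE \<sigma> in lebesgue_on {-\<tau>..0}. norm (row t i \<sigma>) \<le> K"
    by (rule iffD2[OF AE_restrict_space_iff, rotated]) simp
qed

lemma tail_tendsto:
  assumes "good t" shows "(\<lambda>M. tail t M) \<longlonglongrightarrow> 0"
proof -
  have "(\<lambda>M. tail t M) \<longlonglongrightarrow> (\<Sum>i\<in>(UNIV::'d set). 0)"
    unfolding tail_def
  proof (rule tendsto_sum)
    show "(\<lambda>M. L2norm {-\<tau>..0} (\<lambda>\<sigma>. row t i \<sigma> - legendre_proj (-\<tau>) 0 M (row t i) \<sigma>)) \<longlonglongrightarrow> 0" for i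
      using tau_pos by (intro legendre_proj_tendsto row_L2 assms) simp
  qed
  then show ?thesis by simp
qed

text \<open>A coordinate of B at a fixed time is a linear functional on the past, and
  \<open>row\<close> represents it. The row is set to zero off the window
  \<open>{t-\<tau>..t}\<close>, so that the integral may run over the entire past interval.\<close>

lemma FP_component:
  assumes t: "t \<in> {0..h}" and g: "good t" and \<psi>: "\<psi> \<in> L2 {-\<tau>..0}"
  shows "FP \<psi> t $ i = (\<integral>\<sigma>. \<psi> \<sigma> \<bullet> row t i \<sigma> \<partial>(lebesgue_on {-\<tau>..0}))"
proof -
  have v: "V \<psi> (\<lambda>_. 0) \<in> L2 {-\<tau>..h}" using tau_pos h_pos \<psi> by (intro V_L2) auto
  have ax: "(A *v x) \<bullet> axis i 1 = x \<bullet> (A $ i)" for A :: "real^'d^'d" and x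
    by (simp add: inner_axis matrix_vector_mul_component inner_commute[of x])
  have "FP \<psi> t $ i = FP \<psi> t \<bullet> axis i 1" by (simp add: inner_axis)
  also have "\<dots> = (\<integral>\<sigma>. (kern t \<sigma> *v V \<psi> (\<lambda>_. 0) \<sigma>) \<bullet> axis i 1 \<partial>(lebesgue_on {t-\<tau>..t}))"
    unfolding F_eq_kern by (rule integral_inner_left[symmetric]) (rule kern_integrable[OF t g v])
  also have "\<dots> = (\<integral>\<sigma>. (if \<sigma> \<in> {t-\<tau>..t} then (kern t \<sigma> *v V \<psi> (\<lambda>_. 0) \<sigma>) \<bullet> axis i 1 else 0) \<partial>lebesgue)"
    by (rule Lebesgue_Measure.integral_restrict_UNIV[symmetric]) simp
  also have "\<dots> = (\<integral>\<sigma>. (if \<sigma> \<in> {-\<tau>..0} then \<psi> \<sigma> \<bullet> row t i \<sigma> else 0) \<partial>lebesgue)"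
    using t by (intro Bochner_Integration.integral_cong)
      (auto simp: ax V_def row_def)
  also have "\<dots> = (\<integral>\<sigma>. \<psi> \<sigma> \<bullet> row t i \<sigma> \<partial>(lebesgue_on {-\<tau>..0}))"
    by (rule Lebesgue_Measure.integral_restrict_UNIV) simp
  finally show ?thesis .
qed

abbreviation residual :: "nat \<Rightarrow> (real \<Rightarrow> real^'d) \<Rightarrow> real \<Rightarrow> real^'d" where
  "residual M \<phi> \<equiv> (\<lambda>\<sigma>. \<phi> \<sigma> - legendre_proj (-\<tau>) 0 M \<phi> \<sigma>)"

text \<open>The residual of \<phi> is orthogonal to the Legendre sum of the row, so the row may be
  replaced by its own residual before Cauchy-Schwarz. The quantity that must become small then no
  longer involves \<phi>.\<close>

lemma FP_residual_pointwise:
  assumes t: "t \<in> {0..h}" and g: "good t" and \<phi>: "\<phi> \<in> L2 {-\<tau>..0}"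
  shows "norm (FP (residual M \<phi>) t) \<le> tail t M * L2norm {-\<tau>..0} \<phi>"
proof -
  have tau: "-\<tau> < 0" using tau_pos by simp
  let ?r = "residual M \<phi>"
  have r: "?r \<in> L2 {-\<tau>..0}" by (intro L2_diff \<phi> legendre_sum_L2)
  have "\<bar>FP ?r t $ i\<bar> \<le> L2norm {-\<tau>..0} (residual M (row t i)) * L2norm {-\<tau>..0} \<phi>" for i
  proof -
    note k = row_L2[OF g, of i]
    have rk: "residual M (row t i) \<in> L2 {-\<tau>..0}" by (intro L2_diff k legendre_sum_L2)
    have "FP ?r t $ i = (\<integral>\<sigma>. ?r \<sigma> \<bullet> row t i \<sigma> \<partial>(lebesgue_on {-\<tau>..0}))" by (rule FP_component[OF t g r])
    also have "\<dots> = (\<integral>\<sigma>. ?r \<sigma> \<bullet> residual M (row t i) \<sigma> \<partial>(lebesgue_on {-\<tau>..0}))"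
      using legendre_proj_orthogonal[OF tau \<phi>, of M "legendre_coeff (-\<tau>) 0 (row t i)"]
        L2_inner_integrable[OF r k] L2_inner_integrable[OF r legendre_sum_L2]
      by (simp add: inner_diff_right)
    finally have "\<bar>FP ?r t $ i\<bar> \<le> L2norm {-\<tau>..0} ?r * L2norm {-\<tau>..0} (residual M (row t i))"
      using L2_Cauchy_Schwarz[OF r rk] by simp
    also have "\<dots> \<le> L2norm {-\<tau>..0} \<phi> * L2norm {-\<tau>..0} (residual M (row t i))"
      by (intro mult_right_mono legendre_proj_residual_le tau \<phi>) simp
    finally show ?thesis by (simp add: mult.commute)
  qed
  then have "(\<Sum>i\<in>UNIV. \<bar>FP ?r t $ i\<bar>) \<le> tail t M * L2norm {-\<tau>..0} \<phi>"
    unfolding tail_def sum_distrib_right by (intro sum_mono) auto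
  then show ?thesis using norm_le_l1_cart[of "FP ?r t"] by linarith
qed

text \<open>The set of good \<open>t\<close> at which the tail is small from index \<open>n\<close> on exhausts an interval up to a
  null set, so for some \<open>n\<close> it is not negligible and meets the set where \<open>FP (residual M \<phi>)\<close>
  agrees with its continuous representative, although the latter set depends on \<open>\<phi>\<close>.\<close>

lemma FP_residual_small_somewhere:
  assumes e: "0 < e" and cd: "0 \<le> c" "c < d" "d \<le> h"
  shows "\<exists>n. \<forall>M\<ge>n. \<forall>\<phi>\<in>L2 {-\<tau>..0}. \<exists>t\<in>{c..d}.
    norm (cont_rep 0 h (FP (residual M \<phi>)) t) \<le> e * L2norm {-\<tau>..0} \<phi>"
proof -
  define A where "A n = {t \<in> {c..d}. good t \<and> (\<forall>M\<ge>n. tail t M \<le> e)}" for n :: nat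
  have "\<exists>n. \<not> negligible (A n)"
  proof (rule ccontr)
    assume "\<not> (\<exists>n. \<not> negligible (A n))"
    then have "A n \<in> null_sets lebesgue" for n by (simp add: negligible_iff_null_sets)
    then have "(\<Union>n. A n) \<in> null_sets lebesgue" by blast
    then have "AE t in lebesgue. t \<notin> (\<Union>n. A n)" by (rule AE_not_in)
    then have "AE t in lebesgue. t \<in> {0..h} \<longrightarrow> t \<notin> (\<Union>n. A n)" by eventually_elim simp
    then have "AE t in lebesgue_on {0..h}. t \<notin> (\<Union>n. A n)"
      by (rule iffD2[OF AE_restrict_space_iff, rotated]) simp
    then have "AE t in lebesgue_on {0..h}. good t \<and> t \<notin> (\<Union>n. A n)"
      using AE_good by eventually_elim blast
    from AE_lebesgue_on_interval_witness[OF this cd]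
    obtain t where t: "t \<in> {c..d}" "good t" "t \<notin> (\<Union>n. A n)" by blast
    have "\<forall>\<^sub>F M in sequentially. tail t M < e" using tail_tendsto[OF t(2)] e by (rule order_tendstoD)
    then obtain n where "\<forall>M\<ge>n. tail t M < e" by (auto simp: eventually_sequentially)
    then have "t \<in> A n" using t by (auto simp: A_def intro: less_imp_le)
    then show False using t by blast
  qed
  then obtain n where n: "\<not> negligible (A n)" by blast
  show ?thesis
  proof (intro exI[of _ n] allI impI ballI)
    fix M and \<phi> :: "real \<Rightarrow> real^'d" assume M: "n \<le> M" and \<phi>: "\<phi> \<in> L2 {-\<tau>..0}"
    let ?f = "FP (residual M \<phi>)"
    have r: "residual M \<phi> \<in> L2 {-\<tau>..0}" by (intro L2_diff \<phi> legendre_sum_L2)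
    have "AE t in lebesgue. t \<in> {0..h} \<longrightarrow> cont_rep 0 h ?f t = ?f t"
      using H1_Holder(2)[OF h_pos F_past_H1[OF r]] by (simp add: AE_restrict_space_iff)
    then obtain N where N: "negligible N" "{t. \<not> (t \<in> {0..h} \<longrightarrow> cont_rep 0 h ?f t = ?f t)} \<subseteq> N"
      by (auto simp: eventually_ae_filter negligible_iff_null_sets)
    have "\<not> A n \<subseteq> N" using n N(1) negligible_subset by blast
    then obtain t where t: "t \<in> A n" "t \<notin> N" by blast
    then have th: "t \<in> {0..h}" using cd by (auto simp: A_def)
    have "cont_rep 0 h ?f t = ?f t" using t(2) N(2) th by blast
    moreover have "norm (?f t) \<le> tail t M * L2norm {-\<tau>..0} \<phi>"
      using t by (intro FP_residual_pointwise[OF th _ \<phi>]) (simp add: A_def)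
    moreover have "tail t M * L2norm {-\<tau>..0} \<phi> \<le> e * L2norm {-\<tau>..0} \<phi>"
      using t M by (intro mult_right_mono) (auto simp: A_def)
    ultimately show "\<exists>t\<in>{c..d}. norm (cont_rep 0 h ?f t) \<le> e * L2norm {-\<tau>..0} \<phi>"
      using t(1) by (intro bexI[of _ t]) (auto simp: A_def)
  qed
qed

text \<open>The interval is cut into \<open>m\<close> cells so short that the representative varies
  by at most \<open>\<epsilon> * L2norm {-\<tau>..0} \<phi>\<close> on each. One small value per
  cell then bounds the supremum, and with finitely many cells the largest of the thresholds
  \<open>n j\<close> serves all of them.\<close>

lemma FP_residual_small:
  assumes e: "0 < e"
  shows "\<exists>n. \<forall>M\<ge>n. \<forall>\<phi>\<in>L2 {-\<tau>..0}. L2norm {0..h} (FP (residual M \<phi>)) \<le> e * L2norm {-\<tau>..0} \<phi>"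
proof -
  \<comment> \<open>A supremum bound with constant \<open>2 * \<epsilon>\<close> becomes a norm
    bound with constant \<open>e\<close> after the factor \<open>sqrt h\<close>.\<close>
  define \<epsilon> where "\<epsilon> = e / (2 * sqrt h)"
  have \<epsilon>: "0 < \<epsilon>" "sqrt h * (2 * \<epsilon>) = e" using e h_pos by (auto simp: \<epsilon>_def)
  \<comment> \<open>Solves \<open>K3 * sqrt (h / m) \<le> \<epsilon>\<close> for the number of
    cells.\<close>
  obtain m0 where m0: "h * (K3 / \<epsilon>)\<^sup>2 \<le> real m0" using real_arch_simple by blast
  define m where "m = Suc m0"
  have m: "0 < m" by (simp add: m_def)
  have step: "K3 * sqrt (h / real m) \<le> \<epsilon>"
  proof -
    have "h * (K3 / \<epsilon>)\<^sup>2 \<le> real m" using m0 by (simp add: m_def)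
    then have "(h / real m) * K3\<^sup>2 \<le> \<epsilon>\<^sup>2"
      using m \<epsilon>(1) by (simp add: power_divide field_simps)
    then have "sqrt ((h / real m) * K3\<^sup>2) \<le> sqrt (\<epsilon>\<^sup>2)" by (rule real_sqrt_le_mono)
    moreover have "sqrt ((h / real m) * K3\<^sup>2) = K3 * sqrt (h / real m)"
      using K3_nonneg unfolding real_sqrt_mult[of "h / real m"] by simp
    ultimately show ?thesis using \<epsilon>(1) by simp
  qed
  define cell where "cell j = {real j * (h / real m)..real (Suc j) * (h / real m)}" for j
  have "\<forall>j. \<exists>n. j < m \<longrightarrow> (\<forall>M\<ge>n. \<forall>\<phi>\<in>L2 {-\<tau>..0}. \<exists>t\<in>cell j.
      norm (cont_rep 0 h (FP (residual M \<phi>)) t) \<le> \<epsilon> * L2norm {-\<tau>..0} \<phi>)"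
  proof (intro allI)
    fix j
    have "\<exists>n. \<forall>M\<ge>n. \<forall>\<phi>\<in>L2 {-\<tau>..0}. \<exists>t\<in>cell j.
      norm (cont_rep 0 h (FP (residual M \<phi>)) t) \<le> \<epsilon> * L2norm {-\<tau>..0} \<phi>" if j: "j < m"
      unfolding cell_def
    proof (rule FP_residual_small_somewhere[OF \<epsilon>(1)])
      show "0 \<le> real j * (h / real m)" using h_pos by simp
      show "real j * (h / real m) < real (Suc j) * (h / real m)" using h_pos m by (intro mult_strict_right_mono) auto
      have "real (Suc j) * (h / real m) \<le> real m * (h / real m)" using j h_pos by (intro mult_right_mono) auto
      then show "real (Suc j) * (h / real m) \<le> h" using m by simp
    qed
    then show "\<exists>n. j < m \<longrightarrow> (\<forall>M\<ge>n. \<forall>\<phi>\<in>L2 {-\<tau>..0}. \<exists>t\<in>cell j.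
      norm (cont_rep 0 h (FP (residual M \<phi>)) t) \<le> \<epsilon> * L2norm {-\<tau>..0} \<phi>)" by blast
  qed
  then obtain n where n: "\<And>j M \<phi>. j < m \<Longrightarrow> n j \<le> M \<Longrightarrow> \<phi> \<in> L2 {-\<tau>..0} \<Longrightarrow> \<exists>t\<in>cell j.
      norm (cont_rep 0 h (FP (residual M \<phi>)) t) \<le> \<epsilon> * L2norm {-\<tau>..0} \<phi>"
    unfolding choice_iff by blast
  have cells: "\<exists>j<m. t \<in> cell j" if t: "t \<in> {0..h}" for t
  proof (cases "t = h")
    \<comment> \<open>The right end is put into the last cell by hand, as rounding
      \<open>t / (h / m)\<close> down would give the index \<open>m\<close>.\<close>
    case True
    have "real m0 * (h / real m) \<le> real m * (h / real m)" using h_pos by (intro mult_right_mono) (auto simp: m_def)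
    then show ?thesis using True m by (intro exI[of _ m0]) (auto simp: cell_def m_def)
  next
    case False
    define x where "x = t / (h / real m)"
    have x: "0 \<le> x" "x < real m" "t = x * (h / real m)"
      using t False h_pos m by (auto simp: x_def field_simps)
    have "real (nat \<lfloor>x\<rfloor>) \<le> x" "x \<le> real (Suc (nat \<lfloor>x\<rfloor>))" "nat \<lfloor>x\<rfloor> < m" using x by linarith+
    moreover from this have "real (nat \<lfloor>x\<rfloor>) * (h / real m) \<le> t" "t \<le> real (Suc (nat \<lfloor>x\<rfloor>)) * (h / real m)"
      unfolding x(3) using h_pos by (intro mult_right_mono; simp)+
    ultimately show ?thesis by (intro exI[of _ "nat \<lfloor>x\<rfloor>"]) (auto simp: cell_def)
  qed
  have "L2norm {0..h} (FP (residual M \<phi>)) \<le> e * L2norm {-\<tau>..0} \<phi>"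
    if M: "Max (n ` {..<m}) \<le> M" and \<phi>: "\<phi> \<in> L2 {-\<tau>..0}" for M \<phi>
  proof -
    let ?f = "FP (residual M \<phi>)" and ?u = "cont_rep 0 h (FP (residual M \<phi>))" and ?B = "L2norm {-\<tau>..0} \<phi>"
    have r: "residual M \<phi> \<in> L2 {-\<tau>..0}" by (intro L2_diff \<phi> legendre_sum_L2)
    note u = H1_Holder[OF h_pos F_past_H1[OF r]]
    \<comment> \<open>A residual is no larger than \<phi>, so the Hoelder constant is uniform in
      \<open>M\<close>.\<close>
    have "H1norm 0 h ?f \<le> K3 * L2norm {-\<tau>..0} (residual M \<phi>)" by (rule F_past_le[OF r])
    also have "\<dots> \<le> K3 * ?B"
      using tau_pos by (intro mult_left_mono legendre_proj_residual_le \<phi> K3_nonneg) simp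
    finally have H: "H1norm 0 h ?f \<le> K3 * ?B" .
    have bd: "norm (?u t) \<le> 2 * \<epsilon> * ?B" if t: "t \<in> {0..h}" for t
    proof -
      obtain j where j: "j < m" "t \<in> cell j" using cells[OF t] by blast
      have "n j \<le> Max (n ` {..<m})" using j by (intro Max_ge) auto
      then have "n j \<le> M" using M by simp
      then obtain r where r: "r \<in> cell j" "norm (?u r) \<le> \<epsilon> * ?B" using n[OF j(1) _ \<phi>] by blast
      have "real (Suc j) * (h / real m) \<le> real m * (h / real m)" using j(1) h_pos by (intro mult_right_mono) auto
      then have top: "real (Suc j) * (h / real m) \<le> h" using m by simp
      have bot: "0 \<le> real j * (h / real m)" using h_pos by simp
      have r0: "r \<in> {0..h}" using r(1) top bot unfolding cell_def atLeastAtMost_iff by linarith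
      have "real (Suc j) * (h / real m) = real j * (h / real m) + h / real m"
        by (simp only: of_nat_Suc distrib_right mult_1_left add.commute)
      then have "\<bar>t - r\<bar> \<le> h / real m"
        using r(1) j(2) unfolding cell_def atLeastAtMost_iff by linarith
      then have "norm (?u t - ?u r) \<le> (K3 * ?B) * sqrt (h / real m)"
        using u(3)[OF r0 t] H by (intro order_trans[OF u(3)[OF r0 t]] mult_mono)
          (auto intro!: mult_nonneg_nonneg K3_nonneg)
      also have "\<dots> = (K3 * sqrt (h / real m)) * ?B" by simp
      also have "\<dots> \<le> \<epsilon> * ?B" using step by (intro mult_right_mono) auto
      finally show ?thesis using r(2) norm_triangle_sub[of "?u t" "?u r"] by linarith
    qed
    have "L2norm {0..h} ?f = L2norm {0..h} ?u"
      using L2_measurable[OF FP_L2[OF r]] continuous_lebesgue_on_measurable[OF u(1)] u(2)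
      by (intro L2norm_cong_AE) auto
    also have "\<dots> \<le> sqrt (h - 0) * (2 * \<epsilon> * ?B)"
      using h_pos \<epsilon> bd by (intro L2norm_sup_bound u(1)) auto
    also have "\<dots> = sqrt h * (2 * \<epsilon>) * ?B" by simp
    finally show ?thesis unfolding \<epsilon>(2) .
  qed
  then show ?thesis by blast
qed

end

subsection \<open>The collocation equation\<close>

text \<open>Injectivity sends a basis of the span to an independent set of the same size; a vector
  of the span outside the image would enlarge that set beyond the dimension.\<close>

lemma (in vector_space) linear_inj_on_span_surj:
  assumes B: "finite B" and f: "Vector_Spaces.linear scale scale f"
    and into: "f ` span B \<subseteq> span B" and inj: "inj_on f (span B)"
  shows "f ` span B = span B"
proof
  interpret f: Vector_Spaces.linear scale scale f by (rule f)
  obtain D where D: "D \<subseteq> B" "independent D" "B \<subseteq> span D"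
    using maximal_independent_subset[of B] by blast
  have fin: "finite D" using D(1) B by (rule finite_subset)
  have sp: "span D = span B" using D by (metis span_mono span_minimal subspace_span subset_antisym)
  have ind: "independent (f ` D)"
    using D(2) inj by (intro f.independent_injective_image) (simp_all add: sp)
  have card: "card (f ` D) = card D"
    using inj span_superset[of D] by (intro card_image) (auto simp: sp intro: inj_on_subset)
  have img: "f ` D \<subseteq> span D" using into span_superset[of D] by (auto simp: sp)
  show "span B \<subseteq> f ` span B"
  proof
    fix y assume y: "y \<in> span B"
    have "y \<in> span (f ` D)"
    proof (rule ccontr)
      assume ny: "y \<notin> span (f ` D)"
      then have "y \<notin> f ` D" using span_superset by blast
      have "independent (insert y (f ` D))" using ind ny by (simp add: independent_insert)
      moreover have "insert y (f ` D) \<subseteq> span D" using img y by (simp add: sp)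
      ultimately have "card (insert y (f ` D)) \<le> card D" using independent_span_bound[OF fin] by blast
      then show False using \<open>y \<notin> f ` D\<close> fin card by simp
    qed
    then show "y \<in> f ` span B" by (simp add: f.span_image sp)
  qed
qed (rule into)

text \<open>Nodal values are functions on all of \<open>nat\<close>, an infinite-dimensional space;
  the dimension count takes place in the subspace of functions supported on
  \<open>{1..N}\<close>.\<close>

interpretation fun_vs: vector_space "\<lambda>c (f :: nat \<Rightarrow> real^'d) i. c *\<^sub>R f i"
  by unfold_locales (auto simp: fun_eq_iff scaleR_add_right scaleR_add_left)

lemma finitely_supported_span:
  fixes N :: nat
  shows "fun_vs.span ((\<lambda>(k, j) i. if i = k then axis j 1 else 0) ` ({1..N} \<times> UNIV)) =
    {W :: nat \<Rightarrow> real^'d. \<forall>i. i \<notin> {1..N} \<longrightarrow> W i = 0}" (is "fun_vs.span ?B = ?U")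
proof
  have "fun_vs.subspace ?U" by (auto simp: fun_vs.subspace_def)
  then show "fun_vs.span ?B \<subseteq> ?U" by (intro fun_vs.span_minimal) auto
  show "?U \<subseteq> fun_vs.span ?B"
  proof
    fix W :: "nat \<Rightarrow> real^'d" assume W: "W \<in> ?U"
    define E where "E k j = (\<lambda>i. if i = k then axis j 1 else (0 :: real^'d))" for k :: nat and j
    have "(\<Sum>k\<in>{1..N}. \<Sum>j\<in>UNIV. (\<lambda>i. (W k $ j) *\<^sub>R E k j i)) \<in> fun_vs.span ?B"
    proof (intro fun_vs.span_sum)
      fix k j assume "k \<in> {1..N}"
      then have "E k j \<in> fun_vs.span ?B" by (intro fun_vs.span_base) (force simp: E_def)
      then show "(\<lambda>i. (W k $ j) *\<^sub>R E k j i) \<in> fun_vs.span ?B" by (rule fun_vs.span_scale)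
    qed
    also have "(\<Sum>k\<in>{1..N}. \<Sum>j\<in>UNIV. (\<lambda>i. (W k $ j) *\<^sub>R E k j i)) = W"
    proof
      fix i
      have sf: "(\<Sum>x\<in>A. f x) i = (\<Sum>x\<in>A. f x i)" for A and f :: "'b \<Rightarrow> nat \<Rightarrow> real^'d"
        by (induction A rule: infinite_finite_induct) auto
      have "(\<Sum>k\<in>{1..N}. \<Sum>j\<in>UNIV. (\<lambda>i. (W k $ j) *\<^sub>R E k j i)) i =
          (\<Sum>k\<in>{1..N}. if k = i then \<Sum>j\<in>UNIV. (W i $ j) *\<^sub>R axis j 1 else 0)"
        unfolding sf by (intro sum.cong) (auto simp: E_def)
      also have "(\<Sum>j\<in>UNIV. (W i $ j) *\<^sub>R axis j 1) = W i"
        by (simp add: vec_eq_iff axis_def if_distrib cong: if_cong)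
      finally show "(\<Sum>k\<in>{1..N}. \<Sum>j\<in>UNIV. (\<lambda>i. (W k $ j) *\<^sub>R E k j i)) i = W i"
        using W by auto
    qed
    finally show "W \<in> fun_vs.span ?B" .
  qed
qed

text \<open>A square linear system with trivial kernel is solvable. Functions are extended by 0 off
  \<open>{1..N}\<close> here, because the extensional ones, with value \<open>undefined\<close>
  there, need not be closed under addition.\<close>

lemma finitely_supported_linear_surj:
  fixes L :: "(nat \<Rightarrow> real^'d) \<Rightarrow> nat \<Rightarrow> real^'d" and G :: "nat \<Rightarrow> real^'d"
  assumes add: "\<And>W W' i. L (\<lambda>i. W i + W' i) i = L W i + L W' i"
    and scale: "\<And>c W i. L (\<lambda>i. c *\<^sub>R W i) i = c *\<^sub>R L W i"
    and supp: "\<And>W i. i \<notin> {1..N} \<Longrightarrow> L W i = 0"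
    and inj: "\<And>W. (\<And>i. L W i = 0) \<Longrightarrow> (\<And>i. i \<notin> {1..N} \<Longrightarrow> W i = 0) \<Longrightarrow> W = (\<lambda>_. 0)"
  shows "\<exists>W. \<forall>i\<in>{1..N}. L W i = G i"
proof -
  let ?U = "{W :: nat \<Rightarrow> real^'d. \<forall>i. i \<notin> {1..N} \<longrightarrow> W i = 0}"
  let ?B = "(\<lambda>(k, j) i. if i = k then axis j 1 else 0) ` ({1..N} \<times> UNIV) :: (nat \<Rightarrow> real^'d) set"
  have plus: "(\<lambda>i. W i + W' i) = W + W'" for W W' :: "nat \<Rightarrow> real^'d" by (simp add: fun_eq_iff)
  have lin: "Vector_Spaces.linear (\<lambda>c (f :: nat \<Rightarrow> real^'d) i. c *\<^sub>R f i) (\<lambda>c f i. c *\<^sub>R f i) L"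
  proof unfold_locales
    show "L (W + W') = L W + L W'" for W W' using add[of W W'] by (simp add: plus fun_eq_iff)
    show "L (\<lambda>i. c *\<^sub>R W i) = (\<lambda>i. c *\<^sub>R L W i)" for c W using scale[of c W] by (simp add: fun_eq_iff)
  qed
  have "L ` fun_vs.span ?B = fun_vs.span ?B"
  proof (rule fun_vs.linear_inj_on_span_surj[OF _ lin])
    show "finite ?B" by simp
    show "L ` fun_vs.span ?B \<subseteq> fun_vs.span ?B" unfolding finitely_supported_span using supp by auto
    show "inj_on L (fun_vs.span ?B)" unfolding finitely_supported_span
    proof (rule inj_onI)
      fix W W' assume W: "W \<in> ?U" "W' \<in> ?U" "L W = L W'"
      have "(\<lambda>i. W i + (-1) *\<^sub>R W' i) = (\<lambda>_. 0)"
      proof (rule inj)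
        show "L (\<lambda>i. W i + (-1) *\<^sub>R W' i) i = 0" for i using W(3) by (simp only: add scale) simp
        show "W i + (-1) *\<^sub>R W' i = 0" if "i \<notin> {1..N}" for i using W that by simp
      qed
      then show "W = W'" by (simp add: fun_eq_iff)
    qed
  qed
  then have "L ` ?U = ?U" by (simp only: finitely_supported_span)
  moreover have "(\<lambda>i. if i \<in> {1..N} then G i else 0) \<in> ?U" by auto
  ultimately have "(\<lambda>i. if i \<in> {1..N} then G i else 0) \<in> L ` ?U" by (simp only:)
  then obtain W where W: "(\<lambda>i. if i \<in> {1..N} then G i else 0) = L W" by (elim imageE)
  show ?thesis
  proof (intro exI[of _ W] ballI)
    fix i assume "i \<in> {1..N}"
    then show "L W i = G i" using fun_cong[OF W, of i] by simp
  qed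
qed

text \<open>The threshold \<open>N0\<close> precedes \<open>f\<close>, since only a Hoelder
  constant, namely \<open>H1norm 0 h f\<close>, enters the error of polynomial
  approximation.\<close>

lemma H1_interpolation_error:
  assumes h: "0 < h" and \<delta>: "0 < \<delta>"
  shows "\<exists>N0\<ge>1. \<forall>N\<ge>N0. \<forall>f :: real \<Rightarrow> real^'d. f \<in> H1 0 h \<longrightarrow>
    L2norm {0..h} (\<lambda>t. cont_rep 0 h f t - Pplus h N (\<lambda>i. cont_rep 0 h f (node h N i)) t) \<le> \<delta> * H1norm 0 h f"
proof -
  \<comment> \<open>Cancels the factor \<open>2 * sqrt h\<close> of
    \<open>interpolation_error\<close>.\<close>
  define \<epsilon> where "\<epsilon> = \<delta> / (2 * sqrt h)"
  have \<epsilon>: "0 < \<epsilon>" "2 * sqrt h * \<epsilon> = \<delta>" using h \<delta> by (auto simp: \<epsilon>_def)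
  obtain N0 where N0: "\<And>n (u :: real \<Rightarrow> real^'d) k. N0 \<le> n \<Longrightarrow> 0 \<le> k \<Longrightarrow>
      (\<forall>t\<in>{0..h}. \<forall>r\<in>{0..h}. norm (u t - u r) \<le> k * sqrt \<bar>t - r\<bar>) \<Longrightarrow>
      \<exists>p. vec_poly n p \<and> (\<forall>t\<in>{0..h}. norm (u t - p t) \<le> k * \<epsilon>)"
    using Holder_half_poly_approx[OF h \<epsilon>(1), where 'd = 'd] by blast
  show ?thesis
  \<comment> \<open>Off by one: \<open>N\<close> nodes reproduce degree \<open>N - 1\<close>, and it
    is this degree that must reach \<open>N0\<close>.\<close>
  proof (intro exI[of _ "Suc N0"] conjI allI impI)
    fix N and f :: "real \<Rightarrow> real^'d" assume N: "Suc N0 \<le> N" and f: "f \<in> H1 0 h"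
    note H = H1_Holder[OF h f]
    have k: "0 \<le> H1norm 0 h f" by (simp add: H1norm_def)
    obtain p where p: "vec_poly (N - 1) p" "\<forall>t\<in>{0..h}. norm (cont_rep 0 h f t - p t) \<le> H1norm 0 h f * \<epsilon>"
    proof (atomize_elim, rule N0[OF _ k])
      show "N0 \<le> N - 1" using N by simp
    qed (use H(3) in blast)
    have "L2norm {0..h} (\<lambda>t. cont_rep 0 h f t - Pplus h N (\<lambda>i. cont_rep 0 h f (node h N i)) t) \<le>
        2 * sqrt h * (H1norm 0 h f * \<epsilon>)"
      using N k \<epsilon> p(2) by (intro interpolation_error[OF h _ H(1) p(1)]) auto
    also have "\<dots> = \<delta> * H1norm 0 h f" using \<epsilon>(2) by (metis mult.assoc mult.commute)
    finally show "L2norm {0..h} (\<lambda>t. cont_rep 0 h f t - Pplus h N (\<lambda>i. cont_rep 0 h f (node h N i)) t) \<le>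
      \<delta> * H1norm 0 h f" .
  qed simp
qed

text \<open>\<open>delta_small\<close> allows terms containing the unknown to be absorbed: the
  interpolation error of A, amplified by \<open>stab\<close>, has factor at most 1/2.\<close>

locale renewal_discrete = renewal C \<tau> s h K K2 K3
  for C :: "real \<Rightarrow> real \<Rightarrow> real^'d^'d" and \<tau> s h K K2 K3 :: real +
  fixes N :: nat and \<delta> :: real
  assumes N_pos: "1 \<le> N" and delta_nonneg: "0 \<le> \<delta>" and delta_small: "stab * \<delta> * K2 \<le> 1 / 2"
    and interp: "(f :: real \<Rightarrow> real^'d) \<in> H1 0 h \<Longrightarrow>
      L2norm {0..h} (\<lambda>t. cont_rep 0 h f t - Pplus h N (\<lambda>i. cont_rep 0 h f (node h N i)) t) \<le> \<delta> * H1norm 0 h f"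
begin

abbreviation cr where "cr f \<equiv> cont_rep 0 h f"
abbreviation interpolant where "interpolant u \<equiv> Pplus h N (\<lambda>i. u (node h N i))"

lemma node_in: "i \<in> {1..N} \<Longrightarrow> node h N i \<in> {0..h}"
  using node_inside[OF h_pos N_pos, of i] by auto

lemma Pplus_L2: "Pplus h N W \<in> L2 {0..h}"
  by (rule vec_poly_L2[OF Pplus_vec_poly[OF h_pos N_pos]])

lemma cr_FN:
  assumes "w \<in> L2 {0..h}"
  shows "continuous_on {0..h} (cr (FN w))" "AE t in lebesgue_on {0..h}. cr (FN w) t = FN w t"
  using H1_Holder[OF h_pos F_future_H1[OF assms]] by auto

lemma cr_FP:
  assumes "\<phi> \<in> L2 {-\<tau>..0}"
  shows "continuous_on {0..h} (cr (FP \<phi>))" "AE t in lebesgue_on {0..h}. cr (FP \<phi>) t = FP \<phi> t"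
  using H1_Holder[OF h_pos F_past_H1[OF assms]] by auto

text \<open>\<open>FV_split\<close> holds at good times, and a node need not be one. Passing to
  continuous representatives upgrades the identity from almost every time to every time.\<close>

lemma cr_FV:
  assumes \<phi>: "\<phi> \<in> L2 {-\<tau>..0}" and w: "w \<in> L2 {0..h}" and t: "t \<in> {0..h}"
  shows "cr (FV \<phi> w) t = cr (FP \<phi>) t + cr (FN w) t"
proof (rule cont_rep_eq(3)[where u = "\<lambda>t. cr (FP \<phi>) t + cr (FN w) t", OF h_pos _ _ t])
  show "AE t in lebesgue_on {0..h}. cr (FP \<phi>) t + cr (FN w) t = FV \<phi> w t"
    using AE_good AE_space cr_FN(2)[OF w] cr_FP(2)[OF \<phi>]
    by eventually_elim (simp add: FV_split[OF _ _ \<phi> w])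
qed (rule continuous_on_add[OF cr_FP(1)[OF \<phi>] cr_FN(1)[OF w]])

lemma cr_FN_add:
  assumes u: "u \<in> L2 {0..h}" and w: "w \<in> L2 {0..h}" and t: "t \<in> {0..h}"
  shows "cr (FN (\<lambda>x. u x + w x)) t = cr (FN u) t + cr (FN w) t"
proof (rule cont_rep_eq(3)[where u = "\<lambda>t. cr (FN u) t + cr (FN w) t", OF h_pos _ _ t])
  show "AE t in lebesgue_on {0..h}. cr (FN u) t + cr (FN w) t = FN (\<lambda>x. u x + w x) t"
    using AE_good AE_space cr_FN(2)[OF u] cr_FN(2)[OF w]
    by eventually_elim (simp add: FN_add[OF _ _ u w])
qed (rule continuous_on_add[OF cr_FN(1)[OF u] cr_FN(1)[OF w]])

lemma cr_FN_scaleR: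
  assumes w: "w \<in> L2 {0..h}" and t: "t \<in> {0..h}"
  shows "cr (FN (\<lambda>x. c *\<^sub>R w x)) t = c *\<^sub>R cr (FN w) t"
proof (rule cont_rep_eq(3)[where u = "\<lambda>t. c *\<^sub>R cr (FN w) t", OF h_pos _ _ t])
  show "AE t in lebesgue_on {0..h}. c *\<^sub>R cr (FN w) t = FN (\<lambda>x. c *\<^sub>R w x) t"
    using AE_good AE_space cr_FN(2)[OF w]
    by eventually_elim (simp add: FN_scaleR)
qed (rule continuous_on_scaleR[OF continuous_on_const cr_FN(1)[OF w]])

lemma interp_FN:
  assumes "w \<in> L2 {0..h}"
  shows "L2norm {0..h} (\<lambda>t. interpolant (cr (FN w)) t - cr (FN w) t) \<le> \<delta> * (K2 * L2norm {0..h} w)"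
  using interp[OF F_future_H1[OF assms]] mult_left_mono[OF F_future_le[OF assms] delta_nonneg]
  by (subst L2norm_commute) linarith

lemma interp_FP:
  assumes "\<phi> \<in> L2 {-\<tau>..0}"
  shows "L2norm {0..h} (\<lambda>t. interpolant (cr (FP \<phi>)) t - cr (FP \<phi>) t) \<le> \<delta> * (K3 * L2norm {-\<tau>..0} \<phi>)"
  using interp[OF F_past_H1[OF assms]] mult_left_mono[OF F_past_le[OF assms] delta_nonneg]
  by (subst L2norm_commute) linarith

text \<open>The polynomial \<open>w\<close> with these nodal values satisfies
  \<open>w = A w + (I - 1) A w\<close>. Stability and the interpolation error bound its norm by half
  of itself.\<close>

lemma discrete_homogeneous_zero:
  assumes W: "\<And>i. i \<in> {1..N} \<Longrightarrow> W i = cr (FN (Pplus h N W)) (node h N i)" and i: "i \<in> {1..N}"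
  shows "W i = 0"
proof -
  let ?w = "Pplus h N W"
  let ?r = "\<lambda>t. interpolant (cr (FN ?w)) t - cr (FN ?w) t"
  have w: "?w \<in> L2 {0..h}" by (rule Pplus_L2)
  have eq: "interpolant (cr (FN ?w)) = ?w"
    by (rule Pplus_cong[OF h_pos N_pos]) (rule W[symmetric])
  have "L2norm {0..h} ?w \<le> stab * L2norm {0..h} ?r"
  proof (rule Volterra_stability[OF w])
    show "?r \<in> L2 {0..h}" by (intro L2_diff Pplus_L2 L2_continuous cr_FN(1) w)
    show "AE t in lebesgue_on {0..h}. ?w t = FN ?w t + ?r t"
      using cr_FN(2)[OF w] by eventually_elim (simp add: eq)
  qed
  also have "\<dots> \<le> stab * (\<delta> * (K2 * L2norm {0..h} ?w))"
    using stab_pos by (intro mult_left_mono interp_FN w) simp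
  also have "\<dots> = (stab * \<delta> * K2) * L2norm {0..h} ?w" by simp
  also have "\<dots> \<le> (1 / 2) * L2norm {0..h} ?w" by (intro mult_right_mono delta_small) simp
  finally have "L2norm {0..h} ?w = 0" using L2norm_nonneg[of "{0..h}" ?w] by linarith
  then have ae: "AE t in lebesgue_on {0..h}. ?w t = 0" by (rule L2norm_zero_imp_AE[OF w])
  have "?w (node h N i) = 0"
    by (rule continuous_AE_eq_imp_eq[OF vec_poly_continuous[OF Pplus_vec_poly[OF h_pos N_pos]]
          continuous_on_const h_pos ae node_in[OF i]])
  then show ?thesis using Pplus_node[OF h_pos N_pos i, of W] by simp
qed

text \<open>In finite dimension the trivial kernel just found makes the nodal form of
  \<open>1 - A\<close> surjective; the nodal values of \<open>FP \<phi>\<close> are the right-hand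
  side.\<close>

lemma discrete_solution_exists:
  assumes \<phi>: "\<phi> \<in> L2 {-\<tau>..0}"
  shows "\<exists>W. \<forall>i\<in>{1..N}. W i = cr (FV \<phi> (Pplus h N W)) (node h N i)"
proof -
  define L where "L W i = (if i \<in> {1..N} then W i - cr (FN (Pplus h N W)) (node h N i) else 0)" for W i
  have "\<exists>W. \<forall>i\<in>{1..N}. L W i = cr (FP \<phi>) (node h N i)"
  proof (rule finitely_supported_linear_surj)
    show "L (\<lambda>i. W i + W' i) i = L W i + L W' i" for W W' i
    proof (cases "i \<in> {1..N}")
      case True
      have "Pplus h N (\<lambda>i. W i + W' i) = (\<lambda>t. Pplus h N W t + Pplus h N W' t)"
        by (rule ext) (rule Pplus_add[OF h_pos N_pos])
      then show ?thesis using True cr_FN_add[OF Pplus_L2 Pplus_L2 node_in[OF True]] by (simp add: L_def)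
    qed (simp only: L_def if_False add_0_right)
    show "L (\<lambda>i. c *\<^sub>R W i) i = c *\<^sub>R L W i" for c W i
    proof (cases "i \<in> {1..N}")
      case True
      have "Pplus h N (\<lambda>i. c *\<^sub>R W i) = (\<lambda>t. c *\<^sub>R Pplus h N W t)"
        by (rule ext) (rule Pplus_scaleR[OF h_pos N_pos])
      then show ?thesis using True cr_FN_scaleR[OF Pplus_L2 node_in[OF True]] by (simp add: L_def scaleR_diff_right)
    qed (simp only: L_def if_False scaleR_zero_right)
    show "L W i = 0" if "i \<notin> {1..N}" for W i using that by (simp only: L_def if_False)
    show "W = (\<lambda>_. 0)" if W: "\<And>i. L W i = 0" "\<And>i. i \<notin> {1..N} \<Longrightarrow> W i = 0" for W
    proof
      fix i
      have "W j = cr (FN (Pplus h N W)) (node h N j)" if "j \<in> {1..N}" for j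
        using W(1)[of j] that by (simp add: L_def)
      then show "W i = 0" using W(2) discrete_homogeneous_zero by (cases "i \<in> {1..N}") blast+
    qed
  qed
  then obtain W where W: "\<forall>i\<in>{1..N}. L W i = cr (FP \<phi>) (node h N i)" by blast
  have "W i = cr (FV \<phi> (Pplus h N W)) (node h N i)" if i: "i \<in> {1..N}" for i
    using W[rule_format, OF i] i cr_FV[OF \<phi> Pplus_L2 node_in[OF i]] by (simp add: L_def diff_eq_eq)
  then show ?thesis by blast
qed

lemma discrete_solution_unique:
  assumes \<phi>: "\<phi> \<in> L2 {-\<tau>..0}"
    and W: "\<And>i. i \<in> {1..N} \<Longrightarrow> W i = cr (FV \<phi> (Pplus h N W)) (node h N i)"
    and W': "\<And>i. i \<in> {1..N} \<Longrightarrow> W' i = cr (FV \<phi> (Pplus h N W')) (node h N i)"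
    and i: "i \<in> {1..N}"
  shows "W i = W' i"
proof -
  have P: "Pplus h N W = (\<lambda>t. Pplus h N (\<lambda>i. W i - W' i) t + Pplus h N W' t)"
    by (rule ext) (simp add: Pplus_diff[OF h_pos N_pos])
  have "W j - W' j = cr (FN (Pplus h N (\<lambda>i. W i - W' i))) (node h N j)" if j: "j \<in> {1..N}" for j
  proof -
    have "cr (FN (Pplus h N W)) (node h N j) =
        cr (FN (Pplus h N (\<lambda>i. W i - W' i))) (node h N j) + cr (FN (Pplus h N W')) (node h N j)"
      by (subst P) (rule cr_FN_add[OF Pplus_L2 Pplus_L2 node_in[OF j]])
    then show ?thesis
      using W[OF j] W'[OF j] cr_FV[OF \<phi> Pplus_L2[of W] node_in[OF j]] cr_FV[OF \<phi> Pplus_L2[of W'] node_in[OF j]]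
      by simp
  qed
  then have "W i - W' i = 0" by (rule discrete_homogeneous_zero[OF _ i])
  then show ?thesis by simp
qed

text \<open>The description operator in \<open>discrete_sol\<close> asks for a unique extensional
  solution. Restricting a solution to \<open>{1..N}\<close> supplies it, as \<open>Pplus\<close>
  reads only these indices.\<close>

lemma discrete_solution:
  assumes \<phi>: "P \<tau> M \<Phi> \<in> L2 {-\<tau>..0}" and i: "i \<in> {1..N}"
  shows "discrete_sol \<tau> s h C M N \<Phi> i =
    cr (FV (P \<tau> M \<Phi>) (Pplus h N (discrete_sol \<tau> s h C M N \<Phi>))) (node h N i)"
proof -
  let ?Q = "\<lambda>W. W \<in> {1..N} \<rightarrow>\<^sub>E UNIV \<and> W = Rplus h N (FV (P \<tau> M \<Phi>) (Pplus h N W))"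
  have iff: "W i = cr (FV (P \<tau> M \<Phi>) (Pplus h N W)) (node h N i)" if "?Q W" "i \<in> {1..N}" for W i
  proof -
    have "W i = Rplus h N (FV (P \<tau> M \<Phi>) (Pplus h N W)) i" using that(1) by metis
    then show ?thesis using that(2) by (simp add: Rplus_def)
  qed
  obtain W0 where W0: "\<forall>i\<in>{1..N}. W0 i = cr (FV (P \<tau> M \<Phi>) (Pplus h N W0)) (node h N i)"
    using discrete_solution_exists[OF \<phi>] ..
  have Q: "Pplus h N (restrict W0 {1..N}) = Pplus h N W0" by (rule Pplus_cong[OF h_pos N_pos]) simp
  have R: "?Q (restrict W0 {1..N})"
  proof
    show "restrict W0 {1..N} = Rplus h N (FV (P \<tau> M \<Phi>) (Pplus h N (restrict W0 {1..N})))"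
      unfolding Q Rplus_def by (rule restrict_ext) (rule W0[rule_format])
  qed simp
  have "W = restrict W0 {1..N}" if W: "?Q W" for W
  proof (rule PiE_ext)
    show "W \<in> {1..N} \<rightarrow>\<^sub>E UNIV" "restrict W0 {1..N} \<in> {1..N} \<rightarrow>\<^sub>E UNIV" using W R by blast+
    show "W i = restrict W0 {1..N} i" if "i \<in> {1..N}" for i
      by (rule discrete_solution_unique[OF \<phi> iff[OF W] iff[OF R] that])
  qed
  with R have "\<exists>!W. ?Q W" by (rule ex1I)
  then have "?Q (discrete_sol \<tau> s h C M N \<Phi>)" unfolding discrete_sol_def by (rule theI')
  then show ?thesis using i by (rule iff)
qed

text \<open>Here \<open>M\<close> counts Legendre terms. The error solves a Volterra equation whose
  remainder is \<open>?q1 + ?q2 - ?q3\<close>: interpolation errors of the past and of the future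
  part, and the image of the Legendre residual. The factor 2 is the cost of absorbing the share of
  the error contained in \<open>?q2\<close>.\<close>

lemma collocation_error:
  assumes \<phi>: "\<phi> \<in> L2 {-\<tau>..0}" and \<eta>: "L2norm {0..h} (FP (residual M \<phi>)) \<le> \<eta> * L2norm {-\<tau>..0} \<phi>"
    and W: "\<And>i. i \<in> {1..N} \<Longrightarrow> W i = cr (FV (legendre_proj (-\<tau>) 0 M \<phi>) (Pplus h N W)) (node h N i)"
  shows "L2norm {0..h} (\<lambda>t. Pplus h N W t - exact \<phi> t) \<le>
    2 * stab * (\<delta> * K3 + \<delta> * K2 * (stab * K3) + \<eta>) * L2norm {-\<tau>..0} \<phi>"
proof -
  let ?p = "legendre_proj (-\<tau>) 0 M \<phi>" and ?w = "Pplus h N W" and ?n = "L2norm {0..h}" and ?B = "L2norm {-\<tau>..0} \<phi>"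
  let ?e = "\<lambda>t. ?w t - exact \<phi> t"
  let ?q1 = "\<lambda>t. interpolant (cr (FP ?p)) t - cr (FP ?p) t" and ?q2 = "\<lambda>t. interpolant (cr (FN ?w)) t - cr (FN ?w) t"
  let ?q3 = "FP (residual M \<phi>)"
  have p: "?p \<in> L2 {-\<tau>..0}" by (rule legendre_sum_L2)
  have w: "?w \<in> L2 {0..h}" by (rule Pplus_L2)
  note x = exact_solution[OF \<phi>]
  have e: "?e \<in> L2 {0..h}" by (intro L2_diff w x)
  have r: "residual M \<phi> \<in> L2 {-\<tau>..0}" by (intro L2_diff \<phi> p)
  have q: "?q1 \<in> L2 {0..h}" "?q2 \<in> L2 {0..h}" "?q3 \<in> L2 {0..h}"
    using L2_diff[OF Pplus_L2 L2_continuous[OF cr_FP(1)[OF p]]]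
      L2_diff[OF Pplus_L2 L2_continuous[OF cr_FN(1)[OF w]]] FP_L2[OF r] by blast+
  have wI: "?w t = interpolant (cr (FP ?p)) t + interpolant (cr (FN ?w)) t" for t
  proof -
    have "?w = Pplus h N (\<lambda>i. cr (FP ?p) (node h N i) + cr (FN ?w) (node h N i))"
      by (rule Pplus_cong[OF h_pos N_pos]) (rule trans[OF W cr_FV[OF p w node_in]])
    then have "?w t = Pplus h N (\<lambda>i. cr (FP ?p) (node h N i) + cr (FN ?w) (node h N i)) t" by (rule fun_cong)
    then show ?thesis by (simp only: Pplus_add[OF h_pos N_pos])
  qed
  have "?n ?e \<le> stab * ?n (\<lambda>t. ?q1 t + ?q2 t - ?q3 t)"
  proof (rule Volterra_stability[OF e])
    show "(\<lambda>t. ?q1 t + ?q2 t - ?q3 t) \<in> L2 {0..h}" by (rule L2_diff[OF L2_add[OF q(1,2)] q(3)])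
    show "AE t in lebesgue_on {0..h}. ?e t = FN ?e t + (?q1 t + ?q2 t - ?q3 t)"
      using AE_good AE_space x(2) cr_FN(2)[OF w] cr_FP(2)[OF p]
    proof eventually_elim
      case (elim t)
      then have t: "t \<in> {0..h}" by simp
      have 1: "FN ?e t = FN ?w t - FN (exact \<phi>) t" by (rule FN_diff[OF t elim(1) w x(1)])
      have 2: "?q3 t = FP \<phi> t - FP ?p t" by (rule FP_diff[OF t elim(1) \<phi> p])
      have 3: "exact \<phi> t = FP \<phi> t + FN (exact \<phi>) t" using elim(3) FV_split[OF t elim(1) \<phi> x(1)] by simp
      show ?case
        using wI[of t] elim(4,5) 3 unfolding 1 2 by simp
    qed
  qed
  also have "?n (\<lambda>t. ?q1 t + ?q2 t - ?q3 t) \<le> ?n ?q1 + ?n ?q2 + ?n ?q3"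
    using L2norm_triangle_diff[OF L2_add[OF q(1,2)] q(3)] L2norm_triangle[OF q(1,2)] by linarith
  finally have 1: "?n ?e \<le> stab * (?n ?q1 + ?n ?q2 + ?n ?q3)" using stab_pos by simp
  \<comment> \<open>The collocation solution has no bound of its own yet; it is estimated through
    the error and the exact solution.\<close>
  have "?n ?w = ?n (\<lambda>t. ?e t + exact \<phi> t)" by simp
  also have "\<dots> \<le> ?n ?e + ?n (exact \<phi>)" by (rule L2norm_triangle[OF e x(1)])
  also have "\<dots> \<le> ?n ?e + stab * (K3 * ?B)" using exact_solution_norm_le[OF \<phi>] by simp
  finally have nw: "?n ?w \<le> ?n ?e + stab * (K3 * ?B)" .
  have "?n ?q1 \<le> \<delta> * (K3 * L2norm {-\<tau>..0} ?p)" by (rule interp_FP[OF p])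
  also have "\<dots> \<le> \<delta> * (K3 * ?B)"
    using tau_pos by (intro mult_left_mono legendre_proj_norm_le \<phi> delta_nonneg K3_nonneg) simp
  finally have n1: "?n ?q1 \<le> \<delta> * (K3 * ?B)" .
  have "?n ?q2 \<le> \<delta> * (K2 * ?n ?w)" by (rule interp_FN[OF w])
  also have "\<dots> \<le> \<delta> * (K2 * (?n ?e + stab * (K3 * ?B)))"
    by (intro mult_left_mono nw delta_nonneg K2_nonneg)
  finally have n2: "?n ?q2 \<le> \<delta> * (K2 * (?n ?e + stab * (K3 * ?B)))" .
  have "?n ?q1 + ?n ?q2 + ?n ?q3 \<le> \<delta> * (K3 * ?B) + \<delta> * (K2 * (?n ?e + stab * (K3 * ?B))) + \<eta> * ?B"
    using n1 n2 \<eta> by (intro add_mono)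
  then have "stab * (?n ?q1 + ?n ?q2 + ?n ?q3) \<le>
      stab * (\<delta> * (K3 * ?B) + \<delta> * (K2 * (?n ?e + stab * (K3 * ?B))) + \<eta> * ?B)"
    using stab_pos by (intro mult_left_mono) auto
  with 1 have "?n ?e \<le> stab * (\<delta> * (K3 * ?B) + \<delta> * (K2 * (?n ?e + stab * (K3 * ?B))) + \<eta> * ?B)"
    by (rule order_trans)
  also have "\<dots> = (stab * \<delta> * K2) * ?n ?e + stab * (\<delta> * K3 + \<delta> * K2 * (stab * K3) + \<eta>) * ?B"
    by (simp add: algebra_simps)
  \<comment> \<open>This half of the error moves to the left-hand side.\<close>
  also have "(stab * \<delta> * K2) * ?n ?e \<le> (1 / 2) * ?n ?e" by (intro mult_right_mono delta_small) simp
  finally have "?n ?e \<le> 2 * (stab * (\<delta> * K3 + \<delta> * K2 * (stab * K3) + \<eta>) * ?B)" by simp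
  then show ?thesis by (simp add: mult.assoc)
qed

section \<open>From the collocation error to the difference of the operators\<close>

lemma segment_L2:
  assumes "\<phi> \<in> L2 {-\<tau>..0}" "w \<in> L2 {0..h}"
  shows "segment_at h (V \<phi> w) \<in> L2 {-\<tau>..0}"
proof -
  have v: "V \<phi> w \<in> L2 {-\<tau>..h}" using assms tau_pos h_pos by (intro V_L2) auto
  have "V \<phi> w \<in> L2 {h + -\<tau>..h + 0}" using h_pos by (intro L2_subinterval[OF v]) auto
  then show ?thesis unfolding segment_at_def by (rule L2_translate)
qed

text \<open>Because of \<open>h \<ge> \<tau>\<close> the segment lies in the future, except possibly
  at \<theta> = -h, where \<open>V\<close> takes its value from the past.\<close>

lemma AE_segment: "AE \<theta> in lebesgue_on {-\<tau>..0}. segment_at h (V \<phi> w) \<theta> = w (h + \<theta>)"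
  using AE_lebesgue_on_neq[where c = "- h"] AE_space
  by eventually_elim (use h_ge in \<open>auto simp: segment_at_def V_def\<close>)

text \<open>Only almost everywhere is the segment a polynomial of degree at most \<open>M\<close>.
  Legendre coefficients are integrals and do not see the difference, and the projection fixes the
  polynomial.\<close>

lemma T_discrete_eq:
  assumes \<phi>: "\<phi> \<in> L2 {-\<tau>..0}" and M: "N - 1 \<le> M"
  shows "T_discrete \<tau> s h C M N \<phi> = (\<lambda>\<theta>. Pplus h N (discrete_sol \<tau> s h C M N (R \<tau> M \<phi>)) (h + \<theta>))"
proof -
  let ?w = "Pplus h N (discrete_sol \<tau> s h C M N (R \<tau> M \<phi>))" and ?p = "P \<tau> M (R \<tau> M \<phi>)"
  have p: "?p \<in> L2 {-\<tau>..0}" using P_R_eq_legendre_proj[OF tau_pos \<phi>] legendre_sum_L2 by simp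
  have sg: "segment_at h (V ?p ?w) \<in> L2 {-\<tau>..0}" by (rule segment_L2[OF p Pplus_L2])
  have "vec_poly M ?w" by (rule vec_poly_mono[OF Pplus_vec_poly[OF h_pos N_pos] M])
  then have vp: "vec_poly M (\<lambda>\<theta>. ?w (h + \<theta>))" by (rule vec_poly_translate)
  have "T_discrete \<tau> s h C M N \<phi> = legendre_proj (-\<tau>) 0 (Suc M) (segment_at h (V ?p ?w))"
    unfolding T_discrete_def T_matrix_def by (rule P_R_eq_legendre_proj[OF tau_pos sg])
  also have "\<dots> = legendre_proj (-\<tau>) 0 (Suc M) (\<lambda>\<theta>. ?w (h + \<theta>))"
    using legendre_coeff_cong_AE[OF sg vec_poly_L2[OF vp] AE_segment] by simp
  also have "\<dots> = (\<lambda>\<theta>. ?w (h + \<theta>))" using tau_pos by (intro legendre_proj_vec_poly vp) simp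
  finally show ?thesis .
qed

text \<open>The residual carries \<open>Suc M\<close> because \<open>R \<tau> M\<close> keeps
  \<open>M + 1\<close> coefficients. The final segment is part of the future interval, so the
  collocation error dominates the difference.\<close>

lemma T_discrete_error:
  assumes \<phi>: "\<phi> \<in> L2 {-\<tau>..0}" and M: "N - 1 \<le> M"
    and \<eta>: "L2norm {0..h} (FP (residual (Suc M) \<phi>)) \<le> \<eta> * L2norm {-\<tau>..0} \<phi>"
  shows "(\<lambda>\<theta>. T_discrete \<tau> s h C M N \<phi> \<theta> - T \<tau> s h C \<phi> \<theta>) \<in> L2 {-\<tau>..0}"
    and "L2norm {-\<tau>..0} (\<lambda>\<theta>. T_discrete \<tau> s h C M N \<phi> \<theta> - T \<tau> s h C \<phi> \<theta>) \<le>
      2 * stab * (\<delta> * K3 + \<delta> * K2 * (stab * K3) + \<eta>) * L2norm {-\<tau>..0} \<phi>"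
proof -
  let ?W = "discrete_sol \<tau> s h C M N (R \<tau> M \<phi>)"
  let ?w = "Pplus h N ?W" and ?E = "\<lambda>\<theta>. T_discrete \<tau> s h C M N \<phi> \<theta> - T \<tau> s h C \<phi> \<theta>"
  let ?e = "\<lambda>t. ?w t - exact \<phi> t"
  have pr: "P \<tau> M (R \<tau> M \<phi>) = legendre_proj (-\<tau>) 0 (Suc M) \<phi>" by (rule P_R_eq_legendre_proj[OF tau_pos \<phi>])
  have p: "P \<tau> M (R \<tau> M \<phi>) \<in> L2 {-\<tau>..0}" unfolding pr by (rule legendre_sum_L2)
  have x: "exact \<phi> \<in> L2 {0..h}" by (rule exact_solution(1)[OF \<phi>])
  have e: "?e \<in> L2 {0..h}" by (intro L2_diff Pplus_L2 x)
  have sub: "{h + -\<tau>..h + 0} \<subseteq> {0..h}" using h_ge by auto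
  have eh: "?e \<in> L2 {h + -\<tau>..h + 0}" by (rule L2_subinterval[OF e sub])
  have et: "(\<lambda>\<theta>. ?e (h + \<theta>)) \<in> L2 {-\<tau>..0}" by (rule L2_translate[OF eh])
  have ae: "AE \<theta> in lebesgue_on {-\<tau>..0}. ?e (h + \<theta>) = ?E \<theta>"
    using AE_segment[of \<phi> "exact \<phi>"]
    by eventually_elim (simp add: T_discrete_eq[OF \<phi> M] T_def)
  show E: "?E \<in> L2 {-\<tau>..0}" by (rule L2_cong_AE[OF et _ ae]) simp
  have "L2norm {-\<tau>..0} ?E = L2norm {-\<tau>..0} (\<lambda>\<theta>. ?e (h + \<theta>))"
    by (rule L2norm_cong_AE[OF L2_measurable[OF et] L2_measurable[OF E] ae, symmetric])
  also have "\<dots> = L2norm {h + -\<tau>..h + 0} ?e" by (rule L2norm_translate)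
  also have "\<dots> \<le> L2norm {0..h} ?e" by (rule L2norm_subinterval_le[OF e sub])
  also have "\<dots> \<le> 2 * stab * (\<delta> * K3 + \<delta> * K2 * (stab * K3) + \<eta>) * L2norm {-\<tau>..0} \<phi>"
    by (rule collocation_error[OF \<phi> \<eta>]) (rule discrete_solution[OF p, unfolded pr])
  finally show "L2norm {-\<tau>..0} ?E \<le> 2 * stab * (\<delta> * K3 + \<delta> * K2 * (stab * K3) + \<eta>) * L2norm {-\<tau>..0} \<phi>" .
qed

end

theorem theorem3p8:
  fixes C :: "real \<Rightarrow> real \<Rightarrow> real^'d^'d" and \<tau> s h :: real
  assumes tau_pos: "\<tau> > 0" and h_ge: "h \<ge> \<tau>"
    and C_meas: "(\<lambda>(t, \<theta>). C t \<theta>) \<in> borel_measurable (lebesgue_on ({s..} \<times> {-\<tau>..0}))"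
    and H1_bdd: "\<exists>K. AE (t, \<theta>) in lebesgue_on ({s..s+h} \<times> {-\<tau>..0}). norm (C t \<theta>) \<le> K"
    and H2_range: "\<forall>w\<in>L2 {0..h}. F \<tau> s C (V (\<lambda>_. 0) w) \<in> H1 0 h"
    and H2_bdd: "\<exists>K. \<forall>w\<in>L2 {0..h}. H1norm 0 h (F \<tau> s C (V (\<lambda>_. 0) w)) \<le> K * L2norm {0..h} w"
    and H3_range: "\<forall>\<phi>\<in>L2 {-\<tau>..0}. F \<tau> s C (V \<phi> (\<lambda>_. 0)) \<in> H1 0 h"
    and H3_bdd: "\<exists>K. \<forall>\<phi>\<in>L2 {-\<tau>..0}. H1norm 0 h (F \<tau> s C (V \<phi> (\<lambda>_. 0))) \<le> K * L2norm {-\<tau>..0} \<phi>"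
  shows "\<forall>\<epsilon>>0. \<exists>N1. \<forall>N M. N \<ge> 1 \<and> M \<ge> 1 \<and> N \<ge> N1 \<and> M \<ge> N - 1 \<longrightarrow>
           L2_opnorm {-\<tau>..0} (\<lambda>\<phi> \<theta>. T_discrete \<tau> s h C M N \<phi> \<theta> - T \<tau> s h C \<phi> \<theta>) < ereal \<epsilon>"
proof -
  obtain K where K: "AE x in lebesgue_on ({s..s+h} \<times> {-\<tau>..0}). case x of (t, \<theta>) \<Rightarrow> norm (C t \<theta>) \<le> K"
    using H1_bdd by blast
  obtain K2 where K2: "\<forall>w\<in>L2 {0..h}. H1norm 0 h (F \<tau> s C (V (\<lambda>_. 0) w)) \<le> K2 * L2norm {0..h} w"
    using H2_bdd by blast
  obtain K3 where K3: "\<forall>\<phi>\<in>L2 {-\<tau>..0}. H1norm 0 h (F \<tau> s C (V \<phi> (\<lambda>_. 0))) \<le> K3 * L2norm {-\<tau>..0} \<phi>"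
    using H3_bdd by blast
  \<comment> \<open>The bounds in the hypotheses may be negative numbers; the maximum with 0 makes
    them usable as factors in estimates.\<close>
  interpret renewal C \<tau> s h "max K 0" "max K2 0" "max K3 0"
  proof
    show "AE (t, \<theta>) in lebesgue_on ({s..s+h} \<times> {-\<tau>..0}). norm (C t \<theta>) \<le> max K 0"
      using K by eventually_elim auto
    show "H1norm 0 h (F \<tau> s C (V (\<lambda>_. 0) w)) \<le> max K2 0 * L2norm {0..h} w" if "w \<in> L2 {0..h}" for w
      using K2[rule_format, OF that] mult_right_mono[of K2 "max K2 0" "L2norm {0..h} w"] by simp
    show "H1norm 0 h (F \<tau> s C (V \<phi> (\<lambda>_. 0))) \<le> max K3 0 * L2norm {-\<tau>..0} \<phi>" if "\<phi> \<in> L2 {-\<tau>..0}" for \<phi>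
      using K3[rule_format, OF that] mult_right_mono[of K3 "max K3 0" "L2norm {-\<tau>..0} \<phi>"] by simp
  qed (use assms in auto)
  show ?thesis
  proof (intro allI impI)
    fix \<epsilon> :: real assume \<epsilon>: "0 < \<epsilon>"
    \<comment> \<open>The coefficient of \<delta> in the constant of
      \<open>T_discrete_error\<close>, enlarged by 1 to allow division.\<close>
    define A where "A = max K3 0 + max K2 0 * (stab * max K3 0) + 1"
    have A: "1 \<le> A" using stab_pos by (simp add: A_def)
    \<comment> \<open>The first entry yields \<open>delta_small\<close>; the second makes the
      \<delta> part of the error constant at most \<epsilon> / 4.\<close>
    define \<delta> where "\<delta> = min (1 / (2 * (stab * max K2 0 + 1))) (\<epsilon> / (8 * stab * A))"
    have b0: "0 < stab * max K2 0 + 1" using stab_pos by (intro add_nonneg_pos mult_nonneg_nonneg) auto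
    then have \<delta>: "0 < \<delta>" using \<epsilon> stab_pos A by (simp add: \<delta>_def)
    have "stab * \<delta> * max K2 0 = \<delta> * (stab * max K2 0)" by simp
    also have "\<dots> \<le> 1 / (2 * (stab * max K2 0 + 1)) * (stab * max K2 0 + 1)"
      using \<delta> stab_pos by (intro mult_mono) (auto simp: \<delta>_def)
    also have "\<dots> = 1 / 2" using b0 by simp
    finally have small: "stab * \<delta> * max K2 0 \<le> 1 / 2" .
    have "\<delta> * (8 * stab * A) \<le> \<epsilon> / (8 * stab * A) * (8 * stab * A)"
      using stab_pos A by (intro mult_right_mono) (auto simp: \<delta>_def)
    then have \<delta>A: "8 * stab * \<delta> * A \<le> \<epsilon>" using stab_pos A by (simp add: mult_ac)
    \<comment> \<open>Contributes the other \<epsilon> / 4 through \<open>2 * stab * \<eta>\<close>.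
      The total \<epsilon> / 2 leaves room for the strict inequality.\<close>
    define \<eta> where "\<eta> = \<epsilon> / (8 * stab)"
    have \<eta>: "0 < \<eta>" "8 * stab * \<eta> = \<epsilon>" using \<epsilon> stab_pos by (simp_all add: \<eta>_def)
    obtain N0 where N0: "1 \<le> N0" "\<And>N (f :: real \<Rightarrow> real^'d). N0 \<le> N \<Longrightarrow> f \<in> H1 0 h \<Longrightarrow>
        L2norm {0..h} (\<lambda>t. cont_rep 0 h f t - Pplus h N (\<lambda>i. cont_rep 0 h f (node h N i)) t) \<le> \<delta> * H1norm 0 h f"
      using H1_interpolation_error[OF h_pos \<delta>, where 'd = 'd] by blast
    obtain M0 where M0: "\<And>M \<phi>. M0 \<le> M \<Longrightarrow> \<phi> \<in> L2 {-\<tau>..0} \<Longrightarrow>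
        L2norm {0..h} (FP (residual M \<phi>)) \<le> \<eta> * L2norm {-\<tau>..0} \<phi>"
      using FP_residual_small[OF \<eta>(1)] by blast
    show "\<exists>N1. \<forall>N M. N \<ge> 1 \<and> M \<ge> 1 \<and> N \<ge> N1 \<and> M \<ge> N - 1 \<longrightarrow>
           L2_opnorm {-\<tau>..0} (\<lambda>\<phi> \<theta>. T_discrete \<tau> s h C M N \<phi> \<theta> - T \<tau> s h C \<phi> \<theta>) < ereal \<epsilon>"
    proof (intro exI[of _ "max N0 M0"] allI impI)
      fix N M assume NM: "N \<ge> 1 \<and> M \<ge> 1 \<and> N \<ge> max N0 M0 \<and> M \<ge> N - 1"
      interpret renewal_discrete C \<tau> s h "max K 0" "max K2 0" "max K3 0" N \<delta>
        by unfold_locales (use NM N0(2) \<delta> small in auto)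
      let ?E = "\<lambda>\<phi> \<theta>. T_discrete \<tau> s h C M N \<phi> \<theta> - T \<tau> s h C \<phi> \<theta>"
      let ?c = "2 * stab * (\<delta> * max K3 0 + \<delta> * max K2 0 * (stab * max K3 0) + \<eta>)"
      have "?c \<le> 2 * stab * (\<delta> * A + \<eta>)"
        using stab_pos \<delta> by (intro mult_left_mono add_right_mono) (simp_all add: A_def algebra_simps)
      also have "\<dots> \<le> \<epsilon> / 2" using \<delta>A \<eta>(2) by (simp add: algebra_simps)
      finally have c: "?c \<le> \<epsilon> / 2" .
      have "?E \<phi> \<in> L2 {-\<tau>..0} \<and> L2norm {-\<tau>..0} (?E \<phi>) \<le> \<epsilon> / 2 * L2norm {-\<tau>..0} \<phi>"
        if \<phi>: "\<phi> \<in> L2 {-\<tau>..0}" for \<phi>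
      proof -
        \<comment> \<open>From \<open>M0 \<le> N\<close> and \<open>N - 1 \<le> M\<close>: a lower
          bound on \<open>N\<close> also makes the number \<open>Suc M\<close> of Legendre terms
          large enough.\<close>
        have M: "N - 1 \<le> M" "M0 \<le> Suc M" using NM by auto
        note err = T_discrete_error[OF \<phi> M(1) M0[OF M(2) \<phi>]]
        show ?thesis using err(1) order_trans[OF err(2) mult_right_mono[OF c L2norm_nonneg]] by blast
      qed
      then have "ereal (\<epsilon> / 2) \<in> {ereal K | K. 0 \<le> K \<and>
          (\<forall>\<phi>\<in>L2 {-\<tau>..0}. ?E \<phi> \<in> L2 {-\<tau>..0} \<and> L2norm {-\<tau>..0} (?E \<phi>) \<le> K * L2norm {-\<tau>..0} \<phi>)}"
        using \<epsilon> by (intro CollectI exI[of _ "\<epsilon> / 2"]) auto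
      then have "L2_opnorm {-\<tau>..0} ?E \<le> ereal (\<epsilon> / 2)" unfolding L2_opnorm_def by (rule Inf_lower)
      also have "\<dots> < ereal \<epsilon>" using \<epsilon> by simp
      finally show "L2_opnorm {-\<tau>..0} ?E < ereal \<epsilon>" .
    qed
  qed
qed

end
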